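(* Let $(A^{(1)},\ldots,A^{(k)},\sigma)$ be a fully coisometric representation of a product system of $C^*$-correspondences $E$ over $\mathbb{N}^k$ on a Hilbert space $\mathcal{V}$, with minimal isometric dilation $(S^{(1)},\ldots,S^{(k)},\rho)$ on a Hilbert space $\mathcal{H}$. If $\mathbf{n}=(n_1,\ldots,n_k)\in\mathbb{N}^k$ satisfies $n_i\neq0$ for $1\leq i\leq k$, then the representation $(S_\mathbf{n},\rho)$ of the $C^*$-correspondence $E(\mathbf{n})$ is the (unique) minimal isometric dilation of the representation $(A_\mathbf{n},\sigma)$ of $E(\mathbf n)$.
   Context: Conventions. All $C^*$-algebras and their representations on Hilbert spaces are unital; $\mathbb N=\{0,1,2,\dots\}$. A $C^*$-correspondence over $\mathcal A$ is a right Hilbert $C^*$-module over $\mathcal A$ with a left action of $\mathcal A$ by adjointable operators given by a $*$-homomorphism; tensor products are interior tensor products. A representation $(A,\sigma)$ of a $C^*$-correspondence $F$ over $\mathcal A$ on $\mathcal V$ is a completely contractive linear map $A:F\to\mathcal B(\mathcal V)$ and a unital representation $\sigma$ of $\mathcal A$ on $\mathcal V$ with $A(a\xi b)=\sigma(a)A(\xi)\sigma(b)$. $F\otimes_\sigma\mathcal V$ is the Hausdorff completion of the algebraic tensor product for $\langle\xi_1\otimes h_1,\xi_2\otimes h_2\rangle=\langle h_1,\sigma(\langle\xi_1,\xi_2\rangle)h_2\rangle$, and $\tilde A(\xi\otimes h)=A(\xi)h$ is a contraction $F\otimes_\sigma\mathcal V\to\mathcal V$. $(A,\sigma)$ is isometric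 if $A(\xi)^*A(\eta)=\sigma(\langle\xi,\eta\rangle)$ for all $\xi,\eta$ (equivalently $\tilde A$ is an isometry), fully coisometric if $\tilde A\tilde A^*=I$. $\tilde A_m:F^m\otimes_\sigma\mathcal V\to\mathcal V$ is $\tilde A_m(\xi_1\otimes\cdots\otimes\xi_m\otimes h)=A(\xi_1)\cdots A(\xi_m)h$, where $F^m$ is the $m$-fold tensor power and $F^0=\mathcal A$. A representation $(S,\rho)$ of $F$ on $\mathcal H\supseteq\mathcal V$ dilates $(A,\sigma)$ if $\mathcal V$ reduces $\rho$ with $\rho(a)|_{\mathcal V}=\sigma(a)$, $\mathcal V^\perp$ is invariant under all $S(\xi)$, and $P_{\mathcal V}S(\xi)|_{\mathcal V}=A(\xi)$. The dilation is isometric if $(S,\rho)$ is isometric, and minimal if $\mathcal H=\bigvee_{m\ge0}\tilde S_m(F^m\otimes\mathcal V)$. The minimal isometric dilation of a representation of a single correspondence exists and is unique up to unitary equivalence fixing $\mathcal V$. Product systems. A product system of $C^*$-correspondences over $\mathbb N^k$ (with coefficient algebra $\mathcal A$) is a semigroup $E$ with a semigroup homomorphism $p:E\to\mathbb N^k$ such that each $E(\mathbf n)=p^{-1}(\mathbf n)$ is a $C^*$-correspondence over $\mathcal A$, $E(\mathbf 0)=\mathcal A$, and multiplication $E(\mathbf n)\times E(\mathbf m)\to E(\mathbf n+\mathbf m)$ extends to an isomorphism $E(\mathbf n)\otimes E(\mathbf m)\cong E(\mathbf n+\mathbf m)$. With $\mathbf e_1,\dots,\mathbf e_k$ the standard generators,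 $E_i=E(\mathbf e_i)$; the isomorphisms $E_i\otimes E_j\cong E(\mathbf e_i+\mathbf e_j)\cong E_j\otimes E_i$ give isomorphisms $t_{i,j}:E_i\otimes E_j\to E_j\otimes E_i$ ($t_{i,i}$ is the identity). $E(\mathbf n)$ is identified with $E_1^{n_1}\otimes\cdots\otimes E_k^{n_k}$. A representation $(A^{(1)},\dots,A^{(k)},\sigma)$ of $E$ on $\mathcal V$ consists of representations $(A^{(i)},\sigma)$ of $E_i$ on $\mathcal V$ with $\tilde A^{(i)}(I_{E_i}\otimes\tilde A^{(j)})=\tilde A^{(j)}(I_{E_j}\otimes\tilde A^{(i)})(t_{i,j}\otimes I_{\mathcal V})$ for all $i,j$. It is isometric (fully coisometric) if each $(A^{(i)},\sigma)$ is. For $\mathbf n\in\mathbb N^k$, $\tilde A_{\mathbf n}=\tilde A^{(1)}_{n_1}(I_{E_1^{n_1}}\otimes\tilde A^{(2)}_{n_2})\cdots(I_{E_1^{n_1}}\otimes\cdots\otimes I_{E_{k-1}^{n_{k-1}}}\otimes\tilde A^{(k)}_{n_k}):E(\mathbf n)\otimes_\sigma\mathcal V\to\mathcal V$, and $(A_{\mathbf n},\sigma)$ is the representation of $E(\mathbf n)$ given by $A_{\mathbf n}(\xi)h=\tilde A_{\mathbf n}(\xi\otimes h)$. A representation $(S^{(1)},\dots,S^{(k)},\rho)$ of $E$ on $\mathcal H\supseteq\mathcal V$ dilates $(A^{(1)},\dots,A^{(k)},\sigma)$ if each $(S^{(i)},\rho)$ dilates $(A^{(i)},\sigma)$; it is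 an isometric dilation if it is an isometric representation, and minimal if $\mathcal H=\bigvee_{\mathbf n\in\mathbb N^k}\tilde S_{\mathbf n}(E(\mathbf n)\otimes\mathcal V)$. Fully coisometric representations of $E$ have a minimal isometric dilation, unique up to unitary equivalence. *)

theory Defs
  imports "HOL-Analysis.Analysis"
begin

section \<open>C*-algebras and Hilbert spaces\<close>

class scaleC = scaleR +
  fixes scaleC :: "complex \<Rightarrow> 'a \<Rightarrow> 'a" (infixr "*\<^sub>C" 75)

class complex_vector = scaleC + real_vector +
  assumes scaleC_add_right: "c *\<^sub>C (x + y) = c *\<^sub>C x + c *\<^sub>C y"
    and scaleC_add_left: "(c + d) *\<^sub>C x = c *\<^sub>C x + d *\<^sub>C x"
    and scaleC_scaleC: "c *\<^sub>C (d *\<^sub>C x) = (c * d) *\<^sub>C x"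
    and scaleR_eq_scaleC: "r *\<^sub>R x = complex_of_real r *\<^sub>C x"

text \<open>Unital C*-algebras. The class \<^class>\<open>monoid_mult\<close> is used instead of \<^class>\<open>ring_1\<close> in order
  not to exclude the zero algebra.\<close>

class cstar_algebra = complex_vector + real_normed_algebra + banach + monoid_mult +
  fixes star :: "'a \<Rightarrow> 'a"
  assumes scaleC_mult_left: "(c *\<^sub>C a) * b = c *\<^sub>C (a * b)"
    and scaleC_mult_right: "a * (c *\<^sub>C b) = c *\<^sub>C (a * b)"
    and norm_scaleC: "norm (c *\<^sub>C a) = cmod c * norm a"
    and star_add: "star (a + b) = star a + star b"
    and star_scaleC: "star (c *\<^sub>C a) = cnj c *\<^sub>C star a"
    and star_mult: "star (a * b) = star b * star a"
    and star_star: "star (star a) = a"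
    and cstar_identity: "norm (star a * a) = (norm a)\<^sup>2"

definition cstar_pos :: "'a::cstar_algebra \<Rightarrow> bool" where
  "cstar_pos a \<longleftrightarrow> (\<exists>b. a = star b * b)"

text \<open>All inner products are conjugate linear in the first and linear in the second variable.\<close>

class chilbert_space = complex_vector + banach +
  fixes cinner :: "'a \<Rightarrow> 'a \<Rightarrow> complex"
  assumes cinner_add_right: "cinner x (y + z) = cinner x y + cinner x z"
    and cinner_scaleC_right: "cinner x (c *\<^sub>C y) = c * cinner x y"
    and cinner_commute: "cinner y x = cnj (cinner x y)"
    and cinner_ge_zero: "0 \<le> Re (cinner x x)"
    and norm_eq_sqrt_cinner: "norm x = sqrt (Re (cinner x x))"

definition csubspace :: "'h::chilbert_space set \<Rightarrow> bool" where
  "csubspace M \<longleftrightarrow> 0 \<in> M \<and> (\<forall>x\<in>M. \<forall>y\<in>M. x + y \<in> M) \<and> (\<forall>c. \<forall>x\<in>M. c *\<^sub>C x \<in> M)"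

definition closed_span :: "'h::chilbert_space set \<Rightarrow> 'h set" where
  "closed_span S = \<Inter>{M. csubspace M \<and> closed M \<and> S \<subseteq> M}"

definition orth :: "'h::chilbert_space set \<Rightarrow> 'h set" where
  "orth M = {x. \<forall>y\<in>M. cinner y x = 0}"

definition orth_proj :: "'h::chilbert_space set \<Rightarrow> 'h \<Rightarrow> 'h" where
  "orth_proj M x = (THE p. p \<in> M \<and> x - p \<in> orth M)"

text \<open>Hilbert spaces with an explicit carrier; needed for tensor products, whose carrier
  depends on the representation.\<close>

record 'x hspace =
  hcar :: "'x set"
  hadd :: "'x \<Rightarrow> 'x \<Rightarrow> 'x"
  hscale :: "complex \<Rightarrow> 'x \<Rightarrow> 'x"
  hip :: "'x \<Rightarrow> 'x \<Rightarrow> complex"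

definition whole :: "'h::chilbert_space hspace" where
  "whole = \<lparr>hcar = UNIV, hadd = (+), hscale = scaleC, hip = cinner\<rparr>"

definition hnorm :: "'x hspace \<Rightarrow> 'x \<Rightarrow> real" where
  "hnorm X x = sqrt (Re (hip X x x))"

definition bounded_op :: "'x hspace \<Rightarrow> 'y hspace \<Rightarrow> ('x \<Rightarrow> 'y) \<Rightarrow> bool" where
  "bounded_op X Y T \<longleftrightarrow>
     (\<forall>x\<in>hcar X. T x \<in> hcar Y) \<and>
     (\<forall>x\<in>hcar X. \<forall>y\<in>hcar X. T (hadd X x y) = hadd Y (T x) (T y)) \<and>
     (\<forall>c. \<forall>x\<in>hcar X. T (hscale X c x) = hscale Y c (T x)) \<and>
     (\<exists>K. \<forall>x\<in>hcar X. hnorm Y (T x) \<le> K * hnorm X x)"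

definition adj :: "'x hspace \<Rightarrow> 'y hspace \<Rightarrow> ('x \<Rightarrow> 'y) \<Rightarrow> 'y \<Rightarrow> 'x" where
  "adj X Y T y = (THE x. x \<in> hcar X \<and> (\<forall>z\<in>hcar X. hip X z x = hip Y (T z) y))"

text \<open>The bounded operator from \<open>X\<close> to \<open>Y\<close> with \<open>e w \<mapsto> t w\<close> for \<open>w \<in> G\<close>, where
  the vectors \<open>e w\<close> form a total set.\<close>

definition ext_op ::
  "'x hspace \<Rightarrow> 'y hspace \<Rightarrow> 'w set \<Rightarrow> ('w \<Rightarrow> 'x) \<Rightarrow> ('w \<Rightarrow> 'y) \<Rightarrow> 'x \<Rightarrow> 'y" where
  "ext_op X Y G e t =
     (THE T. T \<in> extensional (hcar X) \<and> bounded_op X Y T \<and> (\<forall>w\<in>G. T (e w) = t w))"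


section \<open>Hilbert modules and C*-correspondences\<close>

record ('a, 'e) corr =
  mcar :: "'e set"
  madd :: "'e \<Rightarrow> 'e \<Rightarrow> 'e"
  mzero :: 'e
  mscale :: "complex \<Rightarrow> 'e \<Rightarrow> 'e"
  ract :: "'e \<Rightarrow> 'a \<Rightarrow> 'e"
  lact :: "'a \<Rightarrow> 'e \<Rightarrow> 'e"
  mip :: "'e \<Rightarrow> 'e \<Rightarrow> 'a"

definition mdist :: "('a::cstar_algebra, 'e) corr \<Rightarrow> 'e \<Rightarrow> 'e \<Rightarrow> real" where
  "mdist F x y = (let d = madd F x (mscale F (- 1) y) in sqrt (norm (mip F d d)))"

definition hilbert_module :: "('a::cstar_algebra, 'e) corr \<Rightarrow> bool" where
  "hilbert_module F \<longleftrightarrow>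
     \<comment> \<open>complex vector space\<close>
     mzero F \<in> mcar F \<and>
     (\<forall>x\<in>mcar F. \<forall>y\<in>mcar F. madd F x y \<in> mcar F \<and> madd F x y = madd F y x) \<and>
     (\<forall>x\<in>mcar F. \<forall>y\<in>mcar F. \<forall>z\<in>mcar F. madd F (madd F x y) z = madd F x (madd F y z)) \<and>
     (\<forall>x\<in>mcar F. madd F (mzero F) x = x \<and> madd F x (mscale F (- 1) x) = mzero F) \<and>
     (\<forall>c. \<forall>x\<in>mcar F. mscale F c x \<in> mcar F) \<and>
     (\<forall>c. \<forall>x\<in>mcar F. \<forall>y\<in>mcar F.
        mscale F c (madd F x y) = madd F (mscale F c x) (mscale F c y)) \<and>
     (\<forall>c d. \<forall>x\<in>mcar F. mscale F (c + d) x = madd F (mscale F c x) (mscale F d x) \<and>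
        mscale F c (mscale F d x) = mscale F (c * d) x) \<and>
     (\<forall>x\<in>mcar F. mscale F 1 x = x) \<and>
     \<comment> \<open>right module\<close>
     (\<forall>x\<in>mcar F. \<forall>a. ract F x a \<in> mcar F) \<and>
     (\<forall>x\<in>mcar F. \<forall>y\<in>mcar F. \<forall>a. ract F (madd F x y) a = madd F (ract F x a) (ract F y a)) \<and>
     (\<forall>x\<in>mcar F. \<forall>a b. ract F x (a + b) = madd F (ract F x a) (ract F x b) \<and>
        ract F x (a * b) = ract F (ract F x a) b) \<and>
     (\<forall>x\<in>mcar F. ract F x 1 = x) \<and>
     (\<forall>x\<in>mcar F. \<forall>c a. ract F (mscale F c x) a = mscale F c (ract F x a) \<and>
        ract F x (c *\<^sub>C a) = mscale F c (ract F x a)) \<and>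
     \<comment> \<open>inner product\<close>
     (\<forall>x\<in>mcar F. \<forall>y\<in>mcar F. \<forall>z\<in>mcar F. mip F x (madd F y z) = mip F x y + mip F x z) \<and>
     (\<forall>x\<in>mcar F. \<forall>y\<in>mcar F. \<forall>c. mip F x (mscale F c y) = c *\<^sub>C mip F x y) \<and>
     (\<forall>x\<in>mcar F. \<forall>y\<in>mcar F. \<forall>a. mip F x (ract F y a) = mip F x y * a) \<and>
     (\<forall>x\<in>mcar F. \<forall>y\<in>mcar F. star (mip F x y) = mip F y x) \<and>
     (\<forall>x\<in>mcar F. cstar_pos (mip F x x) \<and> (mip F x x = 0 \<longrightarrow> x = mzero F)) \<and>
     \<comment> \<open>completeness\<close>
     (\<forall>s. (\<forall>n::nat. s n \<in> mcar F) \<and>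
          (\<forall>\<epsilon>>0. \<exists>N. \<forall>m\<ge>N. \<forall>n\<ge>N. mdist F (s m) (s n) < \<epsilon>) \<longrightarrow>
          (\<exists>x\<in>mcar F. (\<lambda>n. mdist F (s n) x) \<longlonglongrightarrow> 0))"

text \<open>The clause \<open>\<langle>a x, y\<rangle> = \<langle>x, a\<^sup>* y\<rangle>\<close> says that \<open>a\<close> acts by an adjointable operator and that the
  action preserves the involution.\<close>

definition correspondence :: "('a::cstar_algebra, 'e) corr \<Rightarrow> bool" where
  "correspondence F \<longleftrightarrow> hilbert_module F \<and>
     (\<forall>x\<in>mcar F. \<forall>a. lact F a x \<in> mcar F) \<and>
     (\<forall>x\<in>mcar F. \<forall>y\<in>mcar F. \<forall>a. lact F a (madd F x y) = madd F (lact F a x) (lact F a y)) \<and>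
     (\<forall>x\<in>mcar F. \<forall>a c. lact F a (mscale F c x) = mscale F c (lact F a x)) \<and>
     (\<forall>x\<in>mcar F. \<forall>a b. lact F a (ract F x b) = ract F (lact F a x) b) \<and>
     (\<forall>x\<in>mcar F. \<forall>y\<in>mcar F. \<forall>a. mip F (lact F a x) y = mip F x (lact F (star a) y)) \<and>
     (\<forall>x\<in>mcar F. \<forall>a b. lact F (a + b) x = madd F (lact F a x) (lact F b x)) \<and>
     (\<forall>x\<in>mcar F. \<forall>a c. lact F (c *\<^sub>C a) x = mscale F c (lact F a x)) \<and>
     (\<forall>x\<in>mcar F. \<forall>a b. lact F (a * b) x = lact F a (lact F b x))"

inductive_set mspan :: "('a, 'e) corr \<Rightarrow> 'e set \<Rightarrow> 'e set"
  for F :: "('a, 'e) corr" and S :: "'e set" where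
  "mzero F \<in> mspan F S"
| "x \<in> mspan F S \<Longrightarrow> y \<in> S \<Longrightarrow> madd F x (mscale F c y) \<in> mspan F S"

text \<open>\<open>T\<close>, with \<open>\<tau> x y\<close> in the role of \<open>x \<otimes> y\<close>, is the interior tensor product
  \<open>F \<otimes> G\<close>: the linear map induced by \<open>\<tau>\<close> on the algebraic tensor product is an isometric
  bimodule map, for the semi-inner product \<open>\<langle>x \<otimes> y, x' \<otimes> y'\<rangle> = \<langle>y, \<langle>x, x'\<rangle> y'\<rangle>\<close>, with dense range
  in the complete module \<open>T\<close>. Equivalently, it extends to an isomorphism of the Hausdorff
  completion onto \<open>T\<close>.\<close>

definition is_interior_tensor ::
  "('a::cstar_algebra, 'e) corr \<Rightarrow> ('a, 'f) corr \<Rightarrow> ('a, 'g) corr \<Rightarrow> ('e \<Rightarrow> 'f \<Rightarrow> 'g) \<Rightarrow> bool" where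
  "is_interior_tensor F G T \<tau> \<longleftrightarrow> correspondence T \<and>
     (\<forall>x\<in>mcar F. \<forall>y\<in>mcar G. \<tau> x y \<in> mcar T) \<and>
     (\<forall>x\<in>mcar F. \<forall>x'\<in>mcar F. \<forall>y\<in>mcar G. \<tau> (madd F x x') y = madd T (\<tau> x y) (\<tau> x' y)) \<and>
     (\<forall>x\<in>mcar F. \<forall>y\<in>mcar G. \<forall>y'\<in>mcar G. \<tau> x (madd G y y') = madd T (\<tau> x y) (\<tau> x y')) \<and>
     (\<forall>x\<in>mcar F. \<forall>y\<in>mcar G. \<forall>c. \<tau> (mscale F c x) y = mscale T c (\<tau> x y) \<and>
        \<tau> x (mscale G c y) = mscale T c (\<tau> x y)) \<and>
     (\<forall>x\<in>mcar F. \<forall>y\<in>mcar G. \<forall>a. \<tau> (ract F x a) y = \<tau> x (lact G a y) \<and>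
        lact T a (\<tau> x y) = \<tau> (lact F a x) y \<and> ract T (\<tau> x y) a = \<tau> x (ract G y a)) \<and>
     (\<forall>x\<in>mcar F. \<forall>x'\<in>mcar F. \<forall>y\<in>mcar G. \<forall>y'\<in>mcar G.
        mip T (\<tau> x y) (\<tau> x' y') = mip G y (lact G (mip F x x') y')) \<and>
     (\<forall>z\<in>mcar T. \<forall>\<epsilon>>0. \<exists>s\<in>mspan T {\<tau> x y |x y. x \<in> mcar F \<and> y \<in> mcar G}. mdist T z s < \<epsilon>)"


section \<open>Hausdorff completion\<close>

text \<open>Let \<open>\<kappa>\<close> be a positive semidefinite kernel on a set \<open>G\<close> of generators. The finitely
  supported functions on \<open>G\<close> (formal linear combinations of generators) carry the semi-inner
  product \<open>sip \<kappa>\<close>. A vector \<open>x\<close> of the Hausdorff completion is encoded as the function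
  \<open>w \<mapsto> \<langle>w, x\<rangle>\<close> on generators; this identifies the null vectors with zero and is injective on the
  completion since the generators are total.\<close>

definition formal_sums :: "'w set \<Rightarrow> ('w \<Rightarrow> complex) set" where
  "formal_sums G = {c. finite {w. c w \<noteq> 0} \<and> {w. c w \<noteq> 0} \<subseteq> G}"

definition sip :: "('w \<Rightarrow> 'w \<Rightarrow> complex) \<Rightarrow> ('w \<Rightarrow> complex) \<Rightarrow> ('w \<Rightarrow> complex) \<Rightarrow> complex" where
  "sip \<kappa> c d = (\<Sum>w\<in>{w. c w \<noteq> 0}. \<Sum>w'\<in>{w. d w \<noteq> 0}. cnj (c w) * d w' * \<kappa> w w')"

text \<open>\<open>s\<close> is a Cauchy sequence of formal sums whose limit in the completion is \<open>f\<close>.\<close>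

definition represents ::
  "'w set \<Rightarrow> ('w \<Rightarrow> 'w \<Rightarrow> complex) \<Rightarrow> (nat \<Rightarrow> 'w \<Rightarrow> complex) \<Rightarrow> ('w \<Rightarrow> complex) \<Rightarrow> bool" where
  "represents G \<kappa> s f \<longleftrightarrow>
     (\<forall>n. s n \<in> formal_sums G) \<and>
     (\<forall>\<epsilon>>0. \<exists>N. \<forall>m\<ge>N. \<forall>n\<ge>N.
        sqrt (Re (sip \<kappa> (\<lambda>w. s m w - s n w) (\<lambda>w. s m w - s n w))) < \<epsilon>) \<and>
     (\<forall>w\<in>G. (\<lambda>n. sip \<kappa> (\<lambda>v. if v = w then 1 else 0) (s n)) \<longlonglongrightarrow> f w) \<and>
     (\<forall>w. w \<notin> G \<longrightarrow> f w = 0)"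

definition hausdorff_completion ::
  "'w set \<Rightarrow> ('w \<Rightarrow> 'w \<Rightarrow> complex) \<Rightarrow> ('w \<Rightarrow> complex) hspace" where
  "hausdorff_completion G \<kappa> =
     \<lparr>hcar = {f. \<exists>s. represents G \<kappa> s f},
      hadd = (\<lambda>f g w. f w + g w),
      hscale = (\<lambda>c f w. c * f w),
      hip = (\<lambda>f g. THE l. \<forall>s t. represents G \<kappa> s f \<and> represents G \<kappa> t g \<longrightarrow>
               (\<lambda>n. sip \<kappa> (s n) (t n)) \<longlonglongrightarrow> l)\<rparr>"


section \<open>The Hilbert spaces \<open>F\<^sub>1 \<otimes> \<dots> \<otimes> F\<^sub>m \<otimes>\<^sub>\<sigma> V\<close>\<close>

text \<open>\<open>word_ip Fs xs ys = \<langle>x\<^sub>1 \<otimes> \<dots> \<otimes> x\<^sub>m, y\<^sub>1 \<otimes> \<dots> \<otimes> y\<^sub>m\<rangle>\<close>, by iterating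
  \<open>\<langle>x \<otimes> x', y \<otimes> y'\<rangle> = \<langle>x', \<langle>x, y\<rangle> y'\<rangle>\<close>.\<close>

fun word_ip_from :: "'a \<Rightarrow> ('a, 'e) corr list \<Rightarrow> 'e list \<Rightarrow> 'e list \<Rightarrow> 'a" where
  "word_ip_from a (F # Fs) (x # xs) (y # ys) =
     word_ip_from (mip F x (lact F a y)) Fs xs ys"
| "word_ip_from a _ _ _ = a"

fun word_ip :: "('a::cstar_algebra, 'e) corr list \<Rightarrow> 'e list \<Rightarrow> 'e list \<Rightarrow> 'a" where
  "word_ip (F # Fs) (x # xs) (y # ys) = word_ip_from (mip F x y) Fs xs ys"
| "word_ip _ _ _ = 1"

definition words :: "('a, 'e) corr list \<Rightarrow> ('e list \<times> 'v) set" where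
  "words Fs = {(xs, h). list_all2 (\<lambda>F x. x \<in> mcar F) Fs xs}"

definition word_kernel ::
  "('a::cstar_algebra, 'e) corr list \<Rightarrow> ('a \<Rightarrow> 'v::chilbert_space \<Rightarrow> 'v) \<Rightarrow>
    'e list \<times> 'v \<Rightarrow> 'e list \<times> 'v \<Rightarrow> complex" where
  "word_kernel Fs \<sigma> = (\<lambda>(xs, h) (ys, g). cinner h (\<sigma> (word_ip Fs xs ys) g))"

text \<open>The relations of the algebraic tensor product are null vectors for the semi-inner product
  on formal sums of words, so that the formal sums of words have the same Hausdorff completion
  as the algebraic tensor product. For the empty list this is \<open>\<A> \<otimes>\<^sub>\<sigma> V = V\<close>.\<close>

definition tensor ::
  "('a::cstar_algebra, 'e) corr list \<Rightarrow> ('a \<Rightarrow> 'v::chilbert_space \<Rightarrow> 'v) \<Rightarrow>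
    ('e list \<times> 'v \<Rightarrow> complex) hspace" where
  "tensor Fs \<sigma> = hausdorff_completion (words Fs) (word_kernel Fs \<sigma>)"

definition elem ::
  "('a::cstar_algebra, 'e) corr list \<Rightarrow> ('a \<Rightarrow> 'v::chilbert_space \<Rightarrow> 'v) \<Rightarrow>
    'e list \<times> 'v \<Rightarrow> 'e list \<times> 'v \<Rightarrow> complex" where
  "elem Fs \<sigma> w = (\<lambda>u. if u \<in> words Fs then word_kernel Fs \<sigma> u w else 0)"

text \<open>\<open>I \<otimes> J\<close>, from \<open>F\<^sub>1 \<otimes> \<dots> \<otimes> F\<^sub>m \<otimes>\<^sub>\<sigma> V\<close> to \<open>F\<^sub>1 \<otimes> \<dots> \<otimes> F\<^sub>m \<otimes>\<^sub>\<rho> H\<close>.\<close>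

definition amplify ::
  "('a::cstar_algebra, 'e) corr list \<Rightarrow> ('a \<Rightarrow> 'v::chilbert_space \<Rightarrow> 'v) \<Rightarrow>
    ('a \<Rightarrow> 'h::chilbert_space \<Rightarrow> 'h) \<Rightarrow> ('v \<Rightarrow> 'h) \<Rightarrow>
    ('e list \<times> 'v \<Rightarrow> complex) \<Rightarrow> 'e list \<times> 'h \<Rightarrow> complex" where
  "amplify Fs \<sigma> \<rho> J = ext_op (tensor Fs \<sigma>) (tensor Fs \<rho>) (words Fs) (elem Fs \<sigma>)
     (\<lambda>(xs, v). elem Fs \<rho> (xs, J v))"


section \<open>Representations of a correspondence\<close>

definition algebra_rep :: "('a::cstar_algebra \<Rightarrow> 'v::chilbert_space \<Rightarrow> 'v) \<Rightarrow> bool" where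
  "algebra_rep \<sigma> \<longleftrightarrow>
     (\<forall>a. bounded_op whole whole (\<sigma> a)) \<and>
     (\<forall>a b h. \<sigma> (a + b) h = \<sigma> a h + \<sigma> b h) \<and>
     (\<forall>c a h. \<sigma> (c *\<^sub>C a) h = c *\<^sub>C \<sigma> a h) \<and>
     (\<forall>a b h. \<sigma> (a * b) h = \<sigma> a (\<sigma> b h)) \<and>
     (\<forall>a h. \<sigma> (star a) h = adj whole whole (\<sigma> a) h) \<and>
     (\<forall>h. \<sigma> 1 h = h)"

definition col_norm :: "nat \<Rightarrow> (nat \<Rightarrow> 'a::cstar_algebra) \<Rightarrow> real" where
  "col_norm N b = sqrt (norm (\<Sum>i<N. star (b i) * b i))"

text \<open>The C*-norm of \<open>M\<^sub>N(\<A>)\<close> is the operator norm on the Hilbert module \<open>\<A>\<^sup>N\<close>.\<close>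

definition mat_norm :: "nat \<Rightarrow> (nat \<Rightarrow> nat \<Rightarrow> 'a::cstar_algebra) \<Rightarrow> real" where
  "mat_norm N a = Sup {col_norm N (\<lambda>i. \<Sum>j<N. a i j * b j) |b. col_norm N b \<le> 1}"

text \<open>The canonical operator space structure of a Hilbert module:
  \<open>\<parallel>[x\<^sub>i\<^sub>j]\<parallel>\<^sup>2 = \<parallel>[\<Sum>\<^sub>l \<langle>x\<^sub>l\<^sub>i, x\<^sub>l\<^sub>j\<rangle>]\<parallel>\<close>.\<close>

definition corr_mat_norm ::
  "('a::cstar_algebra, 'e) corr \<Rightarrow> nat \<Rightarrow> (nat \<Rightarrow> nat \<Rightarrow> 'e) \<Rightarrow> real" where
  "corr_mat_norm F N x = sqrt (mat_norm N (\<lambda>i j. \<Sum>l<N. mip F (x l i) (x l j)))"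

definition completely_contractive ::
  "('a::cstar_algebra, 'e) corr \<Rightarrow> ('e \<Rightarrow> 'v::chilbert_space \<Rightarrow> 'v) \<Rightarrow> bool" where
  "completely_contractive F A \<longleftrightarrow>
     (\<forall>N x v. (\<forall>i<N. \<forall>j<N. x i j \<in> mcar F) \<longrightarrow>
        sqrt (\<Sum>i<N. (norm (\<Sum>j<N. A (x i j) (v j)))\<^sup>2)
          \<le> corr_mat_norm F N x * sqrt (\<Sum>j<N. (norm (v j))\<^sup>2))"

definition representation ::
  "('a::cstar_algebra, 'e) corr \<Rightarrow> ('e \<Rightarrow> 'v::chilbert_space \<Rightarrow> 'v) \<Rightarrow> ('a \<Rightarrow> 'v \<Rightarrow> 'v) \<Rightarrow> bool"
  where
  "representation F A \<sigma> \<longleftrightarrow> algebra_rep \<sigma> \<and>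
     (\<forall>x\<in>mcar F. bounded_op whole whole (A x)) \<and>
     (\<forall>x\<in>mcar F. \<forall>y\<in>mcar F. \<forall>h. A (madd F x y) h = A x h + A y h) \<and>
     (\<forall>x\<in>mcar F. \<forall>c h. A (mscale F c x) h = c *\<^sub>C A x h) \<and>
     completely_contractive F A \<and>
     (\<forall>x\<in>mcar F. \<forall>a b h. A (lact F a (ract F x b)) h = \<sigma> a (A x (\<sigma> b h)))"

definition isometric ::
  "('a::cstar_algebra, 'e) corr \<Rightarrow> ('e \<Rightarrow> 'v::chilbert_space \<Rightarrow> 'v) \<Rightarrow> ('a \<Rightarrow> 'v \<Rightarrow> 'v) \<Rightarrow> bool"
  where
  "isometric F A \<sigma> \<longleftrightarrow>
     (\<forall>x\<in>mcar F. \<forall>y\<in>mcar F. \<forall>h. adj whole whole (A x) (A y h) = \<sigma> (mip F x y) h)"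

text \<open>\<open>x\<^sub>1 \<otimes> \<dots> \<otimes> x\<^sub>m \<otimes> h \<mapsto> A x\<^sub>1 (\<dots> (A x\<^sub>m h))\<close>\<close>

definition tilde_pow ::
  "('a::cstar_algebra, 'e) corr \<Rightarrow> ('e \<Rightarrow> 'v::chilbert_space \<Rightarrow> 'v) \<Rightarrow> ('a \<Rightarrow> 'v \<Rightarrow> 'v) \<Rightarrow> nat \<Rightarrow>
    ('e list \<times> 'v \<Rightarrow> complex) \<Rightarrow> 'v" where
  "tilde_pow F A \<sigma> m = ext_op (tensor (replicate m F) \<sigma>) whole
     (words (replicate m F)) (elem (replicate m F) \<sigma>) (\<lambda>(xs, h). foldr A xs h)"

definition tilde ::
  "('a::cstar_algebra, 'e) corr \<Rightarrow> ('e \<Rightarrow> 'v::chilbert_space \<Rightarrow> 'v) \<Rightarrow> ('a \<Rightarrow> 'v \<Rightarrow> 'v) \<Rightarrow>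
    ('e list \<times> 'v \<Rightarrow> complex) \<Rightarrow> 'v" where
  "tilde F A \<sigma> = ext_op (tensor [F] \<sigma>) whole (words [F]) (elem [F] \<sigma>) (\<lambda>(xs, h). A (hd xs) h)"

definition fully_coisometric ::
  "('a::cstar_algebra, 'e) corr \<Rightarrow> ('e \<Rightarrow> 'v::chilbert_space \<Rightarrow> 'v) \<Rightarrow> ('a \<Rightarrow> 'v \<Rightarrow> 'v) \<Rightarrow> bool"
  where
  "fully_coisometric F A \<sigma> \<longleftrightarrow>
     (\<forall>h. tilde F A \<sigma> (adj (tensor [F] \<sigma>) whole (tilde F A \<sigma>) h) = h)"

text \<open>The inclusion of \<open>V\<close> into \<open>H\<close> is given by a linear isometry \<open>J\<close>, through which \<open>V\<close> is
  identified with the closed subspace \<open>range J\<close> of \<open>H\<close>.\<close>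

definition isometric_embedding :: "('v::chilbert_space \<Rightarrow> 'h::chilbert_space) \<Rightarrow> bool" where
  "isometric_embedding J \<longleftrightarrow> bounded_op whole whole J \<and> (\<forall>v w. cinner (J v) (J w) = cinner v w)"

definition dilates ::
  "('a::cstar_algebra, 'e) corr \<Rightarrow> ('e \<Rightarrow> 'v::chilbert_space \<Rightarrow> 'v) \<Rightarrow> ('a \<Rightarrow> 'v \<Rightarrow> 'v) \<Rightarrow>
    ('v \<Rightarrow> 'h::chilbert_space) \<Rightarrow> ('e \<Rightarrow> 'h \<Rightarrow> 'h) \<Rightarrow> ('a \<Rightarrow> 'h \<Rightarrow> 'h) \<Rightarrow> bool" where
  "dilates F A \<sigma> J S \<rho> \<longleftrightarrow>
     representation F A \<sigma> \<and> representation F S \<rho> \<and> isometric_embedding J \<and>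
     (\<forall>a. \<rho> a ` range J \<subseteq> range J \<and> \<rho> a ` orth (range J) \<subseteq> orth (range J)) \<and>
     (\<forall>a v. \<rho> a (J v) = J (\<sigma> a v)) \<and>
     (\<forall>x\<in>mcar F. S x ` orth (range J) \<subseteq> orth (range J)) \<and>
     (\<forall>x\<in>mcar F. \<forall>v. orth_proj (range J) (S x (J v)) = J (A x v))"

definition minimal_isometric_dilation ::
  "('a::cstar_algebra, 'e) corr \<Rightarrow> ('e \<Rightarrow> 'v::chilbert_space \<Rightarrow> 'v) \<Rightarrow> ('a \<Rightarrow> 'v \<Rightarrow> 'v) \<Rightarrow>
    ('v \<Rightarrow> 'h::chilbert_space) \<Rightarrow> ('e \<Rightarrow> 'h \<Rightarrow> 'h) \<Rightarrow> ('a \<Rightarrow> 'h \<Rightarrow> 'h) \<Rightarrow> bool" where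
  "minimal_isometric_dilation F A \<sigma> J S \<rho> \<longleftrightarrow>
     dilates F A \<sigma> J S \<rho> \<and> isometric F S \<rho> \<and>
     closed_span (\<Union>m. tilde_pow F S \<rho> m ` amplify (replicate m F) \<sigma> \<rho> J `
       hcar (tensor (replicate m F) \<sigma>)) = UNIV"

text \<open>Unitary equivalence of two dilations on \<open>H\<close> and \<open>K\<close>, by a unitary that fixes \<open>V\<close>.\<close>

definition equivalent_dilations ::
  "('a::cstar_algebra, 'e) corr \<Rightarrow>
    ('v::chilbert_space \<Rightarrow> 'h::chilbert_space) \<Rightarrow> ('e \<Rightarrow> 'h \<Rightarrow> 'h) \<Rightarrow> ('a \<Rightarrow> 'h \<Rightarrow> 'h) \<Rightarrow>
    ('v \<Rightarrow> 'k::chilbert_space) \<Rightarrow> ('e \<Rightarrow> 'k \<Rightarrow> 'k) \<Rightarrow> ('a \<Rightarrow> 'k \<Rightarrow> 'k) \<Rightarrow> bool" where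
  "equivalent_dilations F J S \<rho> J' S' \<rho>' \<longleftrightarrow>
     (\<exists>W. isometric_embedding W \<and> surj W \<and>
        (\<forall>v. W (J v) = J' v) \<and>
        (\<forall>x\<in>mcar F. \<forall>h. W (S x h) = S' x (W h)) \<and>
        (\<forall>a h. W (\<rho> a h) = \<rho>' a (W h)))"


section \<open>Product systems over \<open>\<nat>\<^sup>k\<close>\<close>

definition nvecs :: "nat \<Rightarrow> (nat \<Rightarrow> nat) set" where
  "nvecs k = {n. \<forall>i. i \<notin> {1..k} \<longrightarrow> n i = 0}"

definition nvec_add :: "(nat \<Rightarrow> nat) \<Rightarrow> (nat \<Rightarrow> nat) \<Rightarrow> nat \<Rightarrow> nat" where
  "nvec_add n m = (\<lambda>i. n i + m i)"

definition unit_vec :: "nat \<Rightarrow> nat \<Rightarrow> nat" where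
  "unit_vec i = (\<lambda>j. if j = i then 1 else 0)"

text \<open>\<open>pcar\<close>, \<open>pmul\<close>: the semigroup; \<open>pdeg\<close>: the homomorphism to \<open>\<nat>\<^sup>k\<close>; \<open>fibre E n\<close>: the
  correspondence structure on the elements of degree \<open>n\<close>; \<open>pcoeff\<close>: the identification of the
  coefficient algebra with the fibre of degree zero.\<close>

record ('a, 'e) prodsys =
  pcar :: "'e set"
  pmul :: "'e \<Rightarrow> 'e \<Rightarrow> 'e"
  pdeg :: "'e \<Rightarrow> nat \<Rightarrow> nat"
  fibre :: "(nat \<Rightarrow> nat) \<Rightarrow> ('a, 'e) corr"
  pcoeff :: "'a \<Rightarrow> 'e"

definition product_system :: "nat \<Rightarrow> ('a::cstar_algebra, 'e) prodsys \<Rightarrow> bool" where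
  "product_system k E \<longleftrightarrow>
     (\<forall>x\<in>pcar E. \<forall>y\<in>pcar E. pmul E x y \<in> pcar E) \<and>
     (\<forall>x\<in>pcar E. \<forall>y\<in>pcar E. \<forall>z\<in>pcar E. pmul E (pmul E x y) z = pmul E x (pmul E y z)) \<and>
     (\<forall>x\<in>pcar E. pdeg E x \<in> nvecs k) \<and>
     (\<forall>x\<in>pcar E. \<forall>y\<in>pcar E. pdeg E (pmul E x y) = nvec_add (pdeg E x) (pdeg E y)) \<and>
     (\<forall>n\<in>nvecs k. correspondence (fibre E n) \<and> mcar (fibre E n) = {x \<in> pcar E. pdeg E x = n}) \<and>
     \<comment> \<open>the fibre of degree zero is the coefficient algebra, and multiplication by its elements is
        given by the module actions\<close>
     (let E0 = fibre E (\<lambda>_. 0) in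
        bij_betw (pcoeff E) UNIV (mcar E0) \<and>
        (\<forall>a b. pcoeff E (a + b) = madd E0 (pcoeff E a) (pcoeff E b)) \<and>
        (\<forall>c a. pcoeff E (c *\<^sub>C a) = mscale E0 c (pcoeff E a)) \<and>
        (\<forall>a b. pcoeff E (a * b) = ract E0 (pcoeff E a) b \<and>
               pcoeff E (a * b) = lact E0 a (pcoeff E b)) \<and>
        (\<forall>a b. mip E0 (pcoeff E a) (pcoeff E b) = star a * b)) \<and>
     (\<forall>n\<in>nvecs k. \<forall>x\<in>mcar (fibre E n). \<forall>a.
        pmul E (pcoeff E a) x = lact (fibre E n) a x \<and>
        pmul E x (pcoeff E a) = ract (fibre E n) x a) \<and>
     (\<forall>n\<in>nvecs k. \<forall>m\<in>nvecs k.
        is_interior_tensor (fibre E n) (fibre E m) (fibre E (nvec_add n m)) (pmul E))"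

abbreviation gen_fibre :: "('a, 'e) prodsys \<Rightarrow> nat \<Rightarrow> ('a, 'e) corr" where
  "gen_fibre E i \<equiv> fibre E (unit_vec i)"

text \<open>\<open>E\<^sub>i \<otimes> E\<^sub>j \<otimes> V \<rightarrow> E(e\<^sub>i + e\<^sub>j) \<otimes> V\<close>, the isomorphism given by multiplication.\<close>

definition mult_iso ::
  "('a::cstar_algebra, 'e) prodsys \<Rightarrow> ('a \<Rightarrow> 'v::chilbert_space \<Rightarrow> 'v) \<Rightarrow> nat \<Rightarrow> nat \<Rightarrow>
    ('e list \<times> 'v \<Rightarrow> complex) \<Rightarrow> 'e list \<times> 'v \<Rightarrow> complex" where
  "mult_iso E \<sigma> i j =
     (let Fij = fibre E (nvec_add (unit_vec i) (unit_vec j)); Fs = [gen_fibre E i, gen_fibre E j]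
      in ext_op (tensor Fs \<sigma>) (tensor [Fij] \<sigma>) (words Fs) (elem Fs \<sigma>)
           (\<lambda>(xs, h). elem [Fij] \<sigma> ([pmul E (xs ! 0) (xs ! 1)], h)))"

text \<open>\<open>t\<^sub>i\<^sub>,\<^sub>j \<otimes> I\<^sub>V\<close>, from \<open>E\<^sub>i \<otimes> E\<^sub>j \<otimes> V\<close> to \<open>E\<^sub>j \<otimes> E\<^sub>i \<otimes> V\<close>, as the composition of
  the isomorphisms \<open>E\<^sub>i \<otimes> E\<^sub>j \<otimes> V \<cong> E(e\<^sub>i + e\<^sub>j) \<otimes> V \<cong> E\<^sub>j \<otimes> E\<^sub>i \<otimes> V\<close>.\<close>

definition flip_iso ::
  "('a::cstar_algebra, 'e) prodsys \<Rightarrow> ('a \<Rightarrow> 'v::chilbert_space \<Rightarrow> 'v) \<Rightarrow> nat \<Rightarrow> nat \<Rightarrow>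
    ('e list \<times> 'v \<Rightarrow> complex) \<Rightarrow> 'e list \<times> 'v \<Rightarrow> complex" where
  "flip_iso E \<sigma> i j f =
     inv_into (hcar (tensor [gen_fibre E j, gen_fibre E i] \<sigma>)) (mult_iso E \<sigma> j i)
       (mult_iso E \<sigma> i j f)"

text \<open>The operator \<open>I \<otimes> \<tilde>A\<close> from \<open>F \<otimes> G \<otimes> V\<close> to \<open>F \<otimes> V\<close>, for a representation \<open>A\<close> of \<open>G\<close>.\<close>

definition id_tensor_tilde ::
  "('a::cstar_algebra, 'e) corr \<Rightarrow> ('a, 'e) corr \<Rightarrow> ('e \<Rightarrow> 'v::chilbert_space \<Rightarrow> 'v) \<Rightarrow>
    ('a \<Rightarrow> 'v \<Rightarrow> 'v) \<Rightarrow> ('e list \<times> 'v \<Rightarrow> complex) \<Rightarrow> 'e list \<times> 'v \<Rightarrow> complex" where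
  "id_tensor_tilde F G A \<sigma> = ext_op (tensor [F, G] \<sigma>) (tensor [F] \<sigma>) (words [F, G])
     (elem [F, G] \<sigma>) (\<lambda>(xs, h). elem [F] \<sigma> ([xs ! 0], A (xs ! 1) h))"

definition ps_representation ::
  "nat \<Rightarrow> ('a::cstar_algebra, 'e) prodsys \<Rightarrow> (nat \<Rightarrow> 'e \<Rightarrow> 'v::chilbert_space \<Rightarrow> 'v) \<Rightarrow>
    ('a \<Rightarrow> 'v \<Rightarrow> 'v) \<Rightarrow> bool" where
  "ps_representation k E A \<sigma> \<longleftrightarrow> algebra_rep \<sigma> \<and>
     (\<forall>i\<in>{1..k}. representation (gen_fibre E i) (A i) \<sigma>) \<and>
     (\<forall>i\<in>{1..k}. \<forall>j\<in>{1..k}. \<forall>f\<in>hcar (tensor [gen_fibre E i, gen_fibre E j] \<sigma>).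
        tilde (gen_fibre E i) (A i) \<sigma>
          (id_tensor_tilde (gen_fibre E i) (gen_fibre E j) (A j) \<sigma> f) =
        tilde (gen_fibre E j) (A j) \<sigma>
          (id_tensor_tilde (gen_fibre E j) (gen_fibre E i) (A i) \<sigma> (flip_iso E \<sigma> i j f)))"

definition ps_isometric ::
  "nat \<Rightarrow> ('a::cstar_algebra, 'e) prodsys \<Rightarrow> (nat \<Rightarrow> 'e \<Rightarrow> 'v::chilbert_space \<Rightarrow> 'v) \<Rightarrow>
    ('a \<Rightarrow> 'v \<Rightarrow> 'v) \<Rightarrow> bool" where
  "ps_isometric k E A \<sigma> \<longleftrightarrow> (\<forall>i\<in>{1..k}. isometric (gen_fibre E i) (A i) \<sigma>)"

definition ps_fully_coisometric ::
  "nat \<Rightarrow> ('a::cstar_algebra, 'e) prodsys \<Rightarrow> (nat \<Rightarrow> 'e \<Rightarrow> 'v::chilbert_space \<Rightarrow> 'v) \<Rightarrow>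
    ('a \<Rightarrow> 'v \<Rightarrow> 'v) \<Rightarrow> bool" where
  "ps_fully_coisometric k E A \<sigma> \<longleftrightarrow> (\<forall>i\<in>{1..k}. fully_coisometric (gen_fibre E i) (A i) \<sigma>)"

text \<open>The tensor factors of \<open>E(n) = E\<^sub>1\<^sup>n\<^sup>1 \<otimes> \<dots> \<otimes> E\<^sub>k\<^sup>n\<^sup>k\<close>, in this order.\<close>

definition letters :: "nat \<Rightarrow> (nat \<Rightarrow> nat) \<Rightarrow> nat list" where
  "letters k n = concat (map (\<lambda>i. replicate (n i) i) [1..<Suc k])"

text \<open>The operator \<open>\<tilde>A\<^sub>n\<close> on \<open>E(n) \<otimes> V\<close>. Under the identification of \<open>E(n)\<close> with
  \<open>E\<^sub>1\<^sup>n\<^sup>1 \<otimes> \<dots> \<otimes> E\<^sub>k\<^sup>n\<^sup>k\<close> by multiplication, the composition that defines it maps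
  \<open>x\<^sub>1 \<cdots> x\<^sub>N \<otimes> h\<close> to \<open>A x\<^sub>1 \<cdots> A x\<^sub>N h\<close>. The factor \<open>a\<close> in the coefficient algebra is there for
  degree zero, where the product is empty; in the other degrees it can be absorbed into \<open>x\<^sub>N\<close>.\<close>

definition ps_tilde ::
  "nat \<Rightarrow> ('a::cstar_algebra, 'e) prodsys \<Rightarrow> (nat \<Rightarrow> 'e \<Rightarrow> 'v::chilbert_space \<Rightarrow> 'v) \<Rightarrow>
    ('a \<Rightarrow> 'v \<Rightarrow> 'v) \<Rightarrow> (nat \<Rightarrow> nat) \<Rightarrow> ('e list \<times> 'v \<Rightarrow> complex) \<Rightarrow> 'v" where
  "ps_tilde k E A \<sigma> n = ext_op (tensor [fibre E n] \<sigma>) whole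
     {(xs, a, h). list_all2 (\<lambda>i x. x \<in> mcar (gen_fibre E i)) (letters k n) xs}
     (\<lambda>(xs, a, h). elem [fibre E n] \<sigma> ([foldr (pmul E) xs (pcoeff E a)], h))
     (\<lambda>(xs, a, h). foldr (\<lambda>(i, x). A i x) (zip (letters k n) xs) (\<sigma> a h))"

definition ps_at ::
  "nat \<Rightarrow> ('a::cstar_algebra, 'e) prodsys \<Rightarrow> (nat \<Rightarrow> 'e \<Rightarrow> 'v::chilbert_space \<Rightarrow> 'v) \<Rightarrow>
    ('a \<Rightarrow> 'v \<Rightarrow> 'v) \<Rightarrow> (nat \<Rightarrow> nat) \<Rightarrow> 'e \<Rightarrow> 'v \<Rightarrow> 'v" where
  "ps_at k E A \<sigma> n x h = ps_tilde k E A \<sigma> n (elem [fibre E n] \<sigma> ([x], h))"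

definition ps_dilates ::
  "nat \<Rightarrow> ('a::cstar_algebra, 'e) prodsys \<Rightarrow> (nat \<Rightarrow> 'e \<Rightarrow> 'v::chilbert_space \<Rightarrow> 'v) \<Rightarrow>
    ('a \<Rightarrow> 'v \<Rightarrow> 'v) \<Rightarrow> ('v \<Rightarrow> 'h::chilbert_space) \<Rightarrow> (nat \<Rightarrow> 'e \<Rightarrow> 'h \<Rightarrow> 'h) \<Rightarrow>
    ('a \<Rightarrow> 'h \<Rightarrow> 'h) \<Rightarrow> bool" where
  "ps_dilates k E A \<sigma> J S \<rho> \<longleftrightarrow>
     ps_representation k E A \<sigma> \<and> ps_representation k E S \<rho> \<and> isometric_embedding J \<and>
     (\<forall>i\<in>{1..k}. dilates (gen_fibre E i) (A i) \<sigma> J (S i) \<rho>)"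

definition ps_minimal_isometric_dilation ::
  "nat \<Rightarrow> ('a::cstar_algebra, 'e) prodsys \<Rightarrow> (nat \<Rightarrow> 'e \<Rightarrow> 'v::chilbert_space \<Rightarrow> 'v) \<Rightarrow>
    ('a \<Rightarrow> 'v \<Rightarrow> 'v) \<Rightarrow> ('v \<Rightarrow> 'h::chilbert_space) \<Rightarrow> (nat \<Rightarrow> 'e \<Rightarrow> 'h \<Rightarrow> 'h) \<Rightarrow>
    ('a \<Rightarrow> 'h \<Rightarrow> 'h) \<Rightarrow> bool" where
  "ps_minimal_isometric_dilation k E A \<sigma> J S \<rho> \<longleftrightarrow>
     ps_dilates k E A \<sigma> J S \<rho> \<and> ps_isometric k E S \<rho> \<and>
     closed_span (\<Union>n\<in>nvecs k. ps_tilde k E S \<rho> n ` amplify [fibre E n] \<sigma> \<rho> J `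
       hcar (tensor [fibre E n] \<sigma>)) = UNIV"

end

theory Submission
  imports Defs
begin

text \<open>
  All representations are modelled inside the space \<open>H\<close> of the isometric dilation. If the \<open>T\<^sub>i\<close>
  are isometric, then \<open>F\<^sub>1 \<otimes> \<dots> \<otimes> F\<^sub>m \<otimes> V\<close> is the closed span of the vectors
  \<open>T\<^sub>1(x\<^sub>1) \<cdots> T\<^sub>m(x\<^sub>m) J v\<close>, where \<open>J\<close> embeds \<open>V\<close> in \<open>H\<close>, and \<open>\<tilde>A\<close> becomes the restriction of \<open>J\<^sup>*\<close>.
  Hence \<open>A\<close> is fully coisometric iff \<open>V \<subseteq> \<Or>S(F)V\<close>. In the product system this gives
  \<open>\<Or>S\<^sub>m(E(m))V \<subseteq> \<Or>S\<^sub>l(E(l))V\<close> for \<open>m \<le> l\<close>. As all \<open>n\<^sub>i\<close> are positive, each \<open>m\<close> is below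
  a multiple \<open>r n\<close>, and \<open>S\<^sub>r\<^sub>n(E(r n))V\<close> is spanned by products of \<open>r\<close> elements of \<open>S\<^sub>n(E(n))\<close>; so
  minimality over \<open>\<nat>\<^sup>k\<close> implies minimality over the multiples of \<open>n\<close>. Uniqueness holds because the
  inner products of the vectors \<open>S(x\<^sub>1) \<cdots> S(x\<^sub>m) J v\<close> are determined by \<open>A\<close> and \<open>\<sigma>\<close>.
  Complete contractivity of \<open>S\<^sub>n\<close> reduces to contractivity of \<open>\<rho>\<close> on matrices, and that to the
  positivity of the elements \<open>a\<^sup>* a\<close> of a C*-algebra.
\<close>

section \<open>Hilbert spaces\<close>

text \<open>The tensor operators are given as descriptions (\<open>THE\<close>) on completions whose
  elements are functions on words; nothing can be computed with them before a concrete model is at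
  hand. Isometry supplies one: the Gram matrix of the words equals that of actual vectors of
  \<open>H\<close>, and an operator extended from its values on words becomes a restriction of a
  bounded operator on \<open>H\<close>. A second obstacle is that S_n is prescribed on products of
  letters in one fixed order, while S_(n+m)(x y) = S_n(x) S_m(y) breaks that order. So a
  representation is built for every word in the generators, and the commutation relations show that
  only the degree of the word matters. Well-definedness, linearity and covariance rest on one
  principle: the isometry relation fixes all inner products of the vectors concerned, and a
  difference of norm zero vanishes. Finally, \<open>cstar_pos\<close> is not visibly a cone, so
  order arguments in the algebra need the classical theorem on elements \<open>star a * a\<close>;
  it is derived from convergent square roots and norm estimates, without spectral theory.\<close>

lemma scaleC_zero_right [simp]: "c *\<^sub>C (0::'a::complex_vector) = 0"
  using scaleC_add_right[of c "0::'a" 0] by simp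

lemma scaleC_one [simp]: "1 *\<^sub>C (x::'a::complex_vector) = x"
  using scaleR_eq_scaleC[of 1 x] by simp

lemma scaleC_zero_left [simp]: "0 *\<^sub>C (x::'a::complex_vector) = 0"
  using scaleR_eq_scaleC[of 0 x] by simp

lemma scaleC_minus_right: "c *\<^sub>C (- x) = - (c *\<^sub>C (x::'a::complex_vector))"
  using scaleC_add_right[of c x "- x"] by (simp add: eq_neg_iff_add_eq_0 add.commute)

lemma scaleC_minus_left: "(- c) *\<^sub>C x = - (c *\<^sub>C (x::'a::complex_vector))"
  using scaleC_add_left[of c "- c" x] by (simp add: eq_neg_iff_add_eq_0 add.commute)

lemma scaleC_diff_right: "c *\<^sub>C (x - y) = c *\<^sub>C x - c *\<^sub>C (y::'a::complex_vector)"
  using scaleC_add_right[of c x "- y"] by (simp add: scaleC_minus_right)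

lemma scaleC_sum_right: "c *\<^sub>C (\<Sum>i\<in>I. f i) = (\<Sum>i\<in>I. c *\<^sub>C (f i::'a::complex_vector))"
  by (induction I rule: infinite_finite_induct) (auto simp: scaleC_add_right)

lemma cinner_add_left: "cinner (x + y) z = cinner x z + cinner y (z::'a::chilbert_space)"
  by (metis cinner_add_right cinner_commute complex_cnj_add)

lemma cinner_scaleC_left: "cinner (c *\<^sub>C x) y = cnj c * cinner x (y::'a::chilbert_space)"
  by (metis cinner_commute cinner_scaleC_right complex_cnj_mult)

lemma cinner_zero_right [simp]: "cinner x (0::'a::chilbert_space) = 0"
  using cinner_scaleC_right[of x 0 0] by simp

lemma cinner_zero_left [simp]: "cinner (0::'a::chilbert_space) x = 0"
  using cinner_scaleC_left[of 0 0 x] by simp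

lemma cinner_minus_right: "cinner x (- y) = - cinner x (y::'a::chilbert_space)"
  using cinner_add_right[of x y "- y"] by (simp add: eq_neg_iff_add_eq_0 add.commute)

lemma cinner_minus_left: "cinner (- x) y = - cinner x (y::'a::chilbert_space)"
  using cinner_add_left[of x "- x" y] by (simp add: eq_neg_iff_add_eq_0 add.commute)

lemma cinner_diff_right: "cinner x (y - z) = cinner x y - cinner x (z::'a::chilbert_space)"
  using cinner_add_right[of x y "- z"] by (simp add: cinner_minus_right)

lemma cinner_diff_left: "cinner (x - y) z = cinner x z - cinner y (z::'a::chilbert_space)"
  using cinner_add_left[of x "- y" z] by (simp add: cinner_minus_left)

lemma cinner_sum_right: "cinner x (\<Sum>i\<in>I. f i) = (\<Sum>i\<in>I. cinner x (f i::'a::chilbert_space))"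
  by (induction I rule: infinite_finite_induct) (auto simp: cinner_add_right)

lemma cinner_sum_left: "cinner (\<Sum>i\<in>I. f i) x = (\<Sum>i\<in>I. cinner (f i::'a::chilbert_space) x)"
  by (induction I rule: infinite_finite_induct) (auto simp: cinner_add_left)

lemma cinner_self: "cinner x x = complex_of_real ((norm (x::'a::chilbert_space))\<^sup>2)"
proof -
  have "Im (cinner x x) = 0"
    using cinner_commute[of x x] by (simp add: complex_eq_iff)
  moreover have "(norm x)\<^sup>2 = Re (cinner x x)"
    by (simp add: norm_eq_sqrt_cinner cinner_ge_zero)
  ultimately show ?thesis
    by (simp add: complex_eq_iff)
qed

lemma cinner_self_eq_0_iff [simp]: "cinner x x = 0 \<longleftrightarrow> (x::'a::chilbert_space) = 0"
  by (simp add: cinner_self)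

lemma norm_scaleC_hilbert: "norm (c *\<^sub>C x) = cmod c * norm (x::'a::chilbert_space)"
proof -
  have "complex_of_real ((norm (c *\<^sub>C x))\<^sup>2) = cnj c * c * complex_of_real ((norm x)\<^sup>2)"
    unfolding cinner_self[symmetric] by (simp add: cinner_scaleC_left cinner_scaleC_right mult_ac)
  also have "\<dots> = complex_of_real ((cmod c * norm x)\<^sup>2)"
    by (simp add: power_mult_distrib complex_norm_square[symmetric] mult.commute[of "cnj c"])
  finally have "complex_of_real ((norm (c *\<^sub>C x))\<^sup>2) = complex_of_real ((cmod c * norm x)\<^sup>2)" .
  then show ?thesis
    by (metis norm_ge_zero of_real_eq_iff power2_eq_imp_eq mult_nonneg_nonneg)
qed

lemma norm_diff_sq:
  "(norm (x - y))\<^sup>2 = (norm x)\<^sup>2 - 2 * Re (cinner y x) + (norm (y::'a::chilbert_space))\<^sup>2"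
proof -
  have sq: "(norm z)\<^sup>2 = Re (cinner z z)" for z :: 'a
    by (simp add: cinner_self)
  have "Re (cinner x y) = Re (cinner y x)"
    by (simp add: cinner_commute[of x y])
  then show ?thesis
    by (simp add: sq cinner_diff_left cinner_diff_right)
qed

text \<open>Pythagoras for the removal of the component of \<open>x\<close> along \<open>y\<close>.
  Nonnegativity of the left side is the Cauchy-Schwarz inequality; the exact value is what turns
  minimal distance into orthogonality in \<open>projection_exists\<close>.\<close>

lemma norm_sub_component:
  fixes x y :: "'a::chilbert_space"
  assumes "y \<noteq> 0"
  shows "(norm (x - (cinner y x / complex_of_real ((norm y)\<^sup>2)) *\<^sub>C y))\<^sup>2
    = (norm x)\<^sup>2 - (cmod (cinner y x))\<^sup>2 / (norm y)\<^sup>2"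
proof -
  define n where "n = (norm y)\<^sup>2"
  have n: "n \<noteq> 0" using assms by (simp add: n_def)
  have 1: "Re (cnj (cinner y x / complex_of_real n) * cinner y x) = (cmod (cinner y x))\<^sup>2 / n"
    by (simp add: Re_divide_of_real complex_mult_cnj flip: cmod_power2 power2_eq_square add_divide_distrib)
  have 2: "(cmod (cinner y x / complex_of_real n) * norm y)\<^sup>2 = (cmod (cinner y x))\<^sup>2 / n"
    using n by (simp add: norm_divide power_mult_distrib power_divide n_def[symmetric])
      (simp add: power2_eq_square)
  show ?thesis
    unfolding norm_diff_sq norm_scaleC_hilbert cinner_scaleC_left n_def[symmetric] 1 2 by simp
qed

lemma cinner_Cauchy_Schwarz: "cmod (cinner x y) \<le> norm x * norm (y::'a::chilbert_space)"
proof (cases "x = 0")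
  case False
  have "0 \<le> (norm y)\<^sup>2 - (cmod (cinner x y))\<^sup>2 / (norm x)\<^sup>2"
    unfolding norm_sub_component[OF False, symmetric] by (rule zero_le_power2)
  then have "(cmod (cinner x y))\<^sup>2 / (norm x)\<^sup>2 \<le> (norm y)\<^sup>2"
    by simp
  then have "(cmod (cinner x y))\<^sup>2 \<le> (norm x * norm y)\<^sup>2"
    using False by (simp add: pos_divide_le_eq power_mult_distrib mult.commute)
  then show ?thesis
    by (rule power2_le_imp_le) simp
qed simp

lemma bounded_bilinear_cinner: "bounded_bilinear (cinner :: 'a::chilbert_space \<Rightarrow> 'a \<Rightarrow> complex)"
proof
  show "\<exists>K. \<forall>a b::'a. norm (cinner a b) \<le> norm a * norm b * K"
    by (rule exI[of _ 1]) (simp add: cinner_Cauchy_Schwarz)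
qed (auto simp: cinner_add_left cinner_add_right scaleR_eq_scaleC cinner_scaleC_left
    cinner_scaleC_right scaleR_conv_of_real)

lemmas tendsto_cinner = bounded_bilinear.tendsto[OF bounded_bilinear_cinner]

lemma bounded_linear_scaleC: "bounded_linear (\<lambda>x::'a::chilbert_space. c *\<^sub>C x)"
  by (rule bounded_linear_intro[of _ "cmod c"])
    (auto simp: scaleC_add_right scaleR_eq_scaleC scaleC_scaleC norm_scaleC_hilbert mult_ac)

lemmas tendsto_scaleC = bounded_linear.tendsto[OF bounded_linear_scaleC]

section \<open>Closed subspaces and closed spans\<close>

lemma csubspace_0: "csubspace M \<Longrightarrow> 0 \<in> M"
  and csubspace_add: "csubspace M \<Longrightarrow> x \<in> M \<Longrightarrow> y \<in> M \<Longrightarrow> x + y \<in> M"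
  and csubspace_scale: "csubspace M \<Longrightarrow> x \<in> M \<Longrightarrow> c *\<^sub>C x \<in> M"
  by (auto simp: csubspace_def)

lemma csubspace_minus: "csubspace M \<Longrightarrow> x \<in> M \<Longrightarrow> - x \<in> M"
  using csubspace_scale[of M x "- 1"] by (simp add: scaleC_minus_left)

lemma csubspace_diff: "csubspace M \<Longrightarrow> x \<in> M \<Longrightarrow> y \<in> M \<Longrightarrow> x - y \<in> M"
  using csubspace_add[of M x "- y"] csubspace_minus[of M y] by simp

lemma csubspace_closed_span [simp]: "csubspace (closed_span S)"
  by (auto simp: closed_span_def csubspace_def)

lemma closed_closed_span [simp]: "closed (closed_span S)"
  by (auto simp: closed_span_def)

lemma closed_span_superset: "S \<subseteq> closed_span S"
  by (auto simp: closed_span_def)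

lemma closed_span_minimal: "csubspace M \<Longrightarrow> closed M \<Longrightarrow> S \<subseteq> M \<Longrightarrow> closed_span S \<subseteq> M"
  by (auto simp: closed_span_def)

lemma closed_span_mono: "S \<subseteq> T \<Longrightarrow> closed_span S \<subseteq> closed_span T"
  by (auto simp: closed_span_def)

lemma orth_closed_span:
  assumes "\<And>s. s \<in> S \<Longrightarrow> cinner s x = 0" and "y \<in> closed_span S"
  shows "cinner y x = 0"
proof -
  have "closed_span S \<subseteq> {y. cinner y x = 0}"
  proof (rule closed_span_minimal)
    show "csubspace {y. cinner y x = 0}"
      by (simp add: csubspace_def cinner_add_left cinner_scaleC_left)
    have "continuous_on UNIV (\<lambda>y. cinner y x)"
      by (intro bounded_bilinear.continuous_on[OF bounded_bilinear_cinner] continuous_intros)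
    then show "closed {y. cinner y x = 0}"
      by (simp add: closed_Collect_eq)
  qed (use assms in auto)
  then show ?thesis
    using assms by auto
qed

section \<open>Orthogonal projections\<close>

lemma parallelogram:
  "(norm (x + y))\<^sup>2 + (norm (x - y))\<^sup>2 = 2 * (norm x)\<^sup>2 + 2 * (norm (y::'a::chilbert_space))\<^sup>2"
  using norm_diff_sq[of x y] norm_diff_sq[of x "- y"] by (simp add: cinner_minus_left)

text \<open>The point \<open>p\<close> is the nearest point of \<open>M\<close> to \<open>x\<close>,
  obtained as the limit of a minimising sequence.\<close>

lemma projection_exists:
  fixes x :: "'a::chilbert_space"
  assumes M: "csubspace M" "closed M"
  obtains p where "p \<in> M" "\<And>y. y \<in> M \<Longrightarrow> cinner y (x - p) = 0"
proof -
  define D where "D = (\<lambda>y. (norm (x - y))\<^sup>2) ` M"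
  define d where "d = Inf D"
  have bdd: "bdd_below D" by (rule bdd_belowI[of _ 0]) (auto simp: D_def)
  have ne: "D \<noteq> {}" using csubspace_0[OF M(1)] by (auto simp: D_def)
  have dle: "d \<le> (norm (x - y))\<^sup>2" if "y \<in> M" for y
    unfolding d_def by (rule cInf_lower[OF _ bdd]) (use that in \<open>auto simp: D_def\<close>)
  have "\<exists>y\<in>M. (norm (x - y))\<^sup>2 < d + 1 / real (Suc n)" for n
    using cInf_lessD[OF ne, of "d + 1 / real (Suc n)"] by (auto simp: d_def D_def)
  then obtain y where y: "\<And>n. y n \<in> M" "\<And>n. (norm (x - y n))\<^sup>2 < d + 1 / real (Suc n)"
    by metis
  \<comment> \<open>Midpoints of the sequence stay in \<open>M\<close>, so the sum term in the
    parallelogram law is at least \<open>4 * d\<close>; the excesses over \<open>d\<close> bound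
    what is left for the difference.\<close>
  have diff: "(norm (y m - y n))\<^sup>2 \<le> 2 / real (Suc m) + 2 / real (Suc n)" for m n
  proof -
    have h: "(1/2) *\<^sub>C (y m + y n) \<in> M"
      by (intro csubspace_scale csubspace_add M y)
    have e: "(x - y n) + (x - y m) = 2 *\<^sub>R (x - (1/2) *\<^sub>R (y m + y n))"
      by (simp add: algebra_simps flip: scaleR_2)
    have r: "(1/2) *\<^sub>R (y m + y n) = (1/2) *\<^sub>C (y m + y n)"
      by (simp add: scaleR_eq_scaleC)
    have "4 * d \<le> (norm ((x - y n) + (x - y m)))\<^sup>2"
      unfolding e using dle[OF h] by (simp add: power_mult_distrib r)
    moreover have "(x - y n) - (x - y m) = y m - y n" by simp
    ultimately show ?thesis
      using parallelogram[of "x - y n" "x - y m"] y(2)[of m] y(2)[of n] by auto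
  qed
  have "Cauchy y"
    unfolding Cauchy_def
  proof (intro allI impI)
    fix e :: real assume e: "e > 0"
    obtain N where N: "4 / e\<^sup>2 < real N" using reals_Archimedean2 by blast
    have "dist (y m) (y n) < e" if "m \<ge> N" "n \<ge> N" for m n
    proof -
      have b: "2 / real (Suc j) < e\<^sup>2 / 2" if "j \<ge> N" for j
      proof -
        have "4 / e\<^sup>2 < real (Suc j)" using N that by linarith
        then show ?thesis using e by (simp add: field_simps)
      qed
      have "(norm (y m - y n))\<^sup>2 < e\<^sup>2"
        using diff[of m n] b[OF that(1)] b[OF that(2)] by auto
      then show ?thesis using e by (simp add: dist_norm power2_less_imp_less)
    qed
    then show "\<exists>N. \<forall>m\<ge>N. \<forall>n\<ge>N. dist (y m) (y n) < e" by blast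
  qed
  then obtain p where p: "y \<longlonglongrightarrow> p"
    using Cauchy_convergent_iff convergent_def by blast
  have pM: "p \<in> M" using closed_sequentially[OF M(2) y(1) p] .
  have "(\<lambda>n. (norm (x - y n))\<^sup>2) \<longlonglongrightarrow> (norm (x - p))\<^sup>2"
    by (intro tendsto_intros p)
  moreover have "(\<lambda>n. d + 1 / real (Suc n)) \<longlonglongrightarrow> d + 0"
    by (intro tendsto_intros LIMSEQ_Suc[OF lim_1_over_n])
  ultimately have min: "(norm (x - p))\<^sup>2 \<le> d"
    using y(2) by (intro LIMSEQ_le[of "\<lambda>n. (norm (x - y n))\<^sup>2" _ "\<lambda>n. d + 1 / real (Suc n)"])
      (auto intro: less_imp_le)
  have "cinner z (x - p) = 0" if z: "z \<in> M" for z
  proof (cases "z = 0")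
    case False
    \<comment> \<open>The coefficient of the component of \<open>x - p\<close> along
      \<open>z\<close>: moving \<open>p\<close> by \<open>c *\<^sub>C z\<close> would shorten the
      distance unless that component vanishes.\<close>
    define c where "c = cinner z (x - p) / complex_of_real ((norm z)\<^sup>2)"
    have "p + c *\<^sub>C z \<in> M"
      by (intro csubspace_add csubspace_scale M pM z)
    from dle[OF this] have "d \<le> (norm ((x - p) - c *\<^sub>C z))\<^sup>2"
      by (simp add: algebra_simps)
    also have "\<dots> = (norm (x - p))\<^sup>2 - (cmod (cinner z (x - p)))\<^sup>2 / (norm z)\<^sup>2"
      unfolding c_def by (rule norm_sub_component[OF False])
    finally have "(cmod (cinner z (x - p)))\<^sup>2 / (norm z)\<^sup>2 \<le> 0" using min by simp
    then show ?thesis using False by (simp add: divide_le_0_iff)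
  qed simp
  then show thesis using pM that by blast
qed

lemma cinner_eqI:
  assumes "\<And>z. cinner z x = cinner z (y::'a::chilbert_space)" shows "x = y"
proof -
  have "cinner (x - y) (x - y) = 0" using assms by (simp add: cinner_diff_right)
  then show ?thesis by simp
qed

lemma projection_unique:
  fixes x :: "'a::chilbert_space"
  assumes M: "csubspace M"
    and p: "p \<in> M" "\<And>y. y \<in> M \<Longrightarrow> cinner y (x - p) = 0"
    and q: "q \<in> M" "\<And>y. y \<in> M \<Longrightarrow> cinner y (x - q) = 0"
  shows "p = q"
proof -
  have m: "p - q \<in> M" using M p(1) q(1) by (rule csubspace_diff)
  have "cinner (p - q) (p - q) = cinner (p - q) (x - q) - cinner (p - q) (x - p)"
    by (simp add: cinner_diff_right)
  then show ?thesis using p(2)[OF m] q(2)[OF m] by simp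
qed

lemma orth_proj_unique:
  assumes M: "csubspace M" and "p \<in> M" "x - p \<in> orth M"
  shows "orth_proj M x = p"
  unfolding orth_proj_def
proof (rule the_equality)
  show "p \<in> M \<and> x - p \<in> orth M" using assms by simp
  show "q = p" if "q \<in> M \<and> x - q \<in> orth M" for q
    by (rule projection_unique[OF M, of q x p]) (use that assms in \<open>auto simp: orth_def\<close>)
qed

section \<open>Bounded operators, Riesz representation and adjoints\<close>

lemma whole_simps [simp]: "hcar whole = UNIV" "hadd whole = (+)" "hscale whole = scaleC"
  "hip whole = cinner"
  by (auto simp: whole_def)

lemma hnorm_whole [simp]: "hnorm whole x = norm x"
  by (simp add: hnorm_def norm_eq_sqrt_cinner)

lemma bounded_op_whole:
  assumes "bounded_op whole whole T"
  shows "bounded_linear T" "T (c *\<^sub>C x) = c *\<^sub>C T x"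
proof -
  obtain K where K: "\<And>x. norm (T x) \<le> K * norm x" using assms by (auto simp: bounded_op_def)
  show "bounded_linear T"
    by (rule bounded_linear_intro[of _ K]) 
      (use assms K in \<open>auto simp: bounded_op_def scaleR_eq_scaleC mult.commute\<close>)
  show "T (c *\<^sub>C x) = c *\<^sub>C T x" using assms by (simp add: bounded_op_def)
qed

lemma bounded_op_wholeI:
  assumes "\<And>x y. T (x + y) = T x + T y" "\<And>c x. T (c *\<^sub>C x) = c *\<^sub>C T x"
    "\<And>x. norm (T x) \<le> K * norm x"
  shows "bounded_op whole whole T"
  using assms by (auto simp: bounded_op_def)

text \<open>The kernel of a nonzero \<open>f\<close> has one-dimensional orthogonal complement,
  spanned by the component \<open>w\<close> of any \<open>u\<close> with
  \<open>f u \<noteq> 0\<close>; the representing vector is a multiple of \<open>w\<close>.\<close>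

lemma Riesz_representation:
  fixes f :: "'a::chilbert_space \<Rightarrow> complex"
  assumes f: "bounded_linear f" "\<And>c x. f (c *\<^sub>C x) = c * f x"
  obtains y where "\<And>x. f x = cinner y x"
proof (cases "\<forall>x. f x = 0")
  case True
  then show ?thesis using that[of 0] by simp
next
  case False
  then obtain u where u: "f u \<noteq> 0" by blast
  interpret f: bounded_linear f by fact
  have M: "csubspace {x. f x = 0}" "closed {x. f x = 0}"
    using f.continuous_on[OF continuous_on_id]
    by (auto simp: csubspace_def f.add f(2) closed_Collect_eq)
  obtain p where p: "f p = 0" "\<And>y. f y = 0 \<Longrightarrow> cinner y (u - p) = 0"
    using projection_exists[OF M, of u] by auto
  define w where "w = u - p"
  have fw: "f w = f u" by (simp add: w_def f.diff p)
  have w: "cinner w w \<noteq> 0" using fw u f.zero by auto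
  \<comment> \<open>The scalar is forced by \<open>f w = cinner y w\<close>; it is conjugated
    because the first argument is conjugate linear.\<close>
  define y where "y = cnj (f w / cinner w w) *\<^sub>C w"
  have "f x = cinner y x" for x
  proof -
    have "f (x - (f x / f w) *\<^sub>C w) = 0" using u fw by (simp add: f.diff f(2))
    then have "cinner (x - (f x / f w) *\<^sub>C w) w = 0" using p(2) w_def by blast
    then have "cinner w (x - (f x / f w) *\<^sub>C w) = 0"
      by (metis cinner_commute complex_cnj_zero)
    then have "cinner w x = (f x / f w) * cinner w w"
      by (simp add: cinner_diff_right cinner_scaleC_right)
    then show ?thesis using w u fw by (simp add: y_def cinner_scaleC_left)
  qed
  then show ?thesis using that by blast
qed

lemma adjoint_exists:
  fixes T :: "'a::chilbert_space \<Rightarrow> 'b::chilbert_space"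
  assumes "bounded_op whole whole T"
  obtains T' where "\<And>x y. cinner x (T' y) = cinner (T x) y"
proof -
  have "\<exists>z. \<forall>x. cinner x z = cinner (T x) y" for y
  proof -
    have 1: "bounded_linear (\<lambda>x. cinner y (T x))"
      using bounded_linear_compose[OF bounded_bilinear.bounded_linear_right[OF
          bounded_bilinear_cinner] bounded_op_whole(1)[OF assms]] .
    have 2: "cinner y (T (c *\<^sub>C x)) = c * cinner y (T x)" for c x
      using bounded_op_whole(2)[OF assms] by (simp add: cinner_scaleC_right)
    obtain z where "\<And>x. cinner y (T x) = cinner z x"
      using Riesz_representation[OF 1 2] by blast
    then show ?thesis by (metis cinner_commute)
  qed
  then show ?thesis using that by metis
qed

lemma adj_whole:
  assumes "\<And>x. cinner x y' = cinner (T x) y"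
  shows "adj whole whole T y = y'"
  unfolding adj_def by (rule the_equality) (use assms in \<open>auto intro: cinner_eqI\<close>)

lemma cinner_adj:
  assumes "bounded_op whole whole T"
  shows "cinner x (adj whole whole T y) = cinner (T x) y"
proof -
  obtain T' where T': "\<And>x y. cinner x (T' y) = cinner (T x) y"
    using adjoint_exists[OF assms] by blast
  have "adj whole whole T y = T' y" by (rule adj_whole) (rule T')
  then show ?thesis by (simp add: T')
qed

lemma
  fixes J :: "'a::chilbert_space \<Rightarrow> 'b::chilbert_space"
  assumes "isometric_embedding J"
  shows csubspace_range_isometric: "csubspace (range J)"
    and norm_isometric: "norm (J v) = norm v"
proof -
  have b: "bounded_op whole whole J" using assms by (simp add: isometric_embedding_def)
  note J = bounded_op_whole[OF b]
  interpret J: bounded_linear J by (rule J)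
  have n: "norm (J v) = norm v" for v
    using assms by (simp add: isometric_embedding_def norm_eq_sqrt_cinner)
  then show "norm (J v) = norm v" .
  show "csubspace (range J)"
    unfolding csubspace_def
  proof (intro conjI ballI allI)
    show "0 \<in> range J" by (metis J.zero rangeI)
    show "x + y \<in> range J" if "x \<in> range J" "y \<in> range J" for x y
      using that by (auto simp flip: J.add)
    show "c *\<^sub>C x \<in> range J" if "x \<in> range J" for c x
      using that by (auto simp flip: J(2))
  qed
qed

section \<open>Concrete models of Hausdorff completions\<close>

definition comb :: "('w \<Rightarrow> 'h::chilbert_space) \<Rightarrow> ('w \<Rightarrow> complex) \<Rightarrow> 'h" where
  "comb e c = (\<Sum>w | c w \<noteq> 0. c w *\<^sub>C e w)"

lemma comb_superset:
  assumes "finite B" "{w. c w \<noteq> 0} \<subseteq> B"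
  shows "comb e c = (\<Sum>w\<in>B. c w *\<^sub>C e w)"
  unfolding comb_def by (rule sum.mono_neutral_left) (use assms in auto)

lemma
  assumes "c \<in> formal_sums G" "d \<in> formal_sums G"
  shows formal_sums_lincomb: "(\<lambda>w. a * c w + b * d w) \<in> formal_sums G"
    and comb_lincomb: "comb e (\<lambda>w. a * c w + b * d w) = a *\<^sub>C comb e c + b *\<^sub>C comb e d"
proof -
  let ?B = "{w. c w \<noteq> 0} \<union> {w. d w \<noteq> 0}"
  have fin: "finite ?B" using assms by (simp add: formal_sums_def)
  have sub: "{w. a * c w + b * d w \<noteq> 0} \<subseteq> ?B" by auto
  show "(\<lambda>w. a * c w + b * d w) \<in> formal_sums G"
    using assms finite_subset[OF sub fin] by (auto simp: formal_sums_def subset_iff) (metis mult_zero_right add_0)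
  show "comb e (\<lambda>w. a * c w + b * d w) = a *\<^sub>C comb e c + b *\<^sub>C comb e d"
    unfolding comb_superset[OF fin sub] comb_superset[OF fin Un_upper1] comb_superset[OF fin Un_upper2]
    by (simp add: scaleC_add_left scaleC_sum_right scaleC_scaleC sum.distrib)
qed

lemma
  assumes "c \<in> formal_sums G" "d \<in> formal_sums G"
  shows formal_sums_diff: "(\<lambda>w. c w - d w) \<in> formal_sums G"
    and comb_diff: "comb e (\<lambda>w. c w - d w) = comb e c - comb e d"
  using formal_sums_lincomb[OF assms, of 1 "- 1"] comb_lincomb[OF assms, of e 1 "- 1"]
  by (simp_all add: scaleC_minus_left)

lemma
  assumes "w \<in> G"
  shows formal_sums_unit: "(\<lambda>v. if v = w then 1 else 0) \<in> formal_sums G"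
    and comb_unit: "comb e (\<lambda>v. if v = w then 1 else 0) = e w"
proof -
  show "(\<lambda>v. if v = w then 1 else 0) \<in> formal_sums G"
    using assms by (auto simp: formal_sums_def)
  have "comb e (\<lambda>v. if v = w then 1 else 0) = (\<Sum>v\<in>{w}. (if v = w then 1 else 0) *\<^sub>C e v)"
    by (rule comb_superset) auto
  then show "comb e (\<lambda>v. if v = w then 1 else 0) = e w" by simp
qed

text \<open>Once the kernel is the Gram matrix of a family \<open>e\<close> in a Hilbert space,
  \<open>comb e\<close> is isometric for the semi-inner product, and null vectors are exactly the
  formal sums it sends to zero.\<close>

lemma sip_comb:
  assumes "\<And>w w'. w \<in> G \<Longrightarrow> w' \<in> G \<Longrightarrow> \<kappa> w w' = cinner (e w) (e w')"
    and "c \<in> formal_sums G" "d \<in> formal_sums G"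
  shows "sip \<kappa> c d = cinner (comb e c) (comb e d)"
proof -
  have "cnj (c w) * d w' * \<kappa> w w' = cinner (c w *\<^sub>C e w) (d w' *\<^sub>C e w')"
    if "c w \<noteq> 0" "d w' \<noteq> 0" for w w'
  proof -
    have "w \<in> G" "w' \<in> G" using that assms by (auto simp: formal_sums_def)
    then show ?thesis by (simp add: assms(1) cinner_scaleC_left cinner_scaleC_right)
  qed
  then show ?thesis
    unfolding sip_def comb_def cinner_sum_right
    by (subst sum.swap) (simp add: cinner_sum_left)
qed

lemma csubspace_closure:
  fixes S :: "'h::chilbert_space set"
  assumes "csubspace S" shows "csubspace (closure S)"
  unfolding csubspace_def
proof (intro conjI ballI allI)
  show "0 \<in> closure S" using csubspace_0[OF assms] closure_subset by auto
next
  fix x y assume "x \<in> closure S" "y \<in> closure S"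
  then obtain u v where "\<And>n. u n \<in> S" "u \<longlonglongrightarrow> x" "\<And>n. v n \<in> S" "v \<longlonglongrightarrow> y"
    by (auto simp: closure_sequential)
  then have "\<forall>n. u n + v n \<in> S" "(\<lambda>n. u n + v n) \<longlonglongrightarrow> x + y"
    using csubspace_add[OF assms] by (auto intro: tendsto_add)
  then show "x + y \<in> closure S" by (auto simp: closure_sequential)
next
  fix c x assume "x \<in> closure S"
  then obtain u where "\<And>n. u n \<in> S" "u \<longlonglongrightarrow> x"
    by (auto simp: closure_sequential)
  then have "\<forall>n. c *\<^sub>C u n \<in> S" "(\<lambda>n. c *\<^sub>C u n) \<longlonglongrightarrow> c *\<^sub>C x"
    using csubspace_scale[OF assms] by (auto intro: tendsto_scaleC)
  then show "c *\<^sub>C x \<in> closure S" by (auto simp: closure_sequential)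
qed

lemma closed_span_eq_closure_comb: "closed_span (e ` G) = closure (comb e ` formal_sums G)"
proof
  have z: "(\<lambda>_. 0) \<in> formal_sums G" by (simp add: formal_sums_def)
  have sub: "csubspace (comb e ` formal_sums G)"
    unfolding csubspace_def
  proof (intro conjI ballI allI)
    show "0 \<in> comb e ` formal_sums G" using z by (force simp: comb_def intro: image_eqI)
    show "x + y \<in> comb e ` formal_sums G"
      if "x \<in> comb e ` formal_sums G" "y \<in> comb e ` formal_sums G" for x y
      using that formal_sums_lincomb[where a=1 and b=1 and G=G]
        comb_lincomb[where a=1 and b=1 and e=e and G=G] by (force intro: rev_image_eqI)
    show "c *\<^sub>C x \<in> comb e ` formal_sums G" if "x \<in> comb e ` formal_sums G" for c x
      using that formal_sums_lincomb[OF _ z, where a=c and b=0]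
        comb_lincomb[OF _ z, where a=c and b=0 and e=e] by (force intro: rev_image_eqI)
  qed
  have "e ` G \<subseteq> comb e ` formal_sums G"
    using formal_sums_unit[where G=G] comb_unit[where G=G and e=e] by (force intro: rev_image_eqI)
  then show "closed_span (e ` G) \<subseteq> closure (comb e ` formal_sums G)"
    using closure_subset[of "comb e ` formal_sums G"] by (intro closed_span_minimal csubspace_closure sub) auto
  have "comb e c \<in> closed_span (e ` G)" if "c \<in> formal_sums G" for c
  proof -
    have "(\<Sum>w\<in>B. c w *\<^sub>C e w) \<in> closed_span (e ` G)" if "finite B" "B \<subseteq> G" for B
      using that closed_span_superset[of "e ` G"]
      by (induction B) (auto simp: csubspace_0 intro!: csubspace_add csubspace_scale)
    then show ?thesis using that by (simp add: comb_def formal_sums_def)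
  qed
  then show "closure (comb e ` formal_sums G) \<subseteq> closed_span (e ` G)"
    by (intro closure_minimal) auto
qed

text \<open>The completion encodes a vector by its inner products with the generators; this is the
  code of the model vector \<open>x\<close>.\<close>

definition coord :: "'w set \<Rightarrow> ('w \<Rightarrow> 'h::chilbert_space) \<Rightarrow> 'h \<Rightarrow> 'w \<Rightarrow> complex" where
  "coord G e x = (\<lambda>w. if w \<in> G then cinner (e w) x else 0)"

text \<open>As \<open>comb e\<close> is isometric, Cauchy sequences of formal sums are those whose
  images converge in the complete space, and the coordinates of that limit are the limits of the
  coordinates.\<close>

lemma represents_iff:
  assumes \<kappa>: "\<And>w w'. w \<in> G \<Longrightarrow> w' \<in> G \<Longrightarrow> \<kappa> w w' = cinner (e w) (e w')"
  shows "represents G \<kappa> s f \<longleftrightarrow>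
    (\<forall>n. s n \<in> formal_sums G) \<and> (\<exists>x. (\<lambda>n. comb e (s n)) \<longlonglongrightarrow> x \<and> f = coord G e x)"
    (is "?L \<longleftrightarrow> ?R")
proof (cases "\<forall>n. s n \<in> formal_sums G")
  case True
  have sq: "sqrt (Re (sip \<kappa> (\<lambda>w. s m w - s n w) (\<lambda>w. s m w - s n w)))
      = dist (comb e (s m)) (comb e (s n))" for m n
    using True
    by (simp add: sip_comb[OF \<kappa>] formal_sums_diff comb_diff[of _ G] dist_norm norm_eq_sqrt_cinner)
  have unit: "sip \<kappa> (\<lambda>v. if v = w then 1 else 0) (s n) = cinner (e w) (comb e (s n))"
    if "w \<in> G" for w n
    using True that by (simp add: sip_comb[OF \<kappa>] formal_sums_unit comb_unit[of w G])
  show ?thesis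
  proof
    assume L: ?L
    then have "Cauchy (\<lambda>n. comb e (s n))"
      unfolding represents_def sq Cauchy_def by blast
    then obtain x where x: "(\<lambda>n. comb e (s n)) \<longlonglongrightarrow> x"
      using Cauchy_convergent_iff convergent_def by blast
    have "f w = coord G e x w" for w
    proof (cases "w \<in> G")
      case w: True
      have "(\<lambda>n. cinner (e w) (comb e (s n))) \<longlonglongrightarrow> f w"
        using L w by (simp add: represents_def unit)
      moreover have "(\<lambda>n. cinner (e w) (comb e (s n))) \<longlonglongrightarrow> cinner (e w) x"
        by (intro tendsto_cinner x tendsto_const)
      ultimately show ?thesis
        using w LIMSEQ_unique by (simp add: coord_def) blast
    qed (use L in \<open>simp add: represents_def coord_def\<close>)
    then show ?R using True x by auto
  next
    assume ?R
    then obtain x where x: "(\<lambda>n. comb e (s n)) \<longlonglongrightarrow> x" and f: "f = coord G e x" by blast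
    have "Cauchy (\<lambda>n. comb e (s n))" using x by (rule LIMSEQ_imp_Cauchy)
    moreover have "(\<lambda>n. cinner (e w) (comb e (s n))) \<longlonglongrightarrow> cinner (e w) x" for w
      by (intro tendsto_cinner x tendsto_const)
    ultimately show ?L
      unfolding represents_def sq Cauchy_def using True by (simp add: unit f coord_def)
  qed
qed (unfold represents_def, blast)

text \<open>A unitary \<open>U\<close> from a closed subspace \<open>M\<close> of a Hilbert space
  onto \<open>X\<close>. An \<open>hspace\<close> is a bare record without axioms, so all geometry
  of \<open>X\<close> is borrowed from \<open>M\<close> through \<open>U\<close>.\<close>

definition realises :: "'x hspace \<Rightarrow> 'h::chilbert_space set \<Rightarrow> ('h \<Rightarrow> 'x) \<Rightarrow> bool" where
  "realises X M U \<longleftrightarrow> csubspace M \<and> closed M \<and> bij_betw U M (hcar X) \<and>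
     (\<forall>x\<in>M. \<forall>y\<in>M. hadd X (U x) (U y) = U (x + y) \<and> hip X (U x) (U y) = cinner x y) \<and>
     (\<forall>c. \<forall>x\<in>M. hscale X c (U x) = U (c *\<^sub>C x))"

lemma realises_whole: "realises whole UNIV (\<lambda>x. x)"
  by (auto simp: realises_def csubspace_def bij_betw_def)

text \<open>Two vectors with the same code differ by a vector that is orthogonal to all generators,
  yet lies in their closed span, hence is orthogonal to itself.\<close>

lemma coord_inj: "inj_on (coord G e) (closed_span (e ` G))"
proof (rule inj_onI)
  fix x y assume xy: "x \<in> closed_span (e ` G)" "y \<in> closed_span (e ` G)" "coord G e x = coord G e y"
  have 1: "cinner (e w) (x - y) = 0" if "w \<in> G" for w
    using fun_cong[OF xy(3), of w] that by (simp add: coord_def cinner_diff_right)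
  have 2: "x - y \<in> closed_span (e ` G)"
    by (intro csubspace_diff csubspace_closed_span xy(1,2))
  have "cinner (x - y) (x - y) = 0"
    by (rule orth_closed_span[OF _ 2]) (use 1 in blast)
  then show "x = y" by simp
qed

text \<open>A Hausdorff completion depends on its kernel alone, so any family of vectors having that
  kernel as Gram matrix provides a model, namely its closed span.\<close>

lemma realises_completion:
  assumes \<kappa>: "\<And>w w'. w \<in> G \<Longrightarrow> w' \<in> G \<Longrightarrow> \<kappa> w w' = cinner (e w) (e w')"
  shows "realises (hausdorff_completion G \<kappa>) (closed_span (e ` G)) (coord G e)"
proof -
  let ?M = "closed_span (e ` G)"
  have R: "represents G \<kappa> s f \<longleftrightarrow> (\<forall>n. s n \<in> formal_sums G) \<and>
      (\<exists>x. (\<lambda>n. comb e (s n)) \<longlonglongrightarrow> x \<and> f = coord G e x)" for s f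
    by (rule represents_iff) (rule \<kappa>)
  have rep: "\<exists>s. represents G \<kappa> s (coord G e x)" if x: "x \<in> ?M" for x
  proof -
    obtain z where z: "\<And>n. z n \<in> comb e ` formal_sums G" "z \<longlonglongrightarrow> x"
      using x unfolding closed_span_eq_closure_comb closure_sequential by blast
    define s where "s n = inv_into (formal_sums G) (comb e) (z n)" for n
    have s: "s n \<in> formal_sums G" "comb e (s n) = z n" for n
      unfolding s_def using z(1) by (rule inv_into_into, rule f_inv_into_f)
    then have "(\<lambda>n. comb e (s n)) = z" by auto
    then show ?thesis unfolding R using s z(2) by metis
  qed
  have lim: "x \<in> ?M" if "\<And>n. s n \<in> formal_sums G" "(\<lambda>n. comb e (s n)) \<longlonglongrightarrow> x" for s x
    unfolding closed_span_eq_closure_comb closure_sequential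
    using that by (intro exI[of _ "\<lambda>n. comb e (s n)"]) simp
  have car: "hcar (hausdorff_completion G \<kappa>) = coord G e ` ?M"
  proof (intro equalityI subsetI)
    fix f assume "f \<in> hcar (hausdorff_completion G \<kappa>)"
    then obtain s where "represents G \<kappa> s f" by (auto simp: hausdorff_completion_def)
    then show "f \<in> coord G e ` ?M"
      using lim by (auto simp: R)
  qed (use rep in \<open>auto simp: hausdorff_completion_def\<close>)
  have lim_unique: "(\<lambda>n. comb e (s n)) \<longlonglongrightarrow> x" if r: "represents G \<kappa> s (coord G e x)" and x: "x \<in> ?M" for s x
  proof -
    obtain x' where x': "\<And>n. s n \<in> formal_sums G" "(\<lambda>n. comb e (s n)) \<longlonglongrightarrow> x'"
      "coord G e x = coord G e x'"
      using r by (auto simp: R)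
    then have "x = x'" using inj_onD[OF coord_inj _ x lim] by blast
    then show ?thesis using x' by simp
  qed
  have hip: "hip (hausdorff_completion G \<kappa>) (coord G e x) (coord G e y) = cinner x y"
    if x: "x \<in> ?M" and y: "y \<in> ?M" for x y
  proof -
    let ?P = "\<lambda>l. \<forall>s t. represents G \<kappa> s (coord G e x) \<and> represents G \<kappa> t (coord G e y) \<longrightarrow>
               (\<lambda>n. sip \<kappa> (s n) (t n)) \<longlonglongrightarrow> l"
    have P: "?P (cinner x y)"
    proof (intro allI impI)
      fix s t assume st: "represents G \<kappa> s (coord G e x) \<and> represents G \<kappa> t (coord G e y)"
      then have "sip \<kappa> (s n) (t n) = cinner (comb e (s n)) (comb e (t n))" for n
        by (intro sip_comb \<kappa>) (auto simp: represents_def)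
      then show "(\<lambda>n. sip \<kappa> (s n) (t n)) \<longlonglongrightarrow> cinner x y"
        using st lim_unique x y by (simp add: tendsto_cinner)
    qed
    \<comment> \<open>Without representing sequences the condition \<open>?P\<close> would hold
      vacuously for every number; their existence makes the described value unique.\<close>
    obtain s t where st: "represents G \<kappa> s (coord G e x)" "represents G \<kappa> t (coord G e y)"
      using rep x y by blast
    have "l = cinner x y" if "?P l" for l
      using that P st LIMSEQ_unique by blast
    then have "(THE l. ?P l) = cinner x y" using P by (intro the_equality)
    then show ?thesis by (simp add: hausdorff_completion_def)
  qed
  show ?thesis
    unfolding realises_def
    using coord_inj hip car
    by (auto simp: bij_betw_def hausdorff_completion_def coord_def cinner_add_right cinner_scaleC_right)
qed

lemma realisesD:
  assumes "realises X M U"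
  shows "csubspace M" "closed M" "x \<in> M \<Longrightarrow> U x \<in> hcar X" "hcar X = U ` M"
    "x \<in> M \<Longrightarrow> y \<in> M \<Longrightarrow> hadd X (U x) (U y) = U (x + y)"
    "x \<in> M \<Longrightarrow> y \<in> M \<Longrightarrow> hip X (U x) (U y) = cinner x y"
    "x \<in> M \<Longrightarrow> hscale X c (U x) = U (c *\<^sub>C x)"
    "x \<in> M \<Longrightarrow> hnorm X (U x) = norm x"
    "x \<in> M \<Longrightarrow> y \<in> M \<Longrightarrow> U x = U y \<longleftrightarrow> x = y"
    "x \<in> M \<Longrightarrow> inv_into M U (U x) = x"
    "f \<in> hcar X \<Longrightarrow> U (inv_into M U f) = f"
    "f \<in> hcar X \<Longrightarrow> inv_into M U f \<in> M"
  using assms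
  by (auto simp: realises_def bij_betw_def hnorm_def norm_eq_sqrt_cinner inj_on_eq_iff
      f_inv_into_f inv_into_into)

text \<open>The zeros of \<open>D\<close> in \<open>M\<close> form a closed subspace. The bound
  \<open>K\<close> takes the place of continuity, since \<open>D\<close> is controlled on
  \<open>M\<close> only.\<close>

lemma zero_on_closed_span:
  fixes D :: "'h::chilbert_space \<Rightarrow> 'k::chilbert_space"
  assumes M: "closed_span S = M"
    and add: "\<And>x y. x \<in> M \<Longrightarrow> y \<in> M \<Longrightarrow> D (x + y) = D x + D y"
    and scale: "\<And>c x. x \<in> M \<Longrightarrow> D (c *\<^sub>C x) = c *\<^sub>C D x"
    and bd: "\<And>x. x \<in> M \<Longrightarrow> norm (D x) \<le> K * norm x"
    and zero: "\<And>x. x \<in> S \<Longrightarrow> D x = 0"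
    and x: "x \<in> M"
  shows "D x = 0"
proof -
  have sM: "csubspace M" and cM: "closed M" using M by auto
  have D0: "D 0 = 0" using scale[of 0 0] csubspace_0[OF sM] by simp
  have "closed_span S \<subseteq> {x \<in> M. D x = 0}"
  proof (rule closed_span_minimal)
    show "csubspace {x \<in> M. D x = 0}"
      using sM by (auto simp: csubspace_def D0 add scale)
    show "closed {x \<in> M. D x = 0}"
      unfolding closed_sequential_limits
    proof (intro allI impI, elim conjE)
      fix u l assume u: "\<forall>n. u n \<in> {x \<in> M. D x = 0}" and l: "u \<longlonglongrightarrow> l"
      have lM: "l \<in> M" using closed_sequentially[OF cM _ l] u by auto
      have "norm (D l) \<le> K * norm (l - u n)" for n
      proof -
        have un: "u n \<in> M" "D (u n) = 0" using u by auto
        have m: "l - u n \<in> M" using sM lM un(1) by (rule csubspace_diff)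
        have "D ((l - u n) + u n) = D (l - u n)" using add[OF m un(1)] un(2) by simp
        then show ?thesis using bd[OF m] by simp
      qed
      moreover have "(\<lambda>n. K * norm (l - u n)) \<longlonglongrightarrow> K * norm (l - l)"
        by (intro tendsto_intros l)
      ultimately have "norm (D l) \<le> K * norm (l - l)"
        by (intro LIMSEQ_le_const) auto
      then show "l \<in> {x \<in> M. D x = 0}" using lM by simp
    qed
    show "S \<subseteq> {x \<in> M. D x = 0}" using zero closed_span_superset[of S] M by auto
  qed
  then show ?thesis using x M by auto
qed

text \<open>Conjugating \<open>B\<close> by the unitaries gives one candidate for the description.
  Any other candidate, pulled back to the models, differs from \<open>B\<close> by a bounded linear
  map that vanishes on a total set.\<close>

lemma ext_op_realises:
  fixes X :: "'x hspace" and Y :: "'y hspace"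
    and M :: "'h::chilbert_space set" and N :: "'k::chilbert_space set"
  assumes X: "realises X M U" and Y: "realises Y N V"
    and d: "\<And>w. w \<in> G \<Longrightarrow> e w = U (d w)" "closed_span (d ` G) = M"
    and B: "\<And>x. x \<in> M \<Longrightarrow> B x \<in> N" "\<And>x y. x \<in> M \<Longrightarrow> y \<in> M \<Longrightarrow> B (x + y) = B x + B y"
      "\<And>c x. x \<in> M \<Longrightarrow> B (c *\<^sub>C x) = c *\<^sub>C B x" "\<And>x. x \<in> M \<Longrightarrow> norm (B x) \<le> K * norm x"
    and t: "\<And>w. w \<in> G \<Longrightarrow> t w = V (B (d w))"
    and x: "x \<in> M"
  shows "ext_op X Y G e t (U x) = V (B x)"
proof -
  note XD = realisesD[OF X] and YD = realisesD[OF Y]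
  have dM: "d w \<in> M" if "w \<in> G" for w using that d(2) closed_span_superset[of "d ` G"] by auto
  let ?P = "\<lambda>T. T \<in> extensional (hcar X) \<and> bounded_op X Y T \<and> (\<forall>w\<in>G. T (e w) = t w)"
  \<comment> \<open>The value off the carrier is dictated by \<open>extensional\<close>, which makes
    the operator unique as a function.\<close>
  define T where "T = (\<lambda>f. if f \<in> hcar X then V (B (inv_into M U f)) else undefined)"
  have TU: "T (U y) = V (B y)" if "y \<in> M" for y
    using that by (simp add: T_def XD)
  have "bounded_op X Y T"
    unfolding bounded_op_def
  proof (intro conjI ballI allI exI)
    fix f assume "f \<in> hcar X"
    then obtain y where y: "f = U y" "y \<in> M" by (auto simp: XD(4))
    show "T f \<in> hcar Y" using y by (simp add: TU B(1) YD)
    show "hnorm Y (T f) \<le> K * hnorm X f" using y by (simp add: TU B XD YD)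
    show "T (hscale X c f) = hscale Y c (T f)" for c
      using y by (simp add: TU B XD YD csubspace_scale)
    fix g assume "g \<in> hcar X"
    then obtain z where z: "g = U z" "z \<in> M" by (auto simp: XD(4))
    show "T (hadd X f g) = hadd Y (T f) (T g)"
      using y z by (simp add: TU B XD YD csubspace_add)
  qed
  then have PT: "?P T" using dM by (auto simp: TU d t) (simp add: T_def extensional_def)
  have "T' = T" if P: "?P T'" for T'
  proof (rule extensionalityI[of _ "hcar X"])
    fix f assume "f \<in> hcar X"
    then obtain y where y: "f = U y" "y \<in> M" by (auto simp: XD(4))
    define C where "C = (\<lambda>z. inv_into N V (T' (U z)))"
    from P obtain K' where K': "\<And>f. f \<in> hcar X \<Longrightarrow> hnorm Y (T' f) \<le> K' * hnorm X f"
      unfolding bounded_op_def by blast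
    have T'car: "T' (U z) \<in> hcar Y" if "z \<in> M" for z
      using P that XD(3) by (auto simp: bounded_op_def)
    have VC: "V (C z) = T' (U z)" and CN: "C z \<in> N" if "z \<in> M" for z
      using T'car[OF that] by (auto simp: C_def YD)
    have Cadd: "C (z + z') = C z + C z'" if "z \<in> M" "z' \<in> M" for z z'
    proof -
      have "V (C (z + z')) = T' (hadd X (U z) (U z'))"
        using that by (simp add: VC XD csubspace_add)
      also have "\<dots> = hadd Y (T' (U z)) (T' (U z'))"
        using P that by (auto simp: bounded_op_def XD(3))
      also have "\<dots> = V (C z + C z')" using that by (simp add: VC[symmetric] CN YD)
      finally show ?thesis using that by (simp add: YD(9) CN YD(1) XD(1) csubspace_add)
    qed
    have Csc: "C (c *\<^sub>C z) = c *\<^sub>C C z" if "z \<in> M" for c z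
    proof -
      have "V (C (c *\<^sub>C z)) = T' (hscale X c (U z))"
        using that by (simp add: VC XD csubspace_scale)
      also have "\<dots> = hscale Y c (T' (U z))"
        using P that by (auto simp: bounded_op_def XD(3))
      also have "\<dots> = V (c *\<^sub>C C z)" using that by (simp add: VC[symmetric] CN YD)
      finally show ?thesis using that by (simp add: YD(9) CN YD(1) XD(1) csubspace_scale)
    qed
    have Cbd: "norm (C z) \<le> K' * norm z" if "z \<in> M" for z
    proof -
      have "norm (C z) = hnorm Y (T' (U z))" using that by (simp add: VC[symmetric] YD(8) CN)
      then show ?thesis using K'[of "U z"] that by (simp add: XD)
    qed
    have "C y - B y = 0"
    proof (rule zero_on_closed_span[OF d(2) _ _ _ _ y(2), where D="\<lambda>y. C y - B y" and K="K' + K"])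
      show "C z - B z = 0" if z: "z \<in> d ` G" for z
      proof -
        obtain w where w: "w \<in> G" "z = d w" using z by blast
        have "V (C z) = T' (e w)" using w by (simp add: VC dM d(1))
        also have "\<dots> = V (B z)" using P w by (simp add: t)
        finally have "V (C z) = V (B z)" .
        then show ?thesis using w by (simp add: YD(9) CN B dM)
      qed
      show "norm (C z - B z) \<le> (K' + K) * norm z" if "z \<in> M" for z
        using norm_triangle_ineq4[of "C z" "B z"] Cbd[OF that] B(4)[OF that]
        by (simp add: distrib_right)
    qed (simp_all add: Cadd Csc B scaleC_diff_right)
    then show "T' f = T f" using y by (simp add: VC[symmetric] TU)
  qed (use P PT in auto)
  then have "ext_op X Y G e t = T" unfolding ext_op_def using PT by (intro the_equality)
  then show ?thesis using TU[OF x] by simp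
qed

lemma adj_realises:
  assumes X: "realises X M U" and p: "p \<in> M" "\<And>z. z \<in> M \<Longrightarrow> cinner z p = cinner (T (U z)) y"
  shows "adj X whole T y = U p"
proof -
  note XD = realisesD[OF X]
  show ?thesis
    unfolding adj_def
  proof (rule the_equality)
    show "U p \<in> hcar X \<and> (\<forall>z\<in>hcar X. hip X z (U p) = hip whole (T z) y)"
      using p by (auto simp: XD(4,6))
    fix f assume f: "f \<in> hcar X \<and> (\<forall>z\<in>hcar X. hip X z f = hip whole (T z) y)"
    then obtain q where q: "f = U q" "q \<in> M" by (auto simp: XD(4))
    have m: "q - p \<in> M" using XD(1) q(2) p(1) by (rule csubspace_diff)
    have "cinner (q - p) q = cinner (q - p) p"
      using f m q p(2)[OF m] by (auto simp: XD)
    then have "cinner (q - p) (q - p) = 0" by (simp add: cinner_diff_right)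
    then show "f = U p" using q by simp
  qed
qed

section \<open>Positivity in C*-algebras\<close>

lemma star_zero [simp]: "star (0::'a::cstar_algebra) = 0"
  using star_scaleC[of 0 "0::'a"] by simp

lemma star_one [simp]: "star (1::'a::cstar_algebra) = 1"
proof -
  have "star (star 1 * 1) = star 1 * star (star (1::'a))" by (rule star_mult)
  then show ?thesis by (simp add: star_star)
qed

lemma star_minus: "star (- a) = - star (a::'a::cstar_algebra)"
  using star_scaleC[of "- 1" a] by (simp add: scaleC_minus_left)

lemma star_diff: "star (a - b) = star a - star (b::'a::cstar_algebra)"
  using star_add[of a "- b"] by (simp add: star_minus)

lemma star_scaleR: "star (r *\<^sub>R a) = r *\<^sub>R star (a::'a::cstar_algebra)"
  by (simp add: scaleR_eq_scaleC star_scaleC)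

lemma star_sum: "star (\<Sum>i\<in>I. f i) = (\<Sum>i\<in>I. star (f i::'a::cstar_algebra))"
  by (induction I rule: infinite_finite_induct) (auto simp: star_add)

lemmas star_simps = star_add star_diff star_minus star_scaleR star_scaleC star_mult star_star

text \<open>The C*-identity and submultiplicativity give \<open>norm a \<le> norm (star a)\<close>;
  applied to \<open>star a\<close> this is the reverse inequality.\<close>

lemma norm_star [simp]: "norm (star a) = norm (a::'a::cstar_algebra)"
proof -
  have "norm a \<le> norm (star a)" for a :: 'a
  proof (cases "a = 0")
    case False
    have "norm a * norm a \<le> norm (star a) * norm a"
      using norm_mult_ineq[of "star a" a] by (simp add: cstar_identity power2_eq_square)
    then show ?thesis using False by simp
  qed simp
  from this[of a] this[of "star a"] show ?thesis by (simp add: star_star)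
qed

lemma norm_mult_star: "norm (a * star a) = (norm (a::'a::cstar_algebra))\<^sup>2"
  using cstar_identity[of "star a"] by (simp add: star_star)

lemma norm_selfadjoint_square: "star a = a \<Longrightarrow> norm (a * a) = (norm (a::'a::cstar_algebra))\<^sup>2"
  using cstar_identity[of a] by simp

lemma norm_one_le: "norm (1::'a::cstar_algebra) \<le> 1"
  using cstar_identity[of "1::'a"] by (cases "norm (1::'a) = 0") (auto simp: power2_eq_square)

lemma norm_scaleR_one_le: "r \<ge> 0 \<Longrightarrow> norm (r *\<^sub>R (1::'a::cstar_algebra)) \<le> r"
  using norm_one_le mult_left_le[of "norm (1::'a)" r] by simp

lemma bounded_linear_star: "bounded_linear (star :: 'a::cstar_algebra \<Rightarrow> 'a)"
  by (rule bounded_linear_intro[of _ 1]) (auto simp: star_simps)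

text \<open>The series of \<open>1 - sqrt (1 - y)\<close> is summed by iterating \<open>w \<mapsto> (y + w\<^sup>2) / 2\<close>; the
  iteration is dominated by the scalar one for \<open>y = 1\<close>.\<close>

lemma sqrt_one_minus:
  fixes y :: "'a::cstar_algebra"
  assumes sa: "star y = y" and le: "norm y \<le> 1"
  obtains w where "star w = w" "norm w \<le> 1" "(1 - w) * (1 - w) = 1 - y"
    "\<And>b. b * y = y * b \<Longrightarrow> b * w = w * b"
proof -
  \<comment> \<open>A fixed point satisfies \<open>w + w = y + w * w\<close>, which is
    \<open>(1 - w) * (1 - w) = 1 - y\<close>.\<close>
  define W where "W = rec_nat (0::'a) (\<lambda>_ w. (1/2) *\<^sub>R (y + w * w))"
  define s where "s = rec_nat (0::real) (\<lambda>_ t. (1 + t * t) / 2)"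
  have W0: "W 0 = 0" and WS: "\<And>k. W (Suc k) = (1/2) *\<^sub>R (y + W k * W k)" by (simp_all add: W_def)
  have s0: "s 0 = 0" and sS: "\<And>k. s (Suc k) = (1 + s k * s k) / 2" by (simp_all add: s_def)
  have saW: "star (W k) = W k" for k
    by (induction k) (simp_all add: W0 WS star_simps sa)
  have comm: "b * W k = W k * b" if "b * y = y * b" for b k
  proof (induction k)
    case (Suc k)
    have "b * (W k * W k) = (W k * W k) * b" by (metis Suc mult.assoc)
    then show ?case using that by (simp add: WS distrib_left distrib_right)
  qed (simp add: W0)
  have Wy: "W k * y = y * W k" for k using comm[of y k] by simp
  have WW: "W j * W k = W k * W j" for j k by (rule comm) (rule Wy)
  have s01: "0 \<le> s k \<and> s k \<le> 1" for k
  proof (induction k)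
    case (Suc k)
    then have "s k * s k \<le> 1" by (simp add: mult_le_one)
    then show ?case using Suc by (simp add: sS)
  qed (simp add: s0)
  have nW: "norm (W k) \<le> s k" for k
  proof (induction k)
    case (Suc k)
    have "norm (y + W k * W k) \<le> 1 + s k * s k"
      using Suc s01[of k]
      by (intro norm_triangle_le add_mono le order_trans[OF norm_mult_ineq] mult_mono) auto
    then show ?case by (simp add: WS sS)
  qed (simp add: W0 s0)
  \<comment> \<open>The iterates commute, so a difference of squares factors; bounding both factors
    by their scalar counterparts reproduces exactly the next increment of \<open>s\<close>.
    Convergence of the bounded increasing \<open>s\<close> then makes \<open>W\<close>
    Cauchy.\<close>
  have step: "norm (W (Suc k) - W k) \<le> s (Suc k) - s k" for k
  proof (induction k)
    case 0
    show ?case using le by (simp add: W0 WS s0 sS)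
  next
    case (Suc k)
    let ?V = "W (Suc k)" and ?t = "s (Suc k)"
    have "W (Suc (Suc k)) - W (Suc k) = (1/2) *\<^sub>R (?V * ?V - W k * W k)"
      unfolding WS[of "Suc k"] WS[of k] by (simp add: algebra_simps)
    also have "?V * ?V - W k * W k = (?V - W k) * (?V + W k)"
      using WW[of "Suc k" k] by (simp add: algebra_simps)
    finally have "norm (W (Suc (Suc k)) - ?V) = norm ((?V - W k) * (?V + W k)) / 2" by simp
    also have "norm ((?V - W k) * (?V + W k)) \<le> (?t - s k) * (?t + s k)"
      using Suc nW[of "Suc k"] nW[of k] order_trans[OF norm_ge_zero Suc]
      by (intro order_trans[OF norm_mult_ineq] mult_mono norm_triangle_le add_mono) auto
    also have "(?t - s k) * (?t + s k) / 2 = s (Suc (Suc k)) - s (Suc k)"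
      unfolding sS[of "Suc k"] sS[of k] by (simp add: field_simps)
    finally show ?case by simp
  qed
  have tel: "norm (W m - W n) \<le> s m - s n" if "n \<le> m" for m n
    using that
  proof (induction m rule: dec_induct)
    case (step m)
    have "norm (W (Suc m) - W n) \<le> norm (W (Suc m) - W m) + norm (W m - W n)"
      using norm_triangle_ineq[of "W (Suc m) - W m" "W m - W n"] by simp
    then show ?case using step.IH \<open>\<And>k. norm (W (Suc k) - W k) \<le> s (Suc k) - s k\<close>[of m] by linarith
  qed simp
  have "incseq s"
    by (rule incseq_SucI) (use step order_trans[OF norm_ge_zero] in fastforce)
  then have "convergent s"
    using s01 by (intro Bseq_mono_convergent) (auto intro!: BseqI'[of _ 1] simp: incseq_def)
  then have cs: "Cauchy s" by (rule convergent_Cauchy)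
  have "Cauchy W"
    unfolding Cauchy_def
  proof (intro allI impI)
    fix e :: real assume "e > 0"
    then obtain N where N: "\<And>m n. m \<ge> N \<Longrightarrow> n \<ge> N \<Longrightarrow> dist (s m) (s n) < e"
      using cs unfolding Cauchy_def by blast
    have "dist (W m) (W n) < e" if "m \<ge> N" "n \<ge> N" for m n
    proof (cases "n \<le> m")
      case True
      then show ?thesis using tel[OF True] N[OF that] by (simp add: dist_norm)
    next
      case False
      then have "m \<le> n" by simp
      from tel[OF this] N[OF that] show ?thesis by (simp add: dist_norm norm_minus_commute)
    qed
    then show "\<exists>N. \<forall>m\<ge>N. \<forall>n\<ge>N. dist (W m) (W n) < e" by blast
  qed
  then obtain w where w: "W \<longlonglongrightarrow> w"
    using Cauchy_convergent_iff convergent_def by blast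
  have "star w = w"
  proof (rule LIMSEQ_unique[OF _ w])
    show "W \<longlonglongrightarrow> star w"
      using bounded_linear.tendsto[OF bounded_linear_star w] by (simp add: saW)
  qed
  moreover have "norm w \<le> 1"
  proof (rule LIMSEQ_le_const2[OF tendsto_norm[OF w]])
    show "\<exists>N. \<forall>n\<ge>N. norm (W n) \<le> 1" using nW s01 order_trans by blast
  qed
  moreover have "(1 - w) * (1 - w) = 1 - y"
  proof -
    have "(\<lambda>k. W (Suc k)) \<longlonglongrightarrow> (1/2) *\<^sub>R (y + w * w)"
      unfolding WS by (intro tendsto_intros w)
    moreover have "(\<lambda>k. W (Suc k)) \<longlonglongrightarrow> w" using w by (rule LIMSEQ_Suc)
    ultimately have "w = (1/2) *\<^sub>R (y + w * w)" using LIMSEQ_unique by blast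
    then have "2 *\<^sub>R w = 2 *\<^sub>R ((1/2) *\<^sub>R (y + w * w))" by (rule arg_cong)
    then have "w + w = y + w * w" by (simp add: scaleR_2)
    then show ?thesis by (simp add: left_diff_distrib right_diff_distrib algebra_simps)
  qed
  moreover have "b * w = w * b" if "b * y = y * b" for b
  proof (rule LIMSEQ_unique)
    show "(\<lambda>k. b * W k) \<longlonglongrightarrow> b * w" by (intro tendsto_intros w)
    show "(\<lambda>k. b * W k) \<longlonglongrightarrow> w * b" unfolding comm[OF that] by (intro tendsto_intros w)
  qed
  ultimately show thesis using that by blast
qed

text \<open>A norm characterisation of the elements with spectrum in \<open>[0, \<infinity>)\<close>, visibly a cone. It
  coincides with \<open>cstar_pos\<close>.\<close>

definition cpos :: "'a::cstar_algebra \<Rightarrow> bool" where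
  "cpos a \<longleftrightarrow> star a = a \<and> (\<exists>t\<ge>0. norm (t *\<^sub>R 1 - a) \<le> t)"

lemma cposI: "star a = a \<Longrightarrow> 0 \<le> t \<Longrightarrow> norm (t *\<^sub>R 1 - a) \<le> t \<Longrightarrow> cpos a"
  by (auto simp: cpos_def)

lemma cpos_zero [simp]: "cpos 0"
  by (rule cposI[of _ 0]) auto

lemma cpos_add:
  assumes "cpos a" "cpos b" shows "cpos (a + b)"
proof -
  obtain s t where st: "s \<ge> 0" "t \<ge> 0" "norm (s *\<^sub>R 1 - a) \<le> s" "norm (t *\<^sub>R 1 - b) \<le> t"
    and sa: "star a = a" "star b = b"
    using assms by (auto simp: cpos_def)
  have "norm ((s *\<^sub>R 1 - a) + (t *\<^sub>R 1 - b)) \<le> s + t"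
    using st by (intro norm_triangle_le add_mono)
  also have "(s *\<^sub>R 1 - a) + (t *\<^sub>R 1 - b) = (s + t) *\<^sub>R 1 - (a + b)"
    by (simp add: algebra_simps)
  finally show ?thesis
    using st sa by (intro cposI[of _ "s + t"]) (auto simp: star_add)
qed

lemma cpos_scaleR:
  assumes "cpos a" "r \<ge> 0" shows "cpos (r *\<^sub>R a)"
proof -
  obtain t where t: "t \<ge> 0" "norm (t *\<^sub>R 1 - a) \<le> t" and sa: "star a = a"
    using assms by (auto simp: cpos_def)
  have "(r * t) *\<^sub>R 1 - r *\<^sub>R a = r *\<^sub>R (t *\<^sub>R 1 - a)"
    by (simp add: algebra_simps)
  then show ?thesis
    using t sa assms(2) by (intro cposI[of _ "r * t"]) (auto simp: star_scaleR mult_left_mono)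
qed

lemma cpos_sum: "(\<And>i. i \<in> I \<Longrightarrow> cpos (f i)) \<Longrightarrow> cpos (\<Sum>i\<in>I. f i)"
  by (induction I rule: infinite_finite_induct) (auto intro: cpos_add)

lemma cpos_norm_diff:
  assumes "star a = a" "norm a \<le> r" shows "cpos (r *\<^sub>R 1 - a)"
  by (rule cposI[of _ r]) (use assms order_trans[OF norm_ge_zero] in \<open>auto simp: star_simps\<close>)

lemma cpos_scaleR_one: "r \<ge> 0 \<Longrightarrow> cpos (r *\<^sub>R 1)"
  using cpos_norm_diff[of 0 r] by simp

text \<open>If \<open>a\<close> is within \<open>t\<close> of \<open>t *\<^sub>R 1\<close>, then
  \<open>a\<close> is \<open>t\<close> times some \<open>1 - y\<close> with
  \<open>norm y \<le> 1\<close>, and \<open>sqrt t *\<^sub>R (1 - w)\<close> is a root. It is within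
  \<open>sqrt t\<close> of \<open>sqrt t *\<^sub>R 1\<close>, so positive again; commutation is
  inherited from the iteration.\<close>

lemma cpos_sqrt:
  assumes "cpos a"
  obtains z where "star z = z" "z * z = a" "cpos z" "\<And>b. b * a = a * b \<Longrightarrow> b * z = z * b"
proof -
  obtain t where t: "t \<ge> 0" "norm (t *\<^sub>R 1 - a) \<le> t" and sa: "star a = a"
    using assms by (auto simp: cpos_def)
  show ?thesis
  proof (cases "t = 0")
    case True
    then have "a = 0" using t by simp
    then show ?thesis using that[of 0] by simp
  next
    case False
    with t have tp: "t > 0" by simp
    define y where "y = 1 - (1/t) *\<^sub>R a"
    have "y = (1/t) *\<^sub>R (t *\<^sub>R 1 - a)" using tp by (simp add: y_def algebra_simps)
    then have "norm y \<le> 1" using t tp by (simp add: divide_le_eq)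
    moreover have "star y = y" using sa by (simp add: y_def star_simps)
    ultimately obtain w where w: "star w = w" "norm w \<le> 1" "(1 - w) * (1 - w) = 1 - y"
      "\<And>b. b * y = y * b \<Longrightarrow> b * w = w * b"
      using sqrt_one_minus by blast
    define z where "z = sqrt t *\<^sub>R (1 - w)"
    have "star z = z" using w by (simp add: z_def star_simps)
    moreover have "z * z = a"
    proof -
      have "z * z = t *\<^sub>R ((1 - w) * (1 - w))" using tp by (simp add: z_def)
      also have "\<dots> = a" unfolding w(3) y_def using tp by simp
      finally show ?thesis .
    qed
    moreover have "cpos z"
    proof (rule cposI[of _ "sqrt t"])
      have "sqrt t *\<^sub>R 1 - z = sqrt t *\<^sub>R w" by (simp add: z_def algebra_simps)
      then show "norm (sqrt t *\<^sub>R 1 - z) \<le> sqrt t"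
        using w(2) tp by (simp add: mult_left_le)
    qed (use tp calculation in auto)
    moreover have "b * z = z * b" if "b * a = a * b" for b
    proof -
      have "b * y = y * b" using that by (simp add: y_def algebra_simps)
      from w(4)[OF this] show ?thesis by (simp add: z_def algebra_simps)
    qed
    ultimately show ?thesis using that by blast
  qed
qed

text \<open>\<open>x\<close> is the real part of \<open>x + \<i> e\<close>, which is \<open>r\<close> times an isometry.\<close>

lemma norm_selfadjoint_le:
  fixes x e :: "'a::cstar_algebra"
  assumes "star x = x" "star e = e" "x * e = e * x"
    and "x * x + e * e = r\<^sup>2 *\<^sub>R 1" and "r \<ge> 0"
  shows "norm (x + \<i> *\<^sub>C e) \<le> r" "norm x \<le> r"
proof -
  let ?u = "x + \<i> *\<^sub>C e"
  have "star ?u * ?u = (x - \<i> *\<^sub>C e) * (x + \<i> *\<^sub>C e)"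
    using assms by (simp add: star_simps scaleC_minus_left)
  also have "\<dots> = x * x + e * e + (x * (\<i> *\<^sub>C e) - (\<i> *\<^sub>C e) * x)"
    by (simp add: algebra_simps scaleC_mult_left scaleC_mult_right scaleC_scaleC scaleC_minus_left
        scaleC_diff_right scaleC_add_right)
  also have "\<dots> = r\<^sup>2 *\<^sub>R 1"
    using assms by (simp add: scaleC_mult_left scaleC_mult_right)
  finally have "(norm ?u)\<^sup>2 = norm (r\<^sup>2 *\<^sub>R (1::'a))"
    by (metis cstar_identity)
  also have "\<dots> \<le> r\<^sup>2" by (rule norm_scaleR_one_le) simp
  finally show u: "norm ?u \<le> r" using assms(5) by (rule power2_le_imp_le)
  have "x = (1/2) *\<^sub>R (?u + star ?u)"
    using assms by (simp add: star_simps scaleC_minus_left flip: scaleR_2)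
  then have "norm x = norm (?u + star ?u) / 2" 
    by (metis norm_scaleR abs_of_pos half_gt_zero_iff zero_less_one mult.commute
        times_divide_eq_right mult_1_right)
  also have "\<dots> \<le> r" using norm_triangle_le[of ?u "star ?u" "r + r"] u by simp
  finally show "norm x \<le> r" .
qed

text \<open>A double angle formula: \<open>g\<close> is a multiple of \<open>h\<close> of norm at
  most 1, in the role of the cosine, \<open>k\<close> is the sine, and
  \<open>g + \<i> *\<^sub>C k\<close> is a contraction. The real part of its square is
  \<open>2 *\<^sub>R (g * g) - 1\<close>, so this has norm at most 1, which says that
  \<open>g * g\<close> lies within 1/2 of half the unit.\<close>

lemma cpos_square:
  fixes h :: "'a::cstar_algebra"
  assumes sa: "star h = h" shows "cpos (h * h)"
proof -
  \<comment> \<open>Adding 1 makes the scaling legitimate for \<open>h = 0\<close> too.\<close>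
  define s where "s = norm h + 1"
  define g where "g = (1/s) *\<^sub>R h"
  have s: "s > 0" by (simp add: s_def add_nonneg_pos)
  have ng: "norm g \<le> 1" using s by (simp add: g_def s_def)
  have sg: "star g = g" using sa by (simp add: g_def star_simps)
  have "norm (g * g) \<le> 1" using ng by (simp add: norm_selfadjoint_square[OF sg] power_le_one)
  moreover have "star (g * g) = g * g" using sg by (simp add: star_mult)
  ultimately obtain w where w: "star w = w" "(1 - w) * (1 - w) = 1 - g * g"
    "\<And>b. b * (g * g) = (g * g) * b \<Longrightarrow> b * w = w * b"
    using sqrt_one_minus by blast
  define k where "k = 1 - w"
  have k: "star k = k" "k * k = 1 - g * g" using w(1,2) by (auto simp: k_def star_simps)
  have gk: "g * k = k * g" using w(3)[of g] by (simp add: k_def algebra_simps)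
  let ?u = "g + \<i> *\<^sub>C k"
  have nu: "norm ?u \<le> 1"
    by (rule norm_selfadjoint_le) (use sg k gk in auto)
  have nsu: "norm (star ?u) \<le> 1" using nu by simp
  have e: "?u * ?u + star ?u * star ?u = 2 *\<^sub>R (g * g - k * k)"
    using sg k(1) by (simp add: star_simps algebra_simps scaleC_mult_left scaleC_mult_right
        scaleC_scaleC scaleC_minus_left scaleC_diff_right scaleC_add_right scaleR_2 gk)
  have sq: "norm (v * v) \<le> 1" if "norm v \<le> 1" for v :: 'a
    using order_trans[OF norm_mult_ineq[of v v] mult_mono[OF that that]] by simp
  have "norm (?u * ?u + star ?u * star ?u) \<le> 1 + 1"
    by (rule norm_triangle_le[OF add_mono[OF sq[OF nu] sq[OF nsu]]])
  then have "norm (g * g - k * k) \<le> 1" unfolding e by simp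
  moreover have "g * g - k * k = (- 2) *\<^sub>R ((1/2) *\<^sub>R 1 - g * g)"
    unfolding k(2) by (simp add: algebra_simps scaleR_2)
  ultimately have "norm ((1/2) *\<^sub>R 1 - g * g) \<le> 1/2" by simp
  then have "cpos (g * g)" using sg by (intro cposI[of _ "1/2"]) (auto simp: star_mult)
  moreover have "h * h = (s * s) *\<^sub>R (g * g)" using s by (simp add: g_def)
  ultimately show ?thesis using s by (simp add: cpos_scaleR)
qed

text \<open>The roots \<open>c\<close> and \<open>d\<close> of \<open>r *\<^sub>R 1 - x\<close> and
  \<open>r *\<^sub>R 1 + x\<close> commute, so \<open>c * d\<close> squares to
  \<open>r\<^sup>2 *\<^sub>R 1 - x * x\<close> and can serve as the imaginary part in
  \<open>norm_selfadjoint_le\<close>.\<close>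

lemma norm_le_of_cpos:
  fixes x :: "'a::cstar_algebra"
  assumes sa: "star x = x" and p: "cpos (r *\<^sub>R 1 - x)" "cpos (r *\<^sub>R 1 + x)" and r: "r \<ge> 0"
  shows "norm x \<le> r"
proof -
  obtain c where c: "star c = c" "c * c = r *\<^sub>R 1 - x"
    "\<And>b. b * (r *\<^sub>R 1 - x) = (r *\<^sub>R 1 - x) * b \<Longrightarrow> b * c = c * b"
    using cpos_sqrt[OF p(1)] by metis
  obtain d where d: "star d = d" "d * d = r *\<^sub>R 1 + x"
    "\<And>b. b * (r *\<^sub>R 1 + x) = (r *\<^sub>R 1 + x) * b \<Longrightarrow> b * d = d * b"
    using cpos_sqrt[OF p(2)] by metis
  have xc: "x * c = c * x" by (rule c(3)) (simp add: algebra_simps)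
  have xd: "x * d = d * x" by (rule d(3)) (simp add: algebra_simps)
  have cd: "c * d = d * c" by (rule d(3)) (simp add: algebra_simps xc)
  have "(c * d) * (c * d) = (c * c) * (d * d)" by (metis cd mult.assoc)
  also have "\<dots> = (r *\<^sub>R 1 - x) * (r *\<^sub>R 1 + x)" by (simp add: c(2) d(2))
  also have "\<dots> = r\<^sup>2 *\<^sub>R 1 - x * x" by (simp add: algebra_simps power2_eq_square)
  finally have "x * x + (c * d) * (c * d) = r\<^sup>2 *\<^sub>R 1" by simp
  moreover have "x * (c * d) = (c * d) * x" by (metis xc xd mult.assoc)
  moreover have "star (c * d) = c * d" using c(1) d(1) cd by (simp add: star_mult)
  ultimately show ?thesis using norm_selfadjoint_le(2)[OF sa] r by blast
qed

text \<open>With \<open>r\<close> the norm of the sum, \<open>r *\<^sub>R 1 - x\<close> is the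
  positive element \<open>r *\<^sub>R 1 - (x + y)\<close> plus \<open>y\<close>.\<close>

lemma norm_mono_cpos:
  fixes x :: "'a::cstar_algebra"
  assumes "cpos x" "cpos y" shows "norm x \<le> norm (x + y)"
proof (rule norm_le_of_cpos)
  let ?r = "norm (x + y)"
  show sx: "star x = x" using assms by (simp add: cpos_def)
  have "star (x + y) = x + y" using assms by (simp add: cpos_def star_add)
  then have "cpos (?r *\<^sub>R 1 - (x + y))" by (rule cpos_norm_diff) simp
  from cpos_add[OF this assms(2)] show "cpos (?r *\<^sub>R 1 - x)" by simp
  show "cpos (?r *\<^sub>R 1 + x)" by (intro cpos_add cpos_scaleR_one assms) simp
qed simp

text \<open>Twice the element is the sum of the squares of the self-adjoint
  \<open>c + star c\<close> and \<open>\<i> *\<^sub>C (c - star c)\<close>.\<close>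

lemma cpos_star_mult_sum: "cpos (star c * c + c * star c)"
proof -
  let ?u = "c + star c" and ?v = "\<i> *\<^sub>C (c - star c)"
  have "?u * ?u + ?v * ?v = 2 *\<^sub>R (star c * c + c * star c)"
    by (simp add: algebra_simps scaleC_mult_left scaleC_mult_right scaleC_scaleC scaleC_minus_left
        scaleC_diff_right scaleR_2)
  then have e: "star c * c + c * star c = (1/2) *\<^sub>R (?u * ?u + ?v * ?v)" by simp
  have "cpos (?u * ?u)" by (rule cpos_square) (simp add: star_simps add.commute)
  moreover have "cpos (?v * ?v)"
    by (rule cpos_square) (simp add: star_simps scaleC_minus_left scaleC_diff_right)
  ultimately show ?thesis unfolding e by (intro cpos_scaleR cpos_add) auto
qed

text \<open>With \<open>q\<close> the negative part of \<open>x = a\<^sup>* a\<close> and \<open>c = a q\<close>, the element \<open>c\<^sup>* c = - q\<^sup>3 = - h\<^sup>2\<close> is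
  negative. For \<open>d = h c\<^sup>*\<close> both \<open>d\<^sup>* d\<close> and \<open>d d\<^sup>*\<close> are negative, while their sum is positive; this
  forces \<open>c = 0\<close>.\<close>

lemma cpos_star_mult:
  fixes a :: "'a::cstar_algebra"
  shows "cpos (star a * a)"
proof -
  define x where "x = star a * a"
  have sx: "star x = x" by (simp add: x_def star_simps)
  \<comment> \<open>The absolute value of \<open>x\<close>. Its root \<open>z\<close> is needed
    below to exhibit the cube of the negative part as a square.\<close>
  obtain y where y: "star y = y" "y * y = x * x" "cpos y"
    "\<And>b. b * (x * x) = (x * x) * b \<Longrightarrow> b * y = y * b"
    using cpos_sqrt[OF cpos_square[OF sx]] by metis
  obtain z where z: "star z = z" "z * z = y" "\<And>b. b * y = y * b \<Longrightarrow> b * z = z * b"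
    using cpos_sqrt[OF y(3)] by metis
  have xy: "x * y = y * x" by (rule y(4)) (simp add: mult.assoc)
  define q where "q = (1/2) *\<^sub>R (y - x)"
  have sq: "star q = q" using sx y(1) by (simp add: q_def star_simps)
  have qx: "q * x = x * q" and qy: "q * y = y * q" using xy by (simp_all add: q_def algebra_simps)
  have qz: "q * z = z * q" using z(3)[OF qy] .
  have qq: "q * q = q * y"
  proof -
    have "q * q - q * y = (1/4) *\<^sub>R ((y - x) * (y - x)) - (1/4) *\<^sub>R (2 *\<^sub>R ((y - x) * y))"
      by (simp add: q_def)
    then have "q * q - q * y = (1/4) *\<^sub>R ((y - x) * (y - x) - 2 *\<^sub>R ((y - x) * y))"
      by (simp only: scaleR_diff_right)
    also have "(y - x) * (y - x) - 2 *\<^sub>R ((y - x) * y) = 0"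
      using xy y(2) by (simp add: algebra_simps scaleR_2)
    finally show ?thesis by simp
  qed
  have xq: "x * q = - (q * q)"
  proof -
    have "x * q + q * y = (1/2) *\<^sub>R (x * (y - x) + (y - x) * y)"
      by (simp add: q_def scaleR_add_right)
    also have "x * (y - x) + (y - x) * y = 0" using y(2) by (simp add: algebra_simps)
    finally show ?thesis unfolding qq by (simp add: eq_neg_iff_add_eq_0)
  qed
  define c where "c = a * q"
  \<comment> \<open>A self-adjoint square root of the cube of \<open>q\<close>: since
    \<open>q * y = q * q\<close>, squaring \<open>q * z\<close> gives
    \<open>q * (q * q)\<close>.\<close>
  define h where "h = q * z"
  have sh: "star h = h" using sq z(1) qz by (simp add: h_def star_mult)
  have hh: "h * h = q * (q * q)"
  proof -
    have "h * h = q * (z * q) * z" by (simp add: h_def mult.assoc)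
    also have "\<dots> = q * (q * (z * z))" by (simp only: qz[symmetric] mult.assoc)
    finally show ?thesis by (simp add: z(2) qq)
  qed
  have cc: "star c * c = - (h * h)"
  proof -
    have "star c * c = q * (x * q)" by (simp add: c_def x_def star_mult sq mult.assoc)
    then show ?thesis by (simp add: xq hh)
  qed
  define R where "R = c * star c"
  have sR: "star R = R" by (simp add: R_def star_simps)
  define d where "d = h * star c"
  have 1: "star d * d = - (R * R)"
  proof -
    have "star d * d = c * (h * h) * star c" by (simp add: d_def star_simps sh mult.assoc)
    also have "h * h = - (star c * c)" by (simp add: cc)
    finally show ?thesis by (simp add: R_def mult.assoc)
  qed
  have 2: "d * star d = - ((h * h) * (h * h))"
  proof -
    have "d * star d = h * (star c * c) * h" by (simp add: d_def star_simps sh mult.assoc)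
    then show ?thesis by (simp add: cc mult.assoc)
  qed
  have p1: "cpos (R * R)" by (rule cpos_square[OF sR])
  have p2: "cpos ((h * h) * (h * h))" by (rule cpos_square) (simp add: star_mult sh)
  \<comment> \<open>A sum of positive elements that vanishes; norm monotonicity makes the summand
    \<open>R * R\<close> zero.\<close>
  have "R * R + ((h * h) * (h * h) + (star d * d + d * star d)) = 0" by (simp add: 1 2)
  then have "norm (R * R) \<le> 0"
    using norm_mono_cpos[OF p1 cpos_add[OF p2 cpos_star_mult_sum[of d]]] by simp
  then have "R = 0" by (simp add: norm_selfadjoint_square[OF sR])
  then have "c = 0" using norm_mult_star[of c] by (simp add: R_def)
  then have "q * (q * q) = 0" using cc hh by simp
  then have "(q * q) * (q * q) = 0" by (simp add: mult.assoc)
  moreover have "star (q * q) = q * q" by (simp add: star_mult sq)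
  ultimately have "q * q = 0" using norm_selfadjoint_square[of "q * q"] by simp
  then have "q = 0" using norm_selfadjoint_square[OF sq] by simp
  then have "x = y" by (simp add: q_def)
  then show ?thesis using y(3) x_def by simp
qed

lemma cstar_pos_imp_cpos: "cstar_pos a \<Longrightarrow> cpos a"
  by (auto simp: cstar_pos_def cpos_star_mult)

lemma cpos_conjugate:
  assumes "cpos p" shows "cpos (star a * p * a)"
proof -
  obtain z where z: "star z = z" "z * z = p" using cpos_sqrt[OF assms] by metis
  have "star a * p * a = star (z * a) * (z * a)" by (simp add: z(2)[symmetric] star_mult z(1) mult.assoc)
  then show ?thesis using cpos_star_mult[of "z * a"] by metis
qed

lemma cpos_norm_square_diff: "cpos ((norm a)\<^sup>2 *\<^sub>R 1 - star a * a)"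
  by (rule cpos_norm_diff) (auto simp: star_simps cstar_identity)

section \<open>Representations and matrix norms\<close>

lemma algebra_repD:
  assumes "algebra_rep \<rho>"
  shows rep_add: "\<rho> (a + b) h = \<rho> a h + \<rho> b h"
    and rep_scaleC: "\<rho> (c *\<^sub>C a) h = c *\<^sub>C \<rho> a h"
    and rep_mult: "\<rho> (a * b) h = \<rho> a (\<rho> b h)"
    and rep_one: "\<rho> 1 h = h"
    and rep_bounded_op: "bounded_op whole whole (\<rho> a)"
    and rep_add_right: "\<rho> a (h + g) = \<rho> a h + \<rho> a g"
    and rep_scaleC_right: "\<rho> a (c *\<^sub>C h) = c *\<^sub>C \<rho> a h"
  using assms by (auto simp: algebra_rep_def bounded_op_def)

lemma rep_adjoint:
  assumes "algebra_rep \<rho>"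
  shows "cinner (\<rho> a x) y = cinner x (\<rho> (star a) y)"
proof -
  have "\<rho> (star a) y = adj whole whole (\<rho> a) y" using assms by (simp add: algebra_rep_def)
  then show ?thesis using cinner_adj[OF rep_bounded_op[OF assms]] by simp
qed

lemma rep_zero [simp]: "algebra_rep \<rho> \<Longrightarrow> \<rho> 0 h = 0"
  using rep_scaleC[of \<rho> 0 0 h] by simp

lemma rep_zero_right [simp]: "algebra_rep \<rho> \<Longrightarrow> \<rho> a 0 = 0"
  using rep_scaleC_right[of \<rho> a 0 0] by simp

lemma rep_minus: "algebra_rep \<rho> \<Longrightarrow> \<rho> (- a) h = - \<rho> a h"
  using rep_scaleC[of \<rho> "- 1" a h] by (simp add: scaleC_minus_left)

lemma rep_diff: "algebra_rep \<rho> \<Longrightarrow> \<rho> (a - b) h = \<rho> a h - \<rho> b h"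
  using rep_add[of \<rho> a "- b" h] by (simp add: rep_minus)

lemma rep_sum: "algebra_rep \<rho> \<Longrightarrow> \<rho> (\<Sum>i\<in>I. f i) h = (\<Sum>i\<in>I. \<rho> (f i) h)"
  by (induction I rule: infinite_finite_induct) (auto simp: rep_add)

lemma rep_sum_right: "algebra_rep \<rho> \<Longrightarrow> \<rho> a (\<Sum>i\<in>I. f i) = (\<Sum>i\<in>I. \<rho> a (f i))"
  by (induction I rule: infinite_finite_induct) (auto simp: rep_add_right)

text \<open>Writing \<open>(norm a)\<^sup>2 *\<^sub>R 1 - star a * a\<close> as the square of a
  self-adjoint \<open>z\<close>, the difference of the squared norms in question is the squared norm
  of \<open>\<rho> z h\<close>, hence nonnegative.\<close>

lemma rep_norm_le:
  assumes \<rho>: "algebra_rep \<rho>" shows "norm (\<rho> a h) \<le> norm a * norm h"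
proof -
  obtain z where z: "star z = z" "z * z = (norm a)\<^sup>2 *\<^sub>R 1 - star a * a"
    using cpos_sqrt[OF cpos_norm_square_diff[of a]] by metis
  have "cinner (\<rho> z h) (\<rho> z h) = cinner h (\<rho> (z * z) h)"
    by (simp add: rep_adjoint[OF \<rho>] z(1) rep_mult[OF \<rho>])
  also have "\<dots> = cinner h (\<rho> ((norm a)\<^sup>2 *\<^sub>R 1) h) - cinner h (\<rho> (star a * a) h)"
    by (simp add: z rep_diff[OF \<rho>] cinner_diff_right)
  also have "cinner h (\<rho> ((norm a)\<^sup>2 *\<^sub>R 1) h) = complex_of_real ((norm a)\<^sup>2) * cinner h h"
    by (simp only: scaleR_eq_scaleC rep_scaleC[OF \<rho>] rep_one[OF \<rho>] cinner_scaleC_right)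
  also have "cinner h (\<rho> (star a * a) h) = cinner (\<rho> a h) (\<rho> a h)"
    by (simp add: rep_adjoint[OF \<rho>] rep_mult[OF \<rho>])
  finally have "complex_of_real ((norm (\<rho> z h))\<^sup>2)
      = complex_of_real ((norm a)\<^sup>2 * (norm h)\<^sup>2 - (norm (\<rho> a h))\<^sup>2)"
    by (simp only: cinner_self of_real_mult of_real_diff)
  then have "(norm (\<rho> z h))\<^sup>2 = (norm a)\<^sup>2 * (norm h)\<^sup>2 - (norm (\<rho> a h))\<^sup>2"
    by (simp only: of_real_eq_iff)
  then have "(norm (\<rho> a h))\<^sup>2 \<le> (norm a * norm h)\<^sup>2"
    by (metis diff_ge_0_iff_ge power_mult_distrib zero_le_power2)
  then show ?thesis by (rule power2_le_imp_le) simp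
qed

lemma tendsto_rep:
  assumes \<rho>: "algebra_rep \<rho>" and f: "(f \<longlongrightarrow> a) F"
  shows "((\<lambda>n. \<rho> (f n) h) \<longlongrightarrow> \<rho> a h) F"
proof -
  have "bounded_linear (\<lambda>a. \<rho> a h)"
    by (rule bounded_linear_intro[of _ "norm h"])
      (simp_all add: rep_add[OF \<rho>] rep_scaleC[OF \<rho>] scaleR_eq_scaleC rep_norm_le[OF \<rho>])
  then show ?thesis using f by (rule bounded_linear.tendsto)
qed

section \<open>Columns and matrices over a C*-algebra\<close>

lemma col_norm_nonneg [simp]: "0 \<le> col_norm N b"
  by (simp add: col_norm_def)

text \<open>The other summands \<open>star (b j) * b j\<close> are positive, and dropping them
  cannot increase the norm.\<close>

lemma norm_le_col_norm:
  assumes "i < N" shows "norm (b i) \<le> col_norm N b"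
proof -
  have "(\<Sum>j<N. star (b j) * b j) = star (b i) * b i + (\<Sum>j\<in>{..<N} - {i}. star (b j) * b j)"
    using assms by (simp add: sum.remove)
  moreover have "cpos (\<Sum>j\<in>{..<N} - {i}. star (b j) * b j)"
    by (intro cpos_sum cpos_star_mult)
  ultimately have "norm (star (b i) * b i) \<le> norm (\<Sum>j<N. star (b j) * b j)"
    using norm_mono_cpos[OF cpos_star_mult] by metis
  then show ?thesis
    by (simp add: col_norm_def cstar_identity real_le_rsqrt)
qed

lemma col_norm_le_sum: "col_norm N b \<le> (\<Sum>i<N. norm (b i))"
proof -
  have "norm (\<Sum>i<N. star (b i) * b i) \<le> (\<Sum>i<N. (norm (b i))\<^sup>2)"
    by (rule order_trans[OF norm_sum]) (simp add: cstar_identity)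
  then have "col_norm N b \<le> L2_set (\<lambda>i. norm (b i)) {..<N}"
    by (simp add: col_norm_def L2_set_def)
  also have "\<dots> \<le> (\<Sum>i<N. norm (b i))" by (rule L2_set_le_sum) simp
  finally show ?thesis .
qed

lemma col_norm_scaleR: "col_norm N (\<lambda>i. r *\<^sub>R b i) = \<bar>r\<bar> * col_norm N b"
proof -
  have "(\<Sum>i<N. star (r *\<^sub>R b i) * (r *\<^sub>R b i)) = r\<^sup>2 *\<^sub>R (\<Sum>i<N. star (b i) * b i)"
    by (simp add: star_scaleR scaleR_sum_right power2_eq_square)
  then show ?thesis by (simp add: col_norm_def real_sqrt_mult)
qed

text \<open>A crude bound by the sum of all entries; it serves only to make the supremum in
  \<open>mat_norm\<close> a genuine upper bound.\<close>

lemma bdd_above_mat_norm: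
  "bdd_above {col_norm N (\<lambda>i. \<Sum>j<N. a i j * b j) |b. col_norm N b \<le> 1}"
proof (rule bdd_aboveI)
  fix x assume "x \<in> {col_norm N (\<lambda>i. \<Sum>j<N. a i j * b j) |b. col_norm N b \<le> 1}"
  then obtain b where x: "x = col_norm N (\<lambda>i. \<Sum>j<N. a i j * b j)" and b: "col_norm N b \<le> 1"
    by blast
  have "norm (\<Sum>j<N. a i j * b j) \<le> (\<Sum>j<N. norm (a i j))" for i
  proof (rule order_trans[OF norm_sum sum_mono])
    fix j assume "j \<in> {..<N}"
    then have "norm (b j) \<le> 1" using norm_le_col_norm[of j N b] b by simp
    then show "norm (a i j * b j) \<le> norm (a i j)"
      using norm_mult_ineq[of "a i j" "b j"] mult_left_le[of "norm (b j)" "norm (a i j)"] by simp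
  qed
  then show "x \<le> (\<Sum>i<N. \<Sum>j<N. norm (a i j))"
    unfolding x by (intro order_trans[OF col_norm_le_sum] sum_mono)
qed

lemma col_norm_mat_le: "col_norm N (\<lambda>i. \<Sum>j<N. a i j * b j) \<le> mat_norm N a * col_norm N b"
proof (cases "col_norm N b = 0")
  case True
  have "b j = 0" if "j < N" for j
    using norm_le_col_norm[OF that, of b] True by simp
  then show ?thesis by (simp add: col_norm_def)
next
  case False
  define r where "r = inverse (col_norm N b)"
  have r: "r > 0" using False by (simp add: r_def order_less_le)
  have "col_norm N (\<lambda>i. r *\<^sub>R b i) \<le> 1"
    using False r by (simp add: col_norm_scaleR) (simp add: r_def)
  then have "col_norm N (\<lambda>i. \<Sum>j<N. a i j * (r *\<^sub>R b j)) \<le> mat_norm N a"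
    unfolding mat_norm_def
    by (intro cSup_upper bdd_above_mat_norm CollectI exI[of _ "\<lambda>i. r *\<^sub>R b i"] conjI refl)
  then have "r * col_norm N (\<lambda>i. \<Sum>j<N. a i j * b j) \<le> mat_norm N a"
    using r by (simp add: col_norm_scaleR flip: scaleR_sum_right)
  then show ?thesis using False
    by (simp add: r_def order_less_le field_simps)
qed

lemma mat_norm_nonneg: "0 \<le> mat_norm N a"
proof -
  have "col_norm N (\<lambda>i. \<Sum>j<N. a i j * 0) \<le> mat_norm N a"
    unfolding mat_norm_def
    by (intro cSup_upper bdd_above_mat_norm CollectI exI[of _ "\<lambda>_. 0"]) (simp add: col_norm_def)
  then show ?thesis by (simp add: col_norm_def)
qed

text \<open>Log-convexity makes the ratios of successive terms nondecreasing, so \<open>a k\<close>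
  dominates the geometric sequence with ratio \<open>a 1 / a 0\<close>. A ratio above
  \<open>m\<close> would outgrow \<open>C * m ^ k\<close>, whatever the constant
  \<open>C\<close>.\<close>

lemma log_convex_growth:
  fixes a :: "nat \<Rightarrow> real"
  assumes nonneg: "\<And>k. 0 \<le> a k" and conv: "\<And>k. (a (Suc k))\<^sup>2 \<le> a k * a (Suc (Suc k))"
    and bd: "\<And>k. a k \<le> C * m ^ k" and m: "0 \<le> m"
  shows "a 1 \<le> m * a 0"
proof (rule ccontr)
  assume not: "\<not> a 1 \<le> m * a 0"
  have a0: "a 0 > 0"
  proof (rule ccontr)
    assume "\<not> a 0 > 0"
    then have "a 0 = 0" using nonneg[of 0] by simp
    then have "a 1 = 0" using conv[of 0] by simp
    then show False using not \<open>a 0 = 0\<close> by simp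
  qed
  define q where "q = a 1 / a 0"
  have qm: "q > m" using not a0 by (simp add: q_def pos_less_divide_eq)
  then have q: "q > 0" using m by simp
  have step: "a k > 0 \<and> a (Suc k) \<ge> q * a k" for k
  proof (induction k)
    case (Suc k)
    have pos: "a (Suc k) > 0" using Suc q by (meson mult_pos_pos order_less_le_trans)
    have "(q * a k) * a (Suc k) \<le> a (Suc k) * a (Suc k)"
      using Suc pos by (intro mult_right_mono) auto
    also have "\<dots> \<le> a k * a (Suc (Suc k))" using conv[of k] by (simp add: power2_eq_square)
    finally have "a k * (q * a (Suc k)) \<le> a k * a (Suc (Suc k))" by (simp add: mult_ac)
    then show ?case using Suc pos by simp
  qed (use a0 in \<open>simp add: q_def\<close>)
  have geo: "q ^ k * a 0 \<le> a k" for k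
  proof (induction k)
    case (Suc k)
    have "q * (q ^ k * a 0) \<le> q * a k" using Suc q by (intro mult_left_mono) auto
    then show ?case using step[of k] by (simp add: mult_ac)
  qed simp
  show False
  \<comment> \<open>The comparison uses powers of \<open>q / m\<close>; for \<open>m = 0\<close> the
    bound already fails at exponent 1.\<close>
  proof (cases "m = 0")
    case True
    then show False using bd[of 1] step[of 0] mult_pos_pos[OF q a0] by simp
  next
    case False
    with m have mp: "m > 0" by simp
    obtain k where k: "C / a 0 < (q / m) ^ k"
      using real_arch_pow[of "q / m"] qm mp by (auto simp: pos_less_divide_eq)
    have "q ^ k * a 0 \<le> C * m ^ k" using geo[of k] bd[of k] by simp
    then have "(q / m) ^ k \<le> C / a 0"
      using mp a0 by (simp add: power_divide pos_divide_le_eq pos_le_divide_eq mult_ac)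
    then show False using k by simp
  qed
qed

lemma cmod_sum_cinner_le:
  "cmod (\<Sum>i<N. cinner (h i) (g i)) \<le>
    L2_set (\<lambda>i. norm (h i)) {..<N} * L2_set (\<lambda>i. norm (g i)) {..<(N::nat)}"
proof -
  have "cmod (\<Sum>i<N. cinner (h i) (g i)) \<le> (\<Sum>i<N. \<bar>norm (h i)\<bar> * \<bar>norm (g i)\<bar>)"
    by (rule order_trans[OF norm_sum sum_mono]) (simp add: cinner_Cauchy_Schwarz)
  also have "\<dots> \<le> L2_set (\<lambda>i. norm (h i)) {..<N} * L2_set (\<lambda>i. norm (g i)) {..<N}"
    by (rule L2_set_mult_ineq)
  finally show ?thesis .
qed

text \<open>The norms of \<open>T\<^sup>k h\<close> are log-convex and grow
  at most like \<open>(mat_norm M)\<^sup>k\<close>, the columns of \<open>M\<^sup>k\<close> being bounded by powers of the norm of \<open>M\<close>.\<close>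

lemma matrix_rep_contractive:
  fixes \<rho> :: "'a::cstar_algebra \<Rightarrow> 'h::chilbert_space \<Rightarrow> 'h"
  assumes \<rho>: "algebra_rep \<rho>"
    and sa: "\<And>i j. i < N \<Longrightarrow> j < N \<Longrightarrow> star (M i j) = M j i"
  shows "cmod (\<Sum>i<N. \<Sum>j<N. cinner (h i) (\<rho> (M i j) (h j))) \<le> mat_norm N M * (\<Sum>i<N. (norm (h i))\<^sup>2)"
proof -
  define T where "T g = (\<lambda>i. \<Sum>j<N. \<rho> (M i j) (g j))" for g :: "nat \<Rightarrow> 'h"
  define nrm where "nrm g = L2_set (\<lambda>i. norm (g i)) {..<N}" for g :: "nat \<Rightarrow> 'h"
  \<comment> \<open>\<open>B k\<close> applies \<open>M\<close> to a column \<open>k\<close> times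
    and \<open>e j\<close> is the \<open>j\<close>-th standard column, so \<open>B k (e j)\<close>
    is the \<open>j\<close>-th column of the \<open>k\<close>-th power of \<open>M\<close>.\<close>
  define B where "B j = (\<lambda>b i. \<Sum>l<N. M i l * b l) ^^ j" for j
  define e where "e j = (\<lambda>i. if i = j then 1 else 0 :: 'a)" for j :: nat
  have selfadj: "(\<Sum>i<N. cinner (T f i) (g i)) = (\<Sum>i<N. cinner (f i) (T g i))" for f g
  proof -
    have "(\<Sum>i<N. cinner (T f i) (g i)) = (\<Sum>i<N. \<Sum>j<N. cinner (f j) (\<rho> (M j i) (g i)))"
      by (simp add: T_def cinner_sum_left rep_adjoint[OF \<rho>] sa)
    also have "\<dots> = (\<Sum>i<N. cinner (f i) (T g i))"
      by (subst sum.swap) (simp add: T_def cinner_sum_right)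
    finally show ?thesis .
  qed
  have nrm_sq: "complex_of_real ((nrm g)\<^sup>2) = (\<Sum>i<N. cinner (g i) (g i))" for g
    by (simp add: nrm_def L2_set_def sum_nonneg cinner_self)
  define a where "a k = nrm ((T ^^ k) h)" for k
  \<comment> \<open>Moving one \<open>T\<close> across the inner product replaces the two factors of
    exponent k + 1 by factors of exponents k and k + 2; then Cauchy-Schwarz.\<close>
  have conv: "(a (Suc k))\<^sup>2 \<le> a k * a (Suc (Suc k))" for k
  proof -
    have "complex_of_real ((a (Suc k))\<^sup>2) = (\<Sum>i<N. cinner ((T ^^ k) h i) ((T ^^ Suc (Suc k)) h i))"
      unfolding a_def nrm_sq by (simp add: selfadj)
    then have "cmod (complex_of_real ((a (Suc k))\<^sup>2)) \<le> a k * a (Suc (Suc k))"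
      unfolding a_def nrm_def by (metis cmod_sum_cinner_le)
    then show ?thesis by (simp add: norm_power)
  qed
  have pow: "(T ^^ k) h i = (\<Sum>j<N. \<rho> (B k (e j) i) (h j))" if "i < N" for i k
    using that
  proof (induction k arbitrary: i)
    case 0
    have "(\<Sum>j<N. \<rho> (e j i) (h j)) = (\<Sum>j<N. if i = j then h j else 0)"
      by (intro sum.cong) (auto simp: e_def rep_one[OF \<rho>] \<rho>)
    then show ?case using 0 by (simp add: B_def)
  next
    case (Suc k)
    have "(T ^^ Suc k) h i = (\<Sum>l<N. \<rho> (M i l) (\<Sum>j<N. \<rho> (B k (e j) l) (h j)))"
      by (simp add: T_def Suc.IH)
    also have "\<dots> = (\<Sum>j<N. \<Sum>l<N. \<rho> (M i l * B k (e j) l) (h j))"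
      by (subst sum.swap) (simp add: rep_sum_right[OF \<rho>] rep_mult[OF \<rho>])
    also have "\<dots> = (\<Sum>j<N. \<rho> (B (Suc k) (e j) i) (h j))"
      by (simp add: B_def rep_sum[OF \<rho>])
    finally show ?case .
  qed
  have Bk: "col_norm N (B k b) \<le> mat_norm N M ^ k * col_norm N b" for k b
  proof (induction k)
    case (Suc k)
    have "col_norm N (B (Suc k) b) \<le> mat_norm N M * col_norm N (B k b)"
      using col_norm_mat_le[of N M "B k b"] by (simp add: B_def)
    also have "\<dots> \<le> mat_norm N M * (mat_norm N M ^ k * col_norm N b)"
      using Suc mat_norm_nonneg by (rule mult_left_mono)
    finally show ?case by (simp add: mult_ac)
  qed (simp add: B_def)
  \<comment> \<open>The entrywise estimate loses a constant depending on \<open>N\<close> and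
    \<open>h\<close>. Being independent of \<open>k\<close>, it disappears when powers are
    compared.\<close>
  define C where "C = (\<Sum>i<N. \<Sum>j<N. col_norm N (e j) * norm (h j))"
  have bd: "a k \<le> C * mat_norm N M ^ k" for k
  proof -
    have "a k \<le> (\<Sum>i<N. norm ((T ^^ k) h i))"
      unfolding a_def nrm_def by (rule L2_set_le_sum) simp
    also have "\<dots> \<le> (\<Sum>i<N. \<Sum>j<N. mat_norm N M ^ k * (col_norm N (e j) * norm (h j)))"
    proof (rule sum_mono)
      fix i assume i: "i \<in> {..<N}"
      have "norm ((T ^^ k) h i) \<le> (\<Sum>j<N. norm (\<rho> (B k (e j) i) (h j)))"
        using i by (simp add: pow norm_sum)
      also have "\<dots> \<le> (\<Sum>j<N. mat_norm N M ^ k * (col_norm N (e j) * norm (h j)))"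
      proof (rule sum_mono)
        fix j
        have "norm (B k (e j) i) \<le> mat_norm N M ^ k * col_norm N (e j)"
          using i norm_le_col_norm[of i N "B k (e j)"] Bk[of k "e j"] by simp
        then have "norm (B k (e j) i) * norm (h j) \<le> mat_norm N M ^ k * col_norm N (e j) * norm (h j)"
          by (rule mult_right_mono) simp
        then show "norm (\<rho> (B k (e j) i) (h j)) \<le> mat_norm N M ^ k * (col_norm N (e j) * norm (h j))"
          using rep_norm_le[OF \<rho>, of "B k (e j) i" "h j"] by (simp add: mult_ac)
      qed
      finally show "norm ((T ^^ k) h i) \<le> (\<Sum>j<N. mat_norm N M ^ k * (col_norm N (e j) * norm (h j)))" .
    qed
    also have "\<dots> = C * mat_norm N M ^ k"
      by (simp add: C_def sum_distrib_left sum_distrib_right mult_ac)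
    finally show ?thesis .
  qed
  have "a 1 \<le> mat_norm N M * a 0"
    by (rule log_convex_growth[of a C]) (use conv bd mat_norm_nonneg in \<open>auto simp: a_def nrm_def\<close>)
  then have Th: "nrm (T h) \<le> mat_norm N M * nrm h" by (simp add: a_def)
  have "cmod (\<Sum>i<N. \<Sum>j<N. cinner (h i) (\<rho> (M i j) (h j))) = cmod (\<Sum>i<N. cinner (h i) (T h i))"
    by (simp add: T_def cinner_sum_right)
  also have "\<dots> \<le> nrm h * nrm (T h)" unfolding nrm_def by (rule cmod_sum_cinner_le)
  also have "\<dots> \<le> nrm h * (mat_norm N M * nrm h)"
    using Th by (rule mult_left_mono) (simp add: nrm_def)
  also have "\<dots> = mat_norm N M * (\<Sum>i<N. (norm (h i))\<^sup>2)"
    by (simp add: nrm_def L2_set_def sum_nonneg flip: power2_eq_square)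
  finally show ?thesis .
qed

section \<open>Hilbert modules\<close>

definition mnorm :: "('a::cstar_algebra, 'e) corr \<Rightarrow> 'e \<Rightarrow> real" where
  "mnorm F x = sqrt (norm (mip F x x))"

definition msub :: "('a::cstar_algebra, 'e) corr \<Rightarrow> 'e \<Rightarrow> 'e \<Rightarrow> 'e" where
  "msub F x y = madd F x (mscale F (- 1) y)"

lemma mdist_eq: "mdist F x y = mnorm F (msub F x y)"
  by (simp add: mdist_def mnorm_def msub_def Let_def)

lemma mnorm_nonneg [simp]: "0 \<le> mnorm F x"
  by (simp add: mnorm_def)

lemma mnorm_sq: "(mnorm F x)\<^sup>2 = norm (mip F x x)"
  by (simp add: mnorm_def)

locale hilbert_mod =
  fixes F :: "('a::cstar_algebra, 'e) corr"
  assumes hm: "hilbert_module F"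
begin

lemma zero_in [simp]: "mzero F \<in> mcar F"
  and add_in [simp]: "x \<in> mcar F \<Longrightarrow> y \<in> mcar F \<Longrightarrow> madd F x y \<in> mcar F"
  and scale_in [simp]: "x \<in> mcar F \<Longrightarrow> mscale F c x \<in> mcar F"
  and ract_in [simp]: "x \<in> mcar F \<Longrightarrow> ract F x a \<in> mcar F"
  and ract_one [simp]: "x \<in> mcar F \<Longrightarrow> ract F x 1 = x"
  and madd_zero: "x \<in> mcar F \<Longrightarrow> madd F (mzero F) x = x"
  using hm unfolding hilbert_module_def by - (elim conjE, (assumption | metis))+

lemma mip_add_right [simp]:
    "x \<in> mcar F \<Longrightarrow> y \<in> mcar F \<Longrightarrow> z \<in> mcar F \<Longrightarrow> mip F x (madd F y z) = mip F x y + mip F x z"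
  and mip_scale_right [simp]:
    "x \<in> mcar F \<Longrightarrow> y \<in> mcar F \<Longrightarrow> mip F x (mscale F c y) = c *\<^sub>C mip F x y"
  and mip_ract_right [simp]:
    "x \<in> mcar F \<Longrightarrow> y \<in> mcar F \<Longrightarrow> mip F x (ract F y a) = mip F x y * a"
  and star_mip: "x \<in> mcar F \<Longrightarrow> y \<in> mcar F \<Longrightarrow> star (mip F x y) = mip F y x"
  and mip_self: "\<forall>x\<in>mcar F. cstar_pos (mip F x x) \<and> (mip F x x = 0 \<longrightarrow> x = mzero F)"
  using hm unfolding hilbert_module_def by - (elim conjE, (assumption | metis))+

lemma mip_self_eq_0D: "x \<in> mcar F \<Longrightarrow> mip F x x = 0 \<Longrightarrow> x = mzero F"
  using mip_self by blast

lemma cpos_mip: "x \<in> mcar F \<Longrightarrow> cpos (mip F x x)"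
  using mip_self by (blast intro: cstar_pos_imp_cpos)

lemma mip_add_left [simp]:
  "x \<in> mcar F \<Longrightarrow> y \<in> mcar F \<Longrightarrow> z \<in> mcar F \<Longrightarrow> mip F (madd F x y) z = mip F x z + mip F y z"
  using star_mip[of z "madd F x y"] star_mip[of z x] star_mip[of z y] by (simp add: star_add)

lemma mip_scale_left [simp]:
  "x \<in> mcar F \<Longrightarrow> y \<in> mcar F \<Longrightarrow> mip F (mscale F c x) y = cnj c *\<^sub>C mip F x y"
  using star_mip[of y "mscale F c x"] star_mip[of y x] by (simp add: star_scaleC)

lemma mip_ract_left [simp]:
  "x \<in> mcar F \<Longrightarrow> y \<in> mcar F \<Longrightarrow> mip F (ract F x a) y = star a * mip F x y"
  using star_mip[of y "ract F x a"] star_mip[of y x] by (simp add: star_mult)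

lemma mzero_eq: "x \<in> mcar F \<Longrightarrow> mzero F = madd F x (mscale F (- 1) x)"
  by (insert hm, unfold hilbert_module_def, elim conjE) metis

lemma mip_zero_right [simp]: "x \<in> mcar F \<Longrightarrow> mip F x (mzero F) = 0"
  by (simp add: mzero_eq[of x] scaleC_minus_left)

lemma mip_zero_left [simp]: "x \<in> mcar F \<Longrightarrow> mip F (mzero F) x = 0"
  using star_mip[of x "mzero F"] by simp

lemma mnorm_zero [simp]: "mnorm F (mzero F) = 0"
  by (simp add: mnorm_def)

lemma msub_in [simp]: "x \<in> mcar F \<Longrightarrow> y \<in> mcar F \<Longrightarrow> msub F x y \<in> mcar F"
  by (simp add: msub_def)

lemma msub_self: "x \<in> mcar F \<Longrightarrow> msub F x x = mzero F"
  by (simp add: msub_def mzero_eq[of x])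

lemma mip_msub_right: "x \<in> mcar F \<Longrightarrow> y \<in> mcar F \<Longrightarrow> z \<in> mcar F \<Longrightarrow>
    mip F x (msub F y z) = mip F x y - mip F x z"
  by (simp add: msub_def scaleC_minus_left)

lemma mip_msub_left: "x \<in> mcar F \<Longrightarrow> y \<in> mcar F \<Longrightarrow> z \<in> mcar F \<Longrightarrow>
    mip F (msub F x y) z = mip F x z - mip F y z"
  by (simp add: msub_def scaleC_minus_left)

text \<open>For \<open>a = mip F x y\<close> and \<open>r = norm (mip F x x)\<close>, positivity of
  the inner square of \<open>x a - r y\<close> together with \<open>star a * mip F x x * a\<close>
  being at most \<open>r *\<^sub>R (star a * a)\<close> gives
  \<open>r *\<^sub>R (star a * a)\<close> below \<open>(r * r) *\<^sub>R mip F y y\<close>; norms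
  respect this order.\<close>

lemma mip_Cauchy_Schwarz:
  assumes x: "x \<in> mcar F" and y: "y \<in> mcar F"
  shows "norm (mip F x y) \<le> mnorm F x * mnorm F y"
proof (cases "mip F x x = 0")
  case True
  then have "x = mzero F" using x by (simp add: mip_self_eq_0D)
  then show ?thesis using y by simp
next
  case False
  define r where "r = norm (mip F x x)"
  have r: "r > 0" using False by (simp add: r_def)
  define a where "a = mip F x y"
  have yx: "mip F y x = star a" using x y by (simp add: a_def star_mip)
  define w where "w = madd F (ract F x a) (mscale F (- complex_of_real r) y)"
  have w: "w \<in> mcar F" using x y by (simp add: w_def)
  have ww: "mip F w w = star a * mip F x x * a - (r *\<^sub>R (star a * a) + r *\<^sub>R (star a * a)) + (r * r) *\<^sub>R mip F y y"
    using x y by (simp add: w_def yx a_def[symmetric] scaleC_minus_left scaleC_minus_right scaleR_2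
        mult.assoc scaleC_scaleC scaleR_eq_scaleC scaleC_diff_right scaleC_add_right
        scaleC_mult_right scaleC_mult_left algebra_simps)
  have p1: "cpos (star a * (r *\<^sub>R 1 - mip F x x) * a)"
    by (intro cpos_conjugate cpos_norm_diff) (use x in \<open>auto simp: star_mip r_def\<close>)
  have "star a * (r *\<^sub>R 1 - mip F x x) * a = r *\<^sub>R (star a * a) - star a * mip F x x * a"
    by (simp add: algebra_simps)
  with cpos_add[OF cpos_mip[OF w] p1]
  have "cpos ((r * r) *\<^sub>R mip F y y - r *\<^sub>R (star a * a))"
    by (simp add: ww scaleR_2 algebra_simps)
  moreover have "cpos (r *\<^sub>R (star a * a))" using r by (intro cpos_scaleR cpos_star_mult) simp
  ultimately have "norm (r *\<^sub>R (star a * a)) \<le> norm ((r * r) *\<^sub>R mip F y y)"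
    using norm_mono_cpos by fastforce
  then have "(norm a)\<^sup>2 \<le> (mnorm F x * mnorm F y)\<^sup>2"
    using r by (simp add: cstar_identity power_mult_distrib mnorm_sq r_def[symmetric] abs_mult)
  then show ?thesis unfolding a_def by (rule power2_le_imp_le) simp
qed

lemma mnorm_add_le:
  assumes x: "x \<in> mcar F" and y: "y \<in> mcar F"
  shows "mnorm F (madd F x y) \<le> mnorm F x + mnorm F y"
proof -
  have "(mnorm F (madd F x y))\<^sup>2 = norm ((mip F x x + mip F x y) + (mip F y x + mip F y y))"
    using x y by (simp add: mnorm_sq algebra_simps)
  also have "\<dots> \<le> (mnorm F x * mnorm F x + mnorm F x * mnorm F y) + (mnorm F y * mnorm F x + mnorm F y * mnorm F y)"
    using x y by (intro norm_triangle_le add_mono mip_Cauchy_Schwarz)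
  also have "\<dots> = (mnorm F x + mnorm F y)\<^sup>2" by (simp add: power2_eq_square algebra_simps)
  finally show ?thesis by (rule power2_le_imp_le) simp
qed

lemma mdist_commute: "x \<in> mcar F \<Longrightarrow> y \<in> mcar F \<Longrightarrow> mdist F x y = mdist F y x"
  unfolding mdist_eq mnorm_def by (simp add: mip_msub_left mip_msub_right algebra_simps)

lemma mdist_triangle:
  assumes x: "x \<in> mcar F" and y: "y \<in> mcar F" and z: "z \<in> mcar F"
  shows "mdist F x z \<le> mdist F x y + mdist F y z"
proof -
  have "mdist F x z = mnorm F (madd F (msub F x y) (msub F y z))"
    unfolding mdist_eq mnorm_def using x y z
    by (simp add: mip_msub_left mip_msub_right algebra_simps)
  also have "\<dots> \<le> mdist F x y + mdist F y z"
    unfolding mdist_eq using x y z by (intro mnorm_add_le) auto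
  finally show ?thesis .
qed

lemma tendsto_mip:
  assumes x: "\<And>n. s n \<in> mcar F" "x \<in> mcar F" "(\<lambda>n. mdist F x (s n)) \<longlonglongrightarrow> 0"
    and y: "\<And>n. t n \<in> mcar F" "y \<in> mcar F" "(\<lambda>n. mdist F y (t n)) \<longlonglongrightarrow> 0"
  shows "(\<lambda>n. mip F (s n) (t n)) \<longlonglongrightarrow> mip F x y"
proof -
  have bd: "norm (mip F (s n) (t n) - mip F x y) \<le>
    mdist F x (s n) * (mdist F y (t n) + mnorm F y) + mnorm F x * mdist F y (t n)" for n
  proof -
    have tn: "mnorm F (t n) \<le> mdist F y (t n) + mnorm F y"
      using mdist_triangle[of "t n" y "mzero F"] x y mdist_commute[of "t n" y]
      by (simp add: mdist_eq mnorm_def mip_msub_left mip_msub_right)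
    have "mip F (s n) (t n) - mip F x y = - mip F (msub F x (s n)) (t n) + - mip F x (msub F y (t n))"
      using x y by (simp add: mip_msub_left mip_msub_right)
    also have "norm \<dots> \<le> mnorm F (msub F x (s n)) * mnorm F (t n) + mnorm F x * mnorm F (msub F y (t n))"
      unfolding norm_minus_cancel
      by (rule norm_triangle_le, rule add_mono) (use x y in \<open>simp_all add: mip_Cauchy_Schwarz\<close>)
    also have "\<dots> \<le> mdist F x (s n) * (mdist F y (t n) + mnorm F y) + mnorm F x * mdist F y (t n)"
      unfolding mdist_eq[symmetric] using tn by (intro add_mono mult_left_mono) (auto simp: mdist_eq)
    finally show ?thesis .
  qed
  have "(\<lambda>n. mdist F x (s n) * (mdist F y (t n) + mnorm F y) + mnorm F x * mdist F y (t n))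
      \<longlonglongrightarrow> 0 * (0 + mnorm F y) + mnorm F x * 0"
    by (intro tendsto_intros x y)
  then have "(\<lambda>n. mip F (s n) (t n) - mip F x y) \<longlonglongrightarrow> 0"
    by (intro Lim_null_comparison[OF always_eventually[OF allI[OF bd]]]) simp
  then show ?thesis by (simp add: LIM_zero_iff)
qed

end

text \<open>The typical instance is \<open>\<lambda>x. T x h\<close> with \<open>h\<close> fixed.
  Two such maps that agree on a total set are equal, which is how identities between representations
  are carried over from products of letters to whole fibres.\<close>

definition modlin :: "('a::cstar_algebra, 'e) corr \<Rightarrow> ('e \<Rightarrow> 'h::chilbert_space) \<Rightarrow> bool" where
  "modlin F f \<longleftrightarrow> (\<forall>x\<in>mcar F. \<forall>y\<in>mcar F. f (madd F x y) = f x + f y) \<and>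
     (\<forall>c. \<forall>x\<in>mcar F. f (mscale F c x) = c *\<^sub>C f x) \<and>
     (\<exists>K. \<forall>x\<in>mcar F. norm (f x) \<le> K * mnorm F x)"

lemma modlin_diff:
  assumes "modlin F f" "modlin F g" shows "modlin F (\<lambda>x. f x - g x)"
proof -
  obtain K L where KL: "\<And>x. x \<in> mcar F \<Longrightarrow> norm (f x) \<le> K * mnorm F x"
    "\<And>x. x \<in> mcar F \<Longrightarrow> norm (g x) \<le> L * mnorm F x"
    using assms unfolding modlin_def by blast
  have "norm (f x - g x) \<le> (K + L) * mnorm F x" if "x \<in> mcar F" for x
    using norm_triangle_ineq4[of "f x" "g x"] KL[OF that] by (simp add: distrib_right)
  then show ?thesis using assms unfolding modlin_def
    by (auto simp: scaleC_diff_right)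
qed

lemma modlin_compose:
  assumes f: "modlin F f" and T: "bounded_linear T" "\<And>c x. T (c *\<^sub>C x) = c *\<^sub>C T x"
  shows "modlin F (\<lambda>x. T (f x))"
proof -
  obtain K where K: "\<And>x. x \<in> mcar F \<Longrightarrow> norm (f x) \<le> K * mnorm F x"
    using f unfolding modlin_def by blast
  obtain L where L: "L \<ge> 0" "\<And>x. norm (T x) \<le> norm x * L"
    using bounded_linear.nonneg_bounded[OF T(1)] by blast
  have "norm (T (f x)) \<le> (K * L) * mnorm F x" if "x \<in> mcar F" for x
    using order_trans[OF L(2)[of "f x"] mult_right_mono[OF K[OF that] L(1)]] by (simp add: mult_ac)
  then show ?thesis using f T(2) linear_add[OF bounded_linear.linear[OF T(1)]]
    unfolding modlin_def by auto
qed

lemma (in hilbert_mod) modlin_dense_mem: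
  assumes f: "modlin F f" and M: "csubspace M" "closed M"
    and S: "S \<subseteq> mcar F" "\<And>x. x \<in> S \<Longrightarrow> f x \<in> M"
    and dense: "\<And>z \<epsilon>. z \<in> mcar F \<Longrightarrow> \<epsilon> > 0 \<Longrightarrow> \<exists>s\<in>mspan F S. mdist F z s < \<epsilon>"
    and z: "z \<in> mcar F"
  shows "f z \<in> M"
proof -
  obtain K where K: "\<And>x. x \<in> mcar F \<Longrightarrow> norm (f x) \<le> K * mnorm F x"
    using f unfolding modlin_def by blast
  have f0: "f (mzero F) = 0" using K[of "mzero F"] by simp
  have span: "s \<in> mcar F \<and> f s \<in> M" if "s \<in> mspan F S" for s
    using that
  proof induction
    case (2 x y c)
    then have "y \<in> mcar F" "f y \<in> M" using S by auto
    then show ?case using 2 f M by (simp add: modlin_def csubspace_add csubspace_scale)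
  qed (simp add: f0 csubspace_0 M)
  have "\<exists>y\<in>M. dist y (f z) < e" if e: "e > 0" for e
  proof -
    \<comment> \<open>The bound \<open>K\<close> may fail to be positive, whereas
      \<open>e / L\<close> must be a positive distance.\<close>
    define L where "L = max K 1"
    have L: "L > 0" "K \<le> L" by (auto simp: L_def)
    obtain s where s: "s \<in> mspan F S" "mdist F z s < e / L"
      using dense[OF z, of "e / L"] e L by auto
    have sc: "s \<in> mcar F" "f s \<in> M" using span[OF s(1)] by auto
    have "f (msub F z s) = f z - f s"
      using f sc z by (simp add: msub_def modlin_def scaleC_minus_left)
    then have "norm (f z - f s) \<le> K * mdist F z s" using K[of "msub F z s"] sc z by (simp add: mdist_eq)
    also have "\<dots> \<le> L * mdist F z s" using L by (intro mult_right_mono) (auto simp: mdist_eq)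
    also have "\<dots> < e" using s(2) L by (simp add: pos_less_divide_eq mult.commute)
    finally show ?thesis using sc(2) by (auto simp: dist_norm norm_minus_commute)
  qed
  then have "f z \<in> closure M" by (simp add: closure_approachable)
  then show ?thesis using M(2) by simp
qed

locale correspond = hilbert_mod +
  assumes corr: "correspondence F"
begin

lemma lact_in [simp]: "x \<in> mcar F \<Longrightarrow> lact F a x \<in> mcar F"
  and lact_madd: "x \<in> mcar F \<Longrightarrow> y \<in> mcar F \<Longrightarrow> lact F a (madd F x y) = madd F (lact F a x) (lact F a y)"
  and lact_mscale: "x \<in> mcar F \<Longrightarrow> lact F a (mscale F c x) = mscale F c (lact F a x)"
  and lact_mult: "x \<in> mcar F \<Longrightarrow> lact F (a * b) x = lact F a (lact F b x)"
  and lact_add: "x \<in> mcar F \<Longrightarrow> lact F (a + b) x = madd F (lact F a x) (lact F b x)"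
  and lact_scaleC: "x \<in> mcar F \<Longrightarrow> lact F (c *\<^sub>C a) x = mscale F c (lact F a x)"
  and mip_lact_left: "x \<in> mcar F \<Longrightarrow> y \<in> mcar F \<Longrightarrow> mip F (lact F a x) y = mip F x (lact F (star a) y)"
  using corr unfolding correspondence_def by - (elim conjE, (assumption | metis))+

lemma lact_zero: "lact F a (mzero F) = mzero F"
  by (rule mip_self_eq_0D) (simp_all add: mip_lact_left)

lemma mip_lact_sum: "x \<in> mcar F \<Longrightarrow> y \<in> mcar F \<Longrightarrow>
    mip F y (lact F (a - b) x) = mip F y (lact F a x) - mip F y (lact F b x)"
  using lact_add[of x a "- b"] lact_scaleC[of x "- 1" b] by (simp add: scaleC_minus_left)

text \<open>The self-adjoint root of \<open>(norm a)\<^sup>2 *\<^sub>R 1 - star a * a\<close>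
  supplies the missing positive summand, as in \<open>rep_norm_le\<close>. The factor
  \<open>lact F 1 x\<close> appears because \<open>correspondence\<close> does not make the unit of
  the algebra act as the identity.\<close>

lemma mnorm_lact:
  assumes x: "x \<in> mcar F" shows "mnorm F (lact F a x) \<le> norm a * mnorm F (lact F 1 x)"
proof -
  obtain z where z: "star z = z" "z * z = (norm a)\<^sup>2 *\<^sub>R 1 - star a * a"
    using cpos_sqrt[OF cpos_norm_square_diff[of a]] by metis
  have "mip F (lact F z x) (lact F z x) = mip F x (lact F (z * z) x)"
    using x by (simp add: mip_lact_left z(1) lact_mult)
  also have "\<dots> = (norm a)\<^sup>2 *\<^sub>R mip F x (lact F 1 x) - mip F (lact F a x) (lact F a x)"
    using x by (simp add: z mip_lact_sum scaleR_eq_scaleC lact_scaleC mip_lact_left lact_mult)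
  also have "mip F x (lact F 1 x) = mip F (lact F 1 x) (lact F 1 x)"
    using x by (simp add: mip_lact_left flip: lact_mult)
  finally have "mip F (lact F z x) (lact F z x) + mip F (lact F a x) (lact F a x)
    = (norm a)\<^sup>2 *\<^sub>R mip F (lact F 1 x) (lact F 1 x)" by simp
  then have "norm (mip F (lact F a x) (lact F a x)) \<le> norm ((norm a)\<^sup>2 *\<^sub>R mip F (lact F 1 x) (lact F 1 x))"
    using norm_mono_cpos[OF cpos_mip cpos_mip, of "lact F a x" "lact F z x"] x
    by (simp add: add.commute)
  then have "(mnorm F (lact F a x))\<^sup>2 \<le> (norm a * mnorm F (lact F 1 x))\<^sup>2"
    by (simp add: mnorm_sq power_mult_distrib)
  then show ?thesis by (rule power2_le_imp_le) simp
qed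

text \<open>The unit acts as a projection, so the inner square of \<open>lact F 1 x\<close> equals
  \<open>mip F x (lact F 1 x)\<close>; Cauchy-Schwarz finishes.\<close>

lemma mnorm_lact_one: 
  assumes x: "x \<in> mcar F" shows "mnorm F (lact F 1 x) \<le> mnorm F x"
proof -
  have "(mnorm F (lact F 1 x))\<^sup>2 = norm (mip F x (lact F 1 x))"
    using x by (simp add: mnorm_sq mip_lact_left flip: lact_mult)
  also have "\<dots> \<le> mnorm F x * mnorm F (lact F 1 x)" using x by (simp add: mip_Cauchy_Schwarz)
  finally show ?thesis
    by (cases "mnorm F (lact F 1 x) = 0") (auto simp: power2_eq_square order_less_le)
qed

lemma mnorm_lact_le:
  assumes x: "x \<in> mcar F" shows "mnorm F (lact F a x) \<le> norm a * mnorm F x"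
  by (rule order_trans[OF mnorm_lact[OF x] mult_left_mono[OF mnorm_lact_one[OF x]]]) simp

end

lemma correspondI: "correspondence F \<Longrightarrow> correspond F"
  by unfold_locales (simp_all add: correspondence_def)

section \<open>Isometric covariant representations\<close>

text \<open>The isometry relation in polarised form together with left covariance. Linearity,
  boundedness and right covariance are consequences, so constructing a representation amounts to
  checking these two identities.\<close>

definition iso_rep ::
  "('a::cstar_algebra, 'e) corr \<Rightarrow> ('e \<Rightarrow> 'h::chilbert_space \<Rightarrow> 'h) \<Rightarrow> ('a \<Rightarrow> 'h \<Rightarrow> 'h) \<Rightarrow> bool" where
  "iso_rep F T \<rho> \<longleftrightarrow>
     (\<forall>x\<in>mcar F. \<forall>y\<in>mcar F. \<forall>h g. cinner (T x h) (T y g) = cinner h (\<rho> (mip F x y) g)) \<and>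
     (\<forall>x\<in>mcar F. \<forall>a h. \<rho> a (T x h) = T (lact F a x) h)"

lemma iso_rep_cinner:
    "iso_rep F T \<rho> \<Longrightarrow> x \<in> mcar F \<Longrightarrow> y \<in> mcar F \<Longrightarrow>
      cinner (T x h) (T y g) = cinner h (\<rho> (mip F x y) g)"
  and iso_rep_lact: "iso_rep F T \<rho> \<Longrightarrow> x \<in> mcar F \<Longrightarrow> \<rho> a (T x h) = T (lact F a x) h"
  by (auto simp: iso_rep_def)

abbreviation iso_reps ::
  "('a::cstar_algebra \<Rightarrow> 'h::chilbert_space \<Rightarrow> 'h) \<Rightarrow> ('a, 'e) corr list \<Rightarrow> ('e \<Rightarrow> 'h \<Rightarrow> 'h) list \<Rightarrow> bool"
  where
  "iso_reps \<rho> \<equiv> list_all2 (\<lambda>F T. correspondence F \<and> iso_rep F T \<rho>)"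

section \<open>Linearity, covariance and complete contractivity from the isometry relation\<close>

lemma eq_of_cinner_self:
  "cinner (x - y) (x - y) = 0 \<Longrightarrow> x = (y::'h::chilbert_space)"
  by simp

locale iso_representation = correspond F for F :: "('a::cstar_algebra, 'e) corr" +
  fixes T :: "'e \<Rightarrow> 'h::chilbert_space \<Rightarrow> 'h" and \<rho> :: "'a \<Rightarrow> 'h \<Rightarrow> 'h"
  assumes \<rho>: "algebra_rep \<rho>" and T: "iso_rep F T \<rho>"
begin

lemmas ip = iso_rep_cinner[OF T]
lemmas expand = cinner_diff_left cinner_diff_right cinner_add_left cinner_add_right
  cinner_scaleC_left cinner_scaleC_right rep_add[OF \<rho>] rep_scaleC[OF \<rho>] rep_mult[OF \<rho>]
  rep_add_right[OF \<rho>] rep_scaleC_right[OF \<rho>]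

text \<open>The isometry relation computes all inner products among the vectors on the two sides,
  and those computations show that the difference has norm zero. The next four identities hold for
  the same reason.\<close>

lemma T_add: "x \<in> mcar F \<Longrightarrow> T x (h + g) = T x h + T x g"
  by (rule eq_of_cinner_self) (simp add: expand ip)

lemma T_scaleC: "x \<in> mcar F \<Longrightarrow> T x (c *\<^sub>C h) = c *\<^sub>C T x h"
  by (rule eq_of_cinner_self) (simp add: expand ip)

lemma T_madd: "x \<in> mcar F \<Longrightarrow> y \<in> mcar F \<Longrightarrow> T (madd F x y) h = T x h + T y h"
  by (rule eq_of_cinner_self) (simp add: expand ip)

lemma T_mscale: "x \<in> mcar F \<Longrightarrow> T (mscale F c x) h = c *\<^sub>C T x h"
  by (rule eq_of_cinner_self) (simp add: expand ip)

lemma T_ract: "x \<in> mcar F \<Longrightarrow> T (ract F x a) h = T x (\<rho> a h)"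
  by (rule eq_of_cinner_self) (simp add: expand ip rep_adjoint[OF \<rho>])

lemma T_norm: 
  assumes x: "x \<in> mcar F" shows "norm (T x h) \<le> mnorm F x * norm h"
proof -
  have "(norm (T x h))\<^sup>2 = Re (cinner h (\<rho> (mip F x x) h))"
    using arg_cong[OF ip[OF x x, of h h], of Re] by (simp add: cinner_self)
  also have "\<dots> \<le> norm h * norm (\<rho> (mip F x x) h)"
    using complex_Re_le_cmod cinner_Cauchy_Schwarz order_trans by blast
  also have "\<dots> \<le> norm h * (norm (mip F x x) * norm h)"
    using rep_norm_le[OF \<rho>] by (rule mult_left_mono) simp
  also have "\<dots> = (mnorm F x * norm h)\<^sup>2"
    by (simp add: power_mult_distrib mnorm_sq) (simp add: power2_eq_square)
  finally show ?thesis by (rule power2_le_imp_le) simp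
qed

lemma T_bounded_op: "x \<in> mcar F \<Longrightarrow> bounded_op whole whole (T x)"
  by (intro bounded_op_wholeI[of _ "mnorm F x"] T_add T_scaleC T_norm)

lemma modlin_T: "modlin F (\<lambda>x. T x h)"
  unfolding modlin_def
  by (intro conjI ballI allI exI[of _ "norm h"])
    (auto simp: T_madd T_mscale intro: order_trans[OF T_norm])

lemma T_sum_cinner:
  assumes x: "\<And>i j. i < N \<Longrightarrow> j < N \<Longrightarrow> x i j \<in> mcar F"
  shows "complex_of_real (\<Sum>i<N. (norm (\<Sum>j<N. T (x i j) (v j)))\<^sup>2)
    = (\<Sum>j<N. \<Sum>k<N. cinner (v j) (\<rho> (\<Sum>i<N. mip F (x i j) (x i k)) (v k)))"
proof -
  have "complex_of_real (\<Sum>i<N. (norm (\<Sum>j<N. T (x i j) (v j)))\<^sup>2)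
    = (\<Sum>i<N. cinner (\<Sum>j<N. T (x i j) (v j)) (\<Sum>k<N. T (x i k) (v k)))"
    by (simp only: of_real_sum cinner_self)
  also have "\<dots> = (\<Sum>i<N. \<Sum>j<N. \<Sum>k<N. cinner (v j) (\<rho> (mip F (x i j) (x i k)) (v k)))"
    unfolding cinner_sum_left unfolding cinner_sum_right
    by (intro sum.cong refl) (simp add: ip x)
  also have "\<dots> = (\<Sum>j<N. \<Sum>i<N. \<Sum>k<N. cinner (v j) (\<rho> (mip F (x i j) (x i k)) (v k)))"
    by (rule sum.swap)
  also have "\<dots> = (\<Sum>j<N. \<Sum>k<N. \<Sum>i<N. cinner (v j) (\<rho> (mip F (x i j) (x i k)) (v k)))"
    by (intro sum.cong refl sum.swap)
  finally show ?thesis by (simp add: rep_sum[OF \<rho>] cinner_sum_right)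
qed

text \<open>The squared norm of the image column is the quadratic form of \<rho> applied to the Gram
  matrix of \<open>x\<close>, and the matrix norm of that Gram matrix is the square of
  \<open>corr_mat_norm\<close>.\<close>

lemma T_completely_contractive: "completely_contractive F T"
  unfolding completely_contractive_def
proof (intro allI impI)
  fix N and x :: "nat \<Rightarrow> nat \<Rightarrow> 'e" and v :: "nat \<Rightarrow> 'h"
  assume x: "\<forall>i<N. \<forall>j<N. x i j \<in> mcar F"
  let ?M = "\<lambda>i j. \<Sum>l<N. mip F (x l i) (x l j)"
  have "star (?M i j) = ?M j i" if "i < N" "j < N" for i j
    using x that by (simp add: star_sum star_mip)
  from matrix_rep_contractive[where M="?M" and N=N and h=v, OF \<rho> this]
  have "cmod (complex_of_real (\<Sum>i<N. (norm (\<Sum>j<N. T (x i j) (v j)))\<^sup>2))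
      \<le> mat_norm N ?M * (\<Sum>i<N. (norm (v i))\<^sup>2)"
    using T_sum_cinner[of N x v] x by simp
  then have "(\<Sum>i<N. (norm (\<Sum>j<N. T (x i j) (v j)))\<^sup>2) \<le> mat_norm N ?M * (\<Sum>i<N. (norm (v i))\<^sup>2)"
    by (simp only: norm_of_real)
  then show "sqrt (\<Sum>i<N. (norm (\<Sum>j<N. T (x i j) (v j)))\<^sup>2)
      \<le> corr_mat_norm F N x * sqrt (\<Sum>j<N. (norm (v j))\<^sup>2)"
    unfolding corr_mat_norm_def real_sqrt_mult[symmetric] by (rule real_sqrt_le_mono)
qed

end

text \<open>The graph of the linear extension of \<open>e w \<mapsto> t w\<close>. It is a relation
  because different combinations of generators may represent the same element of
  \<open>F\<close>.\<close>

inductive lin_rel ::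
  "('a::cstar_algebra, 'e) corr \<Rightarrow> 'w set \<Rightarrow> ('w \<Rightarrow> 'e) \<Rightarrow> ('w \<Rightarrow> 'h::chilbert_space \<Rightarrow> 'h) \<Rightarrow>
    'e \<Rightarrow> ('h \<Rightarrow> 'h) \<Rightarrow> bool"
  for F W e t where
  "lin_rel F W e t (mzero F) (\<lambda>_. 0)"
| "lin_rel F W e t s P \<Longrightarrow> w \<in> W \<Longrightarrow>
    lin_rel F W e t (madd F s (mscale F c (e w))) (\<lambda>h. P h + c *\<^sub>C t w h)"

definition lim_rel ::
  "('a::cstar_algebra, 'e) corr \<Rightarrow> 'w set \<Rightarrow> ('w \<Rightarrow> 'e) \<Rightarrow> ('w \<Rightarrow> 'h::chilbert_space \<Rightarrow> 'h) \<Rightarrow>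
    'e \<Rightarrow> ('h \<Rightarrow> 'h) \<Rightarrow> bool" where
  "lim_rel F W e t z U \<longleftrightarrow> (\<exists>s P. (\<forall>n. lin_rel F W e t (s n) (P n)) \<and>
     (\<lambda>n. mdist F z (s n)) \<longlonglongrightarrow> 0 \<and> (\<forall>h. (\<lambda>n. P n h) \<longlonglongrightarrow> U h))"

text \<open>The representation is the closure of the linear relation that is generated by the prescribed
  values.\<close>

lemma iso_rep_extension:
  fixes F :: "('a::cstar_algebra, 'e) corr" and t :: "'w \<Rightarrow> 'h::chilbert_space \<Rightarrow> 'h"
  assumes F: "correspondence F" and \<rho>: "algebra_rep \<rho>"
    and e: "\<And>w. w \<in> W \<Longrightarrow> e w \<in> mcar F"
    and total: "\<And>z \<epsilon>. z \<in> mcar F \<Longrightarrow> \<epsilon> > 0 \<Longrightarrow> \<exists>s\<in>mspan F (e ` W). mdist F z s < \<epsilon>"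
    and ip: "\<And>w w' h g. w \<in> W \<Longrightarrow> w' \<in> W \<Longrightarrow> cinner (t w h) (t w' g) = cinner h (\<rho> (mip F (e w) (e w')) g)"
    and act: "\<And>w a. w \<in> W \<Longrightarrow> \<exists>w'\<in>W. e w' = lact F a (e w) \<and> (\<forall>h. t w' h = \<rho> a (t w h))"
  obtains T where "iso_rep F T \<rho>" "\<And>w h. w \<in> W \<Longrightarrow> T (e w) h = t w h"
proof -
  interpret correspond F using F by (rule correspondI)
  note [simp] = rep_add[OF \<rho>] rep_scaleC[OF \<rho>] rep_add_right[OF \<rho>] rep_scaleC_right[OF \<rho>]
    rep_zero[OF \<rho>] rep_zero_right[OF \<rho>] cinner_add_left cinner_add_right cinner_scaleC_left
    cinner_scaleC_right e
  let ?R = "lin_rel F W e t" and ?L = "lim_rel F W e t"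
  have Rin: "s \<in> mcar F" if "?R s P" for s P
    using that by induction auto
  have Rip1: "cinner (t w h) (P g) = cinner h (\<rho> (mip F (e w) s) g)" if w: "w \<in> W" and "?R s P" for w h g s P
    using that(2)
  proof induction
    case (2 s P w' c)
    then show ?case using w Rin[OF 2(1)] by (simp add: ip)
  qed (use w in simp)
  \<comment> \<open>The Gram identity spreads from generators to combinations one argument at a
    time; uniqueness of the values is contained in it.\<close>
  have Rip: "cinner (P h) (Q g) = cinner h (\<rho> (mip F s s') g)" if "?R s P" and Q: "?R s' Q" for h g s P s' Q
    using that(1)
  proof induction
    case (2 s P w c)
    then show ?case using Rin[OF 2(1)] Rin[OF Q] by (simp add: Rip1[OF _ Q])
  qed (use Rin[OF Q] in simp)
  have Rgen: "?R (madd F (mzero F) (mscale F 1 (e w))) (\<lambda>h. 0 + 1 *\<^sub>C t w h)" if "w \<in> W" for w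
    using that by (intro lin_rel.intros)
  have one: "mscale F 1 (e w) = e w" if "w \<in> W" for w
    using hm e[OF that] unfolding hilbert_module_def by - (elim conjE, metis)
  have Rw: "?R (e w) (t w)" if "w \<in> W" for w
    using Rgen[OF that] that by (simp add: one madd_zero)
  have Rspan: "\<exists>P. ?R s P" if "s \<in> mspan F (e ` W)" for s
    using that by induction (blast intro: lin_rel.intros)+
  have Ract: "?R (lact F a s) (\<lambda>h. \<rho> a (P h))" if "?R s P" for s P a
    using that
  proof induction
    case 1
    show ?case using lin_rel.intros(1)[of F W e t] by (simp add: lact_zero)
  next
    case (2 s P w c)
    obtain w' where w': "w' \<in> W" "e w' = lact F a (e w)" "\<And>h. t w' h = \<rho> a (t w h)"
      using act[OF 2(2)] by metis
    have "?R (madd F (lact F a s) (mscale F c (e w'))) (\<lambda>h. \<rho> a (P h) + c *\<^sub>C t w' h)"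
      using 2(3) w'(1) by (rule lin_rel.intros)
    then show ?case using 2(2) Rin[OF 2(1)] by (simp add: w' lact_madd lact_mscale)
  qed
  have Lip: "cinner (U h) (V g) = cinner h (\<rho> (mip F z z') g)"
    if z: "z \<in> mcar F" "z' \<in> mcar F" and L: "?L z U" "?L z' V" for z z' U V h g
  proof -
    obtain s P s' Q where s: "\<And>n. ?R (s n) (P n)" "(\<lambda>n. mdist F z (s n)) \<longlonglongrightarrow> 0" "\<And>h. (\<lambda>n. P n h) \<longlonglongrightarrow> U h"
      and s': "\<And>n. ?R (s' n) (Q n)" "(\<lambda>n. mdist F z' (s' n)) \<longlonglongrightarrow> 0" "\<And>h. (\<lambda>n. Q n h) \<longlonglongrightarrow> V h"
      using L unfolding lim_rel_def by blast
    have "(\<lambda>n. cinner (P n h) (Q n g)) \<longlonglongrightarrow> cinner (U h) (V g)"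
      by (intro tendsto_cinner s s')
    moreover have "(\<lambda>n. cinner h (\<rho> (mip F (s n) (s' n)) g)) \<longlonglongrightarrow> cinner h (\<rho> (mip F z z') g)"
      by (intro tendsto_cinner tendsto_const tendsto_rep[OF \<rho>] tendsto_mip Rin[OF s(1)] Rin[OF s'(1)] s s' z)
    ultimately show ?thesis
      unfolding Rip[OF s(1) s'(1)] by (rule LIMSEQ_unique)
  qed
  \<comment> \<open>Applied to the four pairs formed from \<open>U\<close> and \<open>V\<close>, the
    Gram identity yields one common value, so the difference of the two vectors is null.\<close>
  have Luniq: "U h = V h" if "z \<in> mcar F" "?L z U" "?L z V" for z U V h
    by (rule eq_of_cinner_self) (use that in \<open>simp add: cinner_diff_left cinner_diff_right Lip[of z z]\<close>)
  have Lgen: "?L (e w) (t w)" if "w \<in> W" for w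
    unfolding lim_rel_def
    by (rule exI[of _ "\<lambda>_. e w"], rule exI[of _ "\<lambda>_. t w"])
      (use that in \<open>simp add: Rw mdist_eq msub_self\<close>)
  have Lact: "?L (lact F a z) (\<lambda>h. \<rho> a (U h))" if z: "z \<in> mcar F" and L: "?L z U" for z U a
  proof -
    obtain s P where s: "\<And>n. ?R (s n) (P n)" "(\<lambda>n. mdist F z (s n)) \<longlonglongrightarrow> 0" "\<And>h. (\<lambda>n. P n h) \<longlonglongrightarrow> U h"
      using L unfolding lim_rel_def by blast
    have le: "norm (mdist F (lact F a z) (lact F a (s n))) \<le> norm a * mdist F z (s n)" for n
      using mnorm_lact_le[of "msub F z (s n)" a] z Rin[OF s(1)[of n]]
      by (simp add: mdist_eq msub_def lact_madd lact_mscale)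
    have "(\<lambda>n. norm a * mdist F z (s n)) \<longlonglongrightarrow> norm a * 0" by (intro tendsto_intros s)
    then have "(\<lambda>n. mdist F (lact F a z) (lact F a (s n))) \<longlonglongrightarrow> 0"
      by (intro Lim_null_comparison[OF always_eventually[OF allI[OF le]]]) simp
    moreover have "(\<lambda>n. \<rho> a (P n h)) \<longlonglongrightarrow> \<rho> a (U h)" for h
      by (rule bounded_linear.tendsto[OF bounded_op_whole(1)[OF rep_bounded_op[OF \<rho>]] s(3)])
    ultimately show ?thesis
      unfolding lim_rel_def using Ract[OF s(1)]
      by (intro exI[of _ "\<lambda>n. lact F a (s n)"] exI[of _ "\<lambda>n h. \<rho> a (P n h)"] conjI allI)
  qed
  have Lex: "\<exists>U. ?L z U" if z: "z \<in> mcar F" for z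
  proof -
    have "\<exists>s P. ?R s P \<and> mdist F z s < 1 / real (Suc n)" for n
      using total[OF z, of "1 / real (Suc n)"] Rspan by fastforce
    then obtain s P where s: "\<And>n. ?R (s n) (P n)" "\<And>n. mdist F z (s n) < 1 / real (Suc n)"
      by metis
    have sin: "s n \<in> mcar F" for n using Rin[OF s(1)] .
    have le: "norm (mdist F z (s n)) \<le> 1 / real (Suc n)" for n
      using s(2)[of n] by (simp add: mdist_eq)
    have d0: "(\<lambda>n. mdist F z (s n)) \<longlonglongrightarrow> 0"
      by (rule Lim_null_comparison[OF always_eventually[OF allI[OF le]] LIMSEQ_Suc[OF lim_1_over_n]])
    \<comment> \<open>The isometry relation controls operator values by the module distance, so
      module convergence forces convergence at each vector.\<close>
    have diff: "norm (P m h - P n h) \<le> mdist F (s m) (s n) * norm h" for m n h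
    proof -
      have "cinner (P m h - P n h) (P m h - P n h) = cinner h (\<rho> (mip F (msub F (s m) (s n)) (msub F (s m) (s n))) h)"
        by (simp add: cinner_diff_left cinner_diff_right Rip[OF s(1) s(1)] mip_msub_left
            mip_msub_right sin rep_diff[OF \<rho>])
      then have "(norm (P m h - P n h))\<^sup>2 = Re (cinner h (\<rho> (mip F (msub F (s m) (s n)) (msub F (s m) (s n))) h))"
        by (metis cinner_self Re_complex_of_real)
      also have "\<dots> \<le> norm h * norm (\<rho> (mip F (msub F (s m) (s n)) (msub F (s m) (s n))) h)"
        using complex_Re_le_cmod cinner_Cauchy_Schwarz order_trans by blast
      also have "\<dots> \<le> norm h * (norm (mip F (msub F (s m) (s n)) (msub F (s m) (s n))) * norm h)"
        using rep_norm_le[OF \<rho>] by (rule mult_left_mono) simp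
      also have "\<dots> = (mdist F (s m) (s n) * norm h)\<^sup>2"
        by (simp add: power_mult_distrib mdist_eq mnorm_sq) (simp add: power2_eq_square)
      finally show ?thesis by (rule power2_le_imp_le) (simp add: mdist_eq)
    qed
    have "Cauchy (\<lambda>n. P n h)" for h
      unfolding Cauchy_def
    proof (intro allI impI)
      fix \<epsilon> :: real assume \<epsilon>: "\<epsilon> > 0"
      define c where "c = norm h + 1"
      have c: "norm h < c" "c > 0" by (auto simp: c_def add_nonneg_pos)
      define \<delta> where "\<delta> = \<epsilon> / (2 * c)"
      have \<delta>: "\<delta> > 0" using \<epsilon> c by (simp add: \<delta>_def)
      obtain N where N: "\<And>n. n \<ge> N \<Longrightarrow> mdist F z (s n) < \<delta>"
        using LIMSEQ_D[OF d0 \<delta>] by (auto simp: mdist_eq)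
      have "dist (P m h) (P n h) < \<epsilon>" if "m \<ge> N" "n \<ge> N" for m n
      proof -
        have "mdist F (s m) (s n) \<le> mdist F (s m) z + mdist F z (s n)"
          using mdist_triangle sin z by blast
        also have "\<dots> \<le> 2 * \<delta>" using N[OF that(1)] N[OF that(2)] mdist_commute[OF sin z, of m] by simp
        finally have "norm (P m h - P n h) \<le> 2 * \<delta> * norm h"
          using diff[of m h n] by (meson mult_right_mono norm_ge_zero order_trans)
        also have "\<dots> < 2 * \<delta> * c" using \<delta> c by simp
        also have "\<dots> = \<epsilon>" using c by (simp add: \<delta>_def)
        finally show ?thesis by (simp add: dist_norm)
      qed
      then show "\<exists>N. \<forall>m\<ge>N. \<forall>n\<ge>N. dist (P m h) (P n h) < \<epsilon>" by blast
    qed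
    then have "\<exists>u. (\<lambda>n. P n h) \<longlonglongrightarrow> u" for h
      using Cauchy_convergent_iff convergent_def by blast
    then obtain U where "\<And>h. (\<lambda>n. P n h) \<longlonglongrightarrow> U h" by metis
    then show ?thesis unfolding lim_rel_def using s(1) d0 by blast
  qed
  \<comment> \<open>By \<open>Luniq\<close> the choice is immaterial on the carrier.\<close>
  define T where "T z = (SOME U. ?L z U)" for z
  have TL: "?L z (T z)" if "z \<in> mcar F" for z
    unfolding T_def by (rule someI_ex[OF Lex[OF that]])
  have "iso_rep F T \<rho>"
    unfolding iso_rep_def
  proof (intro conjI ballI allI)
    show "cinner (T x h) (T y g) = cinner h (\<rho> (mip F x y) g)" if "x \<in> mcar F" "y \<in> mcar F" for x y h g
      using Lip[OF that TL[OF that(1)] TL[OF that(2)]] .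
    show "\<rho> a (T x h) = T (lact F a x) h" if "x \<in> mcar F" for x a h
      using Luniq[OF lact_in[OF that] Lact[OF that TL[OF that]] TL[OF lact_in[OF that]]] .
  qed
  moreover have "T (e w) h = t w h" if "w \<in> W" for w h
    using Luniq[OF e[OF that] TL[OF e[OF that]] Lgen[OF that]] .
  ultimately show thesis using that by blast
qed

section \<open>Interior tensor products\<close>

lemma tensorD:
  assumes "is_interior_tensor F G T \<tau>"
  shows tensor_corr: "correspondence T"
    and tensor_in: "x \<in> mcar F \<Longrightarrow> y \<in> mcar G \<Longrightarrow> \<tau> x y \<in> mcar T"
    and tensor_add_left: "x \<in> mcar F \<Longrightarrow> x' \<in> mcar F \<Longrightarrow> y \<in> mcar G \<Longrightarrow>
      \<tau> (madd F x x') y = madd T (\<tau> x y) (\<tau> x' y)"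
    and tensor_add_right: "x \<in> mcar F \<Longrightarrow> y \<in> mcar G \<Longrightarrow> y' \<in> mcar G \<Longrightarrow>
      \<tau> x (madd G y y') = madd T (\<tau> x y) (\<tau> x y')"
    and tensor_scale_left: "x \<in> mcar F \<Longrightarrow> y \<in> mcar G \<Longrightarrow> \<tau> (mscale F c x) y = mscale T c (\<tau> x y)"
    and tensor_scale_right: "x \<in> mcar F \<Longrightarrow> y \<in> mcar G \<Longrightarrow> \<tau> x (mscale G c y) = mscale T c (\<tau> x y)"
    and tensor_lact: "x \<in> mcar F \<Longrightarrow> y \<in> mcar G \<Longrightarrow> lact T a (\<tau> x y) = \<tau> (lact F a x) y"
    and tensor_mip: "x \<in> mcar F \<Longrightarrow> x' \<in> mcar F \<Longrightarrow> y \<in> mcar G \<Longrightarrow> y' \<in> mcar G \<Longrightarrow>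
      mip T (\<tau> x y) (\<tau> x' y') = mip G y (lact G (mip F x x') y')"
    and tensor_dense: "z \<in> mcar T \<Longrightarrow> \<epsilon> > 0 \<Longrightarrow>
      \<exists>s\<in>mspan T {\<tau> x y |x y. x \<in> mcar F \<and> y \<in> mcar G}. mdist T z s < \<epsilon>"
proof -
  have facts: "correspondence T" "\<forall>x\<in>mcar F. \<forall>y\<in>mcar G. \<tau> x y \<in> mcar T"
    "\<forall>x\<in>mcar F. \<forall>x'\<in>mcar F. \<forall>y\<in>mcar G. \<tau> (madd F x x') y = madd T (\<tau> x y) (\<tau> x' y)"
    "\<forall>x\<in>mcar F. \<forall>y\<in>mcar G. \<forall>y'\<in>mcar G. \<tau> x (madd G y y') = madd T (\<tau> x y) (\<tau> x y')"
    "\<forall>x\<in>mcar F. \<forall>y\<in>mcar G. \<forall>c. \<tau> (mscale F c x) y = mscale T c (\<tau> x y) \<and>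
        \<tau> x (mscale G c y) = mscale T c (\<tau> x y)"
    "\<forall>x\<in>mcar F. \<forall>y\<in>mcar G. \<forall>a. \<tau> (ract F x a) y = \<tau> x (lact G a y) \<and>
        lact T a (\<tau> x y) = \<tau> (lact F a x) y \<and> ract T (\<tau> x y) a = \<tau> x (ract G y a)"
    "\<forall>x\<in>mcar F. \<forall>x'\<in>mcar F. \<forall>y\<in>mcar G. \<forall>y'\<in>mcar G.
        mip T (\<tau> x y) (\<tau> x' y') = mip G y (lact G (mip F x x') y')"
    "\<forall>z\<in>mcar T. \<forall>\<epsilon>>0. \<exists>s\<in>mspan T {\<tau> x y |x y. x \<in> mcar F \<and> y \<in> mcar G}. mdist T z s < \<epsilon>"
    using assms unfolding is_interior_tensor_def by - (elim conjE, assumption)+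
  show "correspondence T" by (rule facts(1))
  show "x \<in> mcar F \<Longrightarrow> y \<in> mcar G \<Longrightarrow> \<tau> x y \<in> mcar T" using facts(2) by simp
  show "x \<in> mcar F \<Longrightarrow> x' \<in> mcar F \<Longrightarrow> y \<in> mcar G \<Longrightarrow>
      \<tau> (madd F x x') y = madd T (\<tau> x y) (\<tau> x' y)" using facts(3) by simp
  show "x \<in> mcar F \<Longrightarrow> y \<in> mcar G \<Longrightarrow> y' \<in> mcar G \<Longrightarrow>
      \<tau> x (madd G y y') = madd T (\<tau> x y) (\<tau> x y')" using facts(4) by simp
  show "x \<in> mcar F \<Longrightarrow> y \<in> mcar G \<Longrightarrow> \<tau> (mscale F c x) y = mscale T c (\<tau> x y)"
    and "x \<in> mcar F \<Longrightarrow> y \<in> mcar G \<Longrightarrow> \<tau> x (mscale G c y) = mscale T c (\<tau> x y)"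
    using facts(5) by simp_all
  show "x \<in> mcar F \<Longrightarrow> y \<in> mcar G \<Longrightarrow> lact T a (\<tau> x y) = \<tau> (lact F a x) y"
    using facts(6) by simp
  show "x \<in> mcar F \<Longrightarrow> x' \<in> mcar F \<Longrightarrow> y \<in> mcar G \<Longrightarrow> y' \<in> mcar G \<Longrightarrow>
      mip T (\<tau> x y) (\<tau> x' y') = mip G y (lact G (mip F x x') y')" using facts(7) by simp
  show "z \<in> mcar T \<Longrightarrow> \<epsilon> > 0 \<Longrightarrow>
      \<exists>s\<in>mspan T {\<tau> x y |x y. x \<in> mcar F \<and> y \<in> mcar G}. mdist T z s < \<epsilon>"
    using facts(8) by blast
qed

text \<open>The products \<open>T1 x (T2 y h)\<close> obey the Gram identity of the tensor product:
  isometry of \<open>T1\<close> leaves \<open>\<rho> (mip F x x')\<close> in the middle, left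
  covariance of \<open>T2\<close> moves it onto \<open>y'\<close>, and isometry of \<open>T2\<close>
  concludes.\<close>

lemma tensor_iso_rep:
  fixes T1 :: "'e \<Rightarrow> 'h::chilbert_space \<Rightarrow> 'h"
  assumes \<rho>: "algebra_rep \<rho>" and ten: "is_interior_tensor F G T \<tau>"
    and F: "correspondence F" "iso_rep F T1 \<rho>" and G: "correspondence G" "iso_rep G T2 \<rho>"
  obtains T3 where "iso_rep T T3 \<rho>"
    "\<And>x y h. x \<in> mcar F \<Longrightarrow> y \<in> mcar G \<Longrightarrow> T3 (\<tau> x y) h = T1 x (T2 y h)"
proof -
  interpret F: correspond F using F(1) by (rule correspondI)
  interpret G: correspond G using G(1) by (rule correspondI)
  let ?W = "mcar F \<times> mcar G" and ?e = "\<lambda>(x, y). \<tau> x y" and ?t = "\<lambda>(x, y) h. T1 x (T2 y h)"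
  have W: "{\<tau> x y |x y. x \<in> mcar F \<and> y \<in> mcar G} = ?e ` ?W" by auto
  obtain T3 where T3: "iso_rep T T3 \<rho>" "\<And>w h. w \<in> ?W \<Longrightarrow> T3 (?e w) h = ?t w h"
  proof (rule iso_rep_extension[OF tensor_corr[OF ten] \<rho>, of ?W ?e ?t])
    fix w w' h g assume w: "w \<in> ?W" "w' \<in> ?W"
    then show "cinner (?t w h) (?t w' g) = cinner h (\<rho> (mip T (?e w) (?e w')) g)"
      by (auto simp: iso_rep_cinner[OF F(2)] iso_rep_cinner[OF G(2)] iso_rep_lact[OF G(2)]
          tensor_mip[OF ten])
  next
    fix w a assume w: "w \<in> ?W"
    then show "\<exists>w'\<in>?W. ?e w' = lact T a (?e w) \<and> (\<forall>h. ?t w' h = \<rho> a (?t w h))"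
      by (intro bexI[of _ "(lact F a (fst w), snd w)"])
        (auto simp: tensor_lact[OF ten] iso_rep_lact[OF F(2)])
  next
    fix z \<epsilon> assume "z \<in> mcar T" "(\<epsilon>::real) > 0"
    then show "\<exists>s\<in>mspan T (?e ` ?W). mdist T z s < \<epsilon>"
      using tensor_dense[OF ten] unfolding W by blast
  qed (auto simp: tensor_in[OF ten])
  show thesis by (rule that[OF T3(1)]) (use T3(2) in force)
qed

lemma tensor_mnorm_le:
  assumes ten: "is_interior_tensor F G T \<tau>" and F: "correspondence F" and G: "correspondence G"
    and x: "x \<in> mcar F" and y: "y \<in> mcar G"
  shows "mnorm T (\<tau> x y) \<le> mnorm F x * mnorm G y"
proof -
  interpret G: correspond G using G by (rule correspondI)
  have "(mnorm T (\<tau> x y))\<^sup>2 = norm (mip G y (lact G (mip F x x) y))"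
    using x y by (simp add: mnorm_sq tensor_mip[OF ten])
  also have "\<dots> \<le> mnorm G y * mnorm G (lact G (mip F x x) y)"
    using y by (simp add: G.mip_Cauchy_Schwarz)
  also have "\<dots> \<le> mnorm G y * (norm (mip F x x) * mnorm G y)"
    using y by (intro mult_left_mono G.mnorm_lact_le) auto
  also have "\<dots> = (mnorm F x * mnorm G y)\<^sup>2"
    by (simp add: power_mult_distrib mnorm_sq[of F]) (simp add: power2_eq_square)
  finally show ?thesis by (rule power2_le_imp_le) simp
qed

lemma modlin_tensor_mem:
  assumes ten: "is_interior_tensor F G T \<tau>" and f: "modlin T f" and M: "csubspace M" "closed M"
    and mem: "\<And>x y. x \<in> mcar F \<Longrightarrow> y \<in> mcar G \<Longrightarrow> f (\<tau> x y) \<in> M" and z: "z \<in> mcar T"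
  shows "f z \<in> M"
proof -
  interpret T: correspond T using tensor_corr[OF ten] by (rule correspondI)
  show ?thesis
    by (rule T.modlin_dense_mem[OF f M _ _ tensor_dense[OF ten] z])
      (auto simp: tensor_in[OF ten] mem)
qed

lemma modlin_tensor_eq:
  assumes ten: "is_interior_tensor F G T \<tau>" and f: "modlin T f" and g: "modlin T g"
    and eq: "\<And>x y. x \<in> mcar F \<Longrightarrow> y \<in> mcar G \<Longrightarrow> f (\<tau> x y) = g (\<tau> x y)" and z: "z \<in> mcar T"
  shows "f z = g z"
proof -
  have "f z - g z \<in> {0}"
    by (rule modlin_tensor_mem[OF ten modlin_diff[OF f g] _ _ _ z]) (auto simp: csubspace_def eq)
  then show ?thesis by simp
qed

lemma modlin_tensor_right:
  assumes ten: "is_interior_tensor F G T \<tau>" and F: "correspondence F" and G: "correspondence G"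
    and f: "modlin T f" and x: "x \<in> mcar F"
  shows "modlin G (\<lambda>y. f (\<tau> x y))"
proof -
  obtain K where K: "\<And>z. z \<in> mcar T \<Longrightarrow> norm (f z) \<le> K * mnorm T z"
    using f unfolding modlin_def by blast
  have "norm (f (\<tau> x y)) \<le> (\<bar>K\<bar> * mnorm F x) * mnorm G y" if y: "y \<in> mcar G" for y
  proof -
    have "norm (f (\<tau> x y)) \<le> \<bar>K\<bar> * mnorm T (\<tau> x y)"
      by (rule order_trans[OF K[OF tensor_in[OF ten x y]] mult_right_mono]) auto
    also have "\<dots> \<le> \<bar>K\<bar> * (mnorm F x * mnorm G y)"
      by (intro mult_left_mono tensor_mnorm_le[OF ten F G x y]) simp
    finally show ?thesis by (simp add: mult_ac)
  qed
  moreover have "f (\<tau> x (madd G y y')) = f (\<tau> x y) + f (\<tau> x y')"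
    if "y \<in> mcar G" "y' \<in> mcar G" for y y'
    using f that x unfolding modlin_def by (simp add: tensor_add_right[OF ten] tensor_in[OF ten])
  moreover have "f (\<tau> x (mscale G c y)) = c *\<^sub>C f (\<tau> x y)" if "y \<in> mcar G" for c y
    using f that x unfolding modlin_def by (simp add: tensor_scale_right[OF ten] tensor_in[OF ten])
  ultimately show ?thesis unfolding modlin_def by blast
qed

lemma modlin_tensor_left:
  assumes ten: "is_interior_tensor F G T \<tau>" and F: "correspondence F" and G: "correspondence G"
    and f: "modlin T f" and y: "y \<in> mcar G"
  shows "modlin F (\<lambda>x. f (\<tau> x y))"
proof -
  obtain K where K: "\<And>z. z \<in> mcar T \<Longrightarrow> norm (f z) \<le> K * mnorm T z"
    using f unfolding modlin_def by blast
  have "norm (f (\<tau> x y)) \<le> (\<bar>K\<bar> * mnorm G y) * mnorm F x" if x: "x \<in> mcar F" for x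
  proof -
    have "norm (f (\<tau> x y)) \<le> \<bar>K\<bar> * mnorm T (\<tau> x y)"
      by (rule order_trans[OF K[OF tensor_in[OF ten x y]] mult_right_mono]) auto
    also have "\<dots> \<le> \<bar>K\<bar> * (mnorm F x * mnorm G y)"
      by (intro mult_left_mono tensor_mnorm_le[OF ten F G x y]) simp
    finally show ?thesis by (simp add: mult_ac)
  qed
  moreover have "f (\<tau> (madd F x x') y) = f (\<tau> x y) + f (\<tau> x' y)"
    if "x \<in> mcar F" "x' \<in> mcar F" for x x'
    using f that y unfolding modlin_def by (simp add: tensor_add_left[OF ten] tensor_in[OF ten])
  moreover have "f (\<tau> (mscale F c x) y) = c *\<^sub>C f (\<tau> x y)" if "x \<in> mcar F" for c x
    using f that y unfolding modlin_def by (simp add: tensor_scale_left[OF ten] tensor_in[OF ten])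
  ultimately show ?thesis unfolding modlin_def by blast
qed

section \<open>Tensor words\<close>

definition word_op :: "('e \<Rightarrow> 'h \<Rightarrow> 'h) list \<Rightarrow> 'e list \<Rightarrow> 'h \<Rightarrow> 'h" where
  "word_op Ts xs h = foldr (\<lambda>(T, x). T x) (zip Ts xs) h"

lemma word_op_simps [simp]:
  "word_op [] xs h = h" "word_op Ts [] h = h"
  "word_op (T # Ts) (x # xs) h = T x (word_op Ts xs h)"
  by (simp_all add: word_op_def)

lemma word_op_replicate: "word_op (replicate (length xs) T) xs h = foldr T xs h"
  by (induction xs) auto

text \<open>The accumulator \<open>a\<close> is absorbed into the first letter of \<open>ys\<close>
  by left covariance; isometry then turns the two first letters into the next accumulator
  \<open>mip F x (lact F a y)\<close>.\<close>

lemma word_op_ip_from: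
  assumes \<rho>: "algebra_rep \<rho>" and Ts: "iso_reps \<rho> Fs Ts"
    and xs: "list_all2 (\<lambda>F x. x \<in> mcar F) Fs xs" and ys: "list_all2 (\<lambda>F x. x \<in> mcar F) Fs ys"
  shows "cinner (word_op Ts xs h) (\<rho> a (word_op Ts ys g)) = cinner h (\<rho> (word_ip_from a Fs xs ys) g)"
  using Ts xs ys
proof (induction Fs Ts arbitrary: a xs ys rule: list_all2_induct)
  case (Cons F Fs T Ts)
  interpret correspond F using Cons.hyps by (auto intro: correspondI)
  obtain x xs' y ys' where xy: "xs = x # xs'" "ys = y # ys'" "x \<in> mcar F" "y \<in> mcar F"
    "list_all2 (\<lambda>F x. x \<in> mcar F) Fs xs'" "list_all2 (\<lambda>F x. x \<in> mcar F) Fs ys'"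
    using Cons.prems by (auto simp: list_all2_Cons1)
  have T: "iso_rep F T \<rho>" using Cons.hyps by simp
  show ?case
    using xy Cons.IH[OF xy(5,6)] by (simp add: iso_rep_lact[OF T] iso_rep_cinner[OF T])
qed auto

text \<open>The first letter is treated apart, without an accumulator 1, because the unit need not
  act trivially from the left.\<close>

lemma word_op_ip:
  assumes \<rho>: "algebra_rep \<rho>" and Ts: "iso_reps \<rho> Fs Ts"
    and xs: "list_all2 (\<lambda>F x. x \<in> mcar F) Fs xs" and ys: "list_all2 (\<lambda>F x. x \<in> mcar F) Fs ys"
  shows "cinner (word_op Ts xs h) (word_op Ts ys g) = cinner h (\<rho> (word_ip Fs xs ys) g)"
proof (cases Fs)
  case Nil
  then show ?thesis using Ts xs ys by (simp add: rep_one[OF \<rho>])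
next
  case (Cons F Fs')
  obtain T Ts' where T: "Ts = T # Ts'" "iso_rep F T \<rho>" 
    "iso_reps \<rho> Fs' Ts'"
    using Ts Cons by (auto simp: list_all2_Cons1)
  obtain x xs' y ys' where xy: "xs = x # xs'" "ys = y # ys'" "x \<in> mcar F" "y \<in> mcar F"
    "list_all2 (\<lambda>F x. x \<in> mcar F) Fs' xs'" "list_all2 (\<lambda>F x. x \<in> mcar F) Fs' ys'"
    using xs ys Cons by (auto simp: list_all2_Cons1)
  show ?thesis
    using xy T Cons by (simp add: iso_rep_cinner[OF T(2)] word_op_ip_from[OF \<rho> T(3) xy(5,6)])
qed

text \<open>Both \<open>F\<^sub>1 \<otimes> \<dots> \<otimes> F\<^sub>m \<otimes>\<^sub>\<sigma> V\<close> and (for \<open>J\<close> the identity)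
  \<open>F\<^sub>1 \<otimes> \<dots> \<otimes> F\<^sub>m \<otimes>\<^sub>\<rho> H\<close> are modelled by subspaces of \<open>H\<close>, using isometric representations on \<open>H\<close>.\<close>

definition intertwining ::
  "('a::cstar_algebra \<Rightarrow> 'v::chilbert_space \<Rightarrow> 'v) \<Rightarrow> ('a \<Rightarrow> 'h::chilbert_space \<Rightarrow> 'h) \<Rightarrow> ('v \<Rightarrow> 'h) \<Rightarrow> bool"
  where
  "intertwining \<sigma> \<rho> J \<longleftrightarrow> algebra_rep \<rho> \<and> isometric_embedding J \<and> (\<forall>a v. \<rho> a (J v) = J (\<sigma> a v))"

lemma intertwining_id: "algebra_rep \<rho> \<Longrightarrow> intertwining \<rho> \<rho> (\<lambda>h. h)"
  using bounded_op_wholeI[of "\<lambda>h. h" 1] by (simp add: intertwining_def isometric_embedding_def)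

definition wvec :: "('e \<Rightarrow> 'h \<Rightarrow> 'h) list \<Rightarrow> ('v \<Rightarrow> 'h) \<Rightarrow> 'e list \<times> 'v \<Rightarrow> 'h" where
  "wvec Ts J = (\<lambda>(xs, v). word_op Ts xs (J v))"

definition wspace ::
  "('a, 'e) corr list \<Rightarrow> ('e \<Rightarrow> 'h \<Rightarrow> 'h) list \<Rightarrow> ('v \<Rightarrow> 'h) \<Rightarrow> 'h::chilbert_space set" where
  "wspace Fs Ts J = closed_span (wvec Ts J ` words Fs)"

definition wcoord ::
  "('a, 'e) corr list \<Rightarrow> ('e \<Rightarrow> 'h \<Rightarrow> 'h) list \<Rightarrow> ('v \<Rightarrow> 'h) \<Rightarrow> 'h::chilbert_space \<Rightarrow>
    'e list \<times> 'v \<Rightarrow> complex" where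
  "wcoord Fs Ts J = coord (words Fs) (wvec Ts J)"

lemma wvec_in_wspace: "w \<in> words Fs \<Longrightarrow> wvec Ts J w \<in> wspace Fs Ts J"
  unfolding wspace_def by (intro subsetD[OF closed_span_superset] imageI)

context
  fixes Fs :: "('a::cstar_algebra, 'e) corr list" and Ts :: "('e \<Rightarrow> 'h::chilbert_space \<Rightarrow> 'h) list"
    and \<rho> :: "'a \<Rightarrow> 'h \<Rightarrow> 'h" and \<sigma> :: "'a \<Rightarrow> 'v::chilbert_space \<Rightarrow> 'v" and J :: "'v \<Rightarrow> 'h"
  assumes J: "intertwining \<sigma> \<rho> J"
    and Ts: "iso_reps \<rho> Fs Ts"
begin

lemma word_kernel_eq:
  assumes "w \<in> words Fs" "w' \<in> words Fs"
  shows "word_kernel Fs \<sigma> w w' = cinner (wvec Ts J w) (wvec Ts J w')"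
proof -
  have "algebra_rep \<rho>" using J by (simp add: intertwining_def)
  from word_op_ip[OF this Ts] show ?thesis
    using assms J by (auto simp: words_def word_kernel_def wvec_def intertwining_def isometric_embedding_def)
qed

lemma realises_tensor: "realises (tensor Fs \<sigma>) (wspace Fs Ts J) (wcoord Fs Ts J)"
  unfolding tensor_def wspace_def wcoord_def by (rule realises_completion) (rule word_kernel_eq)

lemma elem_eq: "w \<in> words Fs \<Longrightarrow> elem Fs \<sigma> w = wcoord Fs Ts J (wvec Ts J w)"
  by (auto simp: elem_def wcoord_def coord_def word_kernel_eq)

end

text \<open>The uniform way of computing an operator prescribed on words: find a bounded
  \<open>B\<close> on the whole space \<open>H\<close> with the right values on the model
  vectors.\<close>

lemma ext_op_tensor:
  fixes Fs :: "('a::cstar_algebra, 'e) corr list" and Y :: "'y hspace" and N :: "'k::chilbert_space set"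
  assumes J: "intertwining \<sigma> \<rho> J"
    and Ts: "iso_reps \<rho> Fs Ts"
    and Y: "realises Y N V"
    and B: "bounded_op whole whole B" "\<And>x. x \<in> wspace Fs Ts J \<Longrightarrow> B x \<in> N"
    and t: "\<And>w. w \<in> words Fs \<Longrightarrow> t w = V (B (wvec Ts J w))"
    and x: "x \<in> wspace Fs Ts J"
  shows "ext_op (tensor Fs \<sigma>) Y (words Fs) (elem Fs \<sigma>) t (wcoord Fs Ts J x) = V (B x)"
proof -
  obtain K where K: "\<And>x. norm (B x) \<le> K * norm x" using B(1) by (auto simp: bounded_op_def)
  show ?thesis
  proof (rule ext_op_realises[OF realises_tensor[OF J Ts] Y, where d="wvec Ts J" and K=K])
    show "closed_span (wvec Ts J ` words Fs) = wspace Fs Ts J" by (simp add: wspace_def)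
  qed (use B K t x in \<open>auto simp: elem_eq[OF J Ts] bounded_op_def\<close>)
qed

lemma bounded_op_id: "bounded_op whole whole (\<lambda>h::'h::chilbert_space. h)"
  by (rule bounded_op_wholeI[of _ 1]) auto

lemma wspace_mono:
  fixes Fs :: "('a, 'e) corr list" and J :: "'v \<Rightarrow> 'h::chilbert_space"
  shows "wspace Fs Ts J \<subseteq> wspace Fs Ts (\<lambda>h. h)"
  unfolding wspace_def
proof (rule closed_span_mono, rule image_subsetI)
  fix w :: "'e list \<times> 'v" assume "w \<in> words Fs"
  then have "wvec Ts J w = wvec Ts (\<lambda>h. h) (fst w, J (snd w))" "(fst w, J (snd w)) \<in> words Fs"
    by (auto simp: wvec_def words_def)
  then show "wvec Ts J w \<in> wvec Ts (\<lambda>h. h) ` words Fs" by blast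
qed

text \<open>A word ending in \<open>v\<close> and its image ending in \<open>J v\<close> have the
  same model vector, so amplification by \<open>J\<close> is an inclusion of subspaces of
  \<open>H\<close>.\<close>

lemma amplify_wcoord:
  fixes Fs :: "('a::cstar_algebra, 'e) corr list" and J :: "'v::chilbert_space \<Rightarrow> 'h::chilbert_space"
  assumes J: "intertwining \<sigma> \<rho> J"
    and Ts: "iso_reps \<rho> Fs Ts"
    and x: "x \<in> wspace Fs Ts J"
  shows "amplify Fs \<sigma> \<rho> J (wcoord Fs Ts J x) = wcoord Fs Ts (\<lambda>h. h) x"
proof -
  have I: "intertwining \<rho> \<rho> (\<lambda>h. h)" using J by (intro intertwining_id) (simp add: intertwining_def)
  show ?thesis
    unfolding amplify_def
  proof (rule ext_op_tensor[OF J Ts realises_tensor[OF I Ts] bounded_op_id _ _ x])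
    fix w :: "'e list \<times> 'v" assume "w \<in> words Fs"
    then have "(fst w, J (snd w)) \<in> words Fs" by (auto simp: words_def)
    from elem_eq[OF I Ts this]
    show "(\<lambda>(xs, v). elem Fs \<rho> (xs, J v)) w = wcoord Fs Ts (\<lambda>h. h) (wvec Ts J w)"
      by (simp add: wvec_def split_def)
  qed (use wspace_mono in blast)
qed

lemma words_replicate: "words (replicate m F) = {(xs, h). length xs = m \<and> set xs \<subseteq> mcar F}"
  by (fastforce simp: words_def list_all2_conv_all_nth in_set_conv_nth subset_iff)

lemma wvec_replicate:
  "w \<in> words (replicate m F) \<Longrightarrow> wvec (replicate m T) J w = foldr T (fst w) (J (snd w))"
  by (auto simp: words_replicate wvec_def word_op_replicate)

lemma list_all2_replicate:
  "P F T \<Longrightarrow> list_all2 P (replicate m F) (replicate m T)"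
  by (simp add: list_all2_conv_all_nth)

lemma tilde_pow_wcoord:
  assumes \<rho>: "algebra_rep \<rho>" and F: "correspondence F" and T: "iso_rep F T \<rho>"
    and x: "x \<in> wspace (replicate m F) (replicate m T) (\<lambda>h. h)"
  shows "tilde_pow F T \<rho> m (wcoord (replicate m F) (replicate m T) (\<lambda>h. h) x) = x"
  unfolding tilde_pow_def
  by (rule ext_op_tensor[OF intertwining_id[OF \<rho>] list_all2_replicate realises_whole bounded_op_id _ _ x])
    (use F T in \<open>auto simp: wvec_replicate\<close>)

text \<open>In the models the amplification is an inclusion and the tilde operator of an isometric
  representation returns the vector itself, so the image is the model subspace.\<close>

lemma tilde_pow_amplify_image:
  assumes J: "intertwining \<sigma> \<rho> J" and F: "correspondence F" and T: "iso_rep F T \<rho>"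
  shows "tilde_pow F T \<rho> m ` amplify (replicate m F) \<sigma> \<rho> J ` hcar (tensor (replicate m F) \<sigma>)
    = closed_span {foldr T xs (J v) |xs v. length xs = m \<and> set xs \<subseteq> mcar F}"
proof -
  let ?Fs = "replicate m F" and ?Ts = "replicate m T"
  have \<rho>: "algebra_rep \<rho>" using J by (simp add: intertwining_def)
  have Ts: "iso_reps \<rho> ?Fs ?Ts"
    using F T by (intro list_all2_replicate) simp
  have "tilde_pow F T \<rho> m ` amplify ?Fs \<sigma> \<rho> J ` hcar (tensor ?Fs \<sigma>)
    = (\<lambda>x. tilde_pow F T \<rho> m (amplify ?Fs \<sigma> \<rho> J (wcoord ?Fs ?Ts J x))) ` wspace ?Fs ?Ts J"
    unfolding realisesD(4)[OF realises_tensor[OF J Ts]] image_image ..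
  also have "\<dots> = (\<lambda>x. x) ` wspace ?Fs ?Ts J"
  proof (rule image_cong[OF refl])
    fix x assume x: "x \<in> wspace ?Fs ?Ts J"
    then have x': "x \<in> wspace ?Fs ?Ts (\<lambda>h. h)" using wspace_mono by blast
    show "tilde_pow F T \<rho> m (amplify ?Fs \<sigma> \<rho> J (wcoord ?Fs ?Ts J x)) = x"
      unfolding amplify_wcoord[OF J Ts x] by (rule tilde_pow_wcoord[OF \<rho> F T x'])
  qed
  also have "\<dots> = closed_span {foldr T xs (J v) |xs v. length xs = m \<and> set xs \<subseteq> mcar F}"
  proof -
    have "wvec ?Ts J ` words ?Fs = (\<lambda>w. foldr T (fst w) (J (snd w))) ` words ?Fs"
      by (rule image_cong[OF refl]) (rule wvec_replicate)
    also have "\<dots> = {foldr T xs (J v) |xs v. length xs = m \<and> set xs \<subseteq> mcar F}"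
      unfolding words_replicate by force
    finally show ?thesis by (simp add: wspace_def)
  qed
  finally show ?thesis .
qed

lemma closed_span_Union_closed_span:
  "closed_span (\<Union>i\<in>I. closed_span (S i)) = closed_span (\<Union>i\<in>I. S i)"
proof (rule subset_antisym)
  have "closed_span (S i) \<subseteq> closed_span (\<Union>i\<in>I. S i)" if "i \<in> I" for i
    using that by (intro closed_span_mono) blast
  then show "closed_span (\<Union>i\<in>I. closed_span (S i)) \<subseteq> closed_span (\<Union>i\<in>I. S i)"
    by (intro closed_span_minimal) auto
  have "S i \<subseteq> (\<Union>i\<in>I. closed_span (S i))" if "i \<in> I" for i
    using that closed_span_superset[of "S i"] by blast
  then show "closed_span (\<Union>i\<in>I. S i) \<subseteq> closed_span (\<Union>i\<in>I. closed_span (S i))"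
    by (intro closed_span_mono) blast
qed

section \<open>Dilations\<close>

lemma cinner_adj_embedding:
  assumes "isometric_embedding J"
  shows "cinner v (adj whole whole J h) = cinner (J v) h"
  using assms by (intro cinner_adj) (simp add: isometric_embedding_def)

lemma adj_embedding [simp]:
  assumes "isometric_embedding J"
  shows "adj whole whole J (J v) = v"
  by (rule cinner_eqI) (use assms in \<open>simp add: cinner_adj_embedding isometric_embedding_def\<close>)

lemma norm_adj_embedding_le:
  assumes J: "isometric_embedding J"
  shows "norm (adj whole whole J x) \<le> norm x"
proof -
  let ?Js = "adj whole whole J"
  have "complex_of_real ((norm (?Js x))\<^sup>2) = cinner (J (?Js x)) x"
    unfolding cinner_self[symmetric] by (rule cinner_adj_embedding[OF J])
  then have "cmod (complex_of_real ((norm (?Js x))\<^sup>2)) \<le> norm (?Js x) * norm x"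
    using cinner_Cauchy_Schwarz[of "J (?Js x)" x] by (simp add: norm_isometric[OF J])
  then have "norm (?Js x) * norm (?Js x) \<le> norm (?Js x) * norm x"
    by (simp only: norm_of_real abs_power2) (simp only: power2_eq_square)
  then show ?thesis
    by (cases "norm (?Js x) = 0") auto
qed

lemma bounded_op_adj_embedding:
  assumes J: "isometric_embedding J"
  shows "bounded_op whole whole (adj whole whole J)"
proof (rule bounded_op_wholeI[of _ 1])
  let ?Js = "adj whole whole J"
  show "?Js (x + y) = ?Js x + ?Js y" for x y
    by (rule cinner_eqI) (simp add: cinner_adj_embedding[OF J] cinner_add_right)
  show "?Js (c *\<^sub>C x) = c *\<^sub>C ?Js x" for c x
    by (rule cinner_eqI) (simp add: cinner_adj_embedding[OF J] cinner_scaleC_right)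
qed (simp add: norm_adj_embedding_le[OF J])

lemma mem_orth_range_iff:
  assumes J: "isometric_embedding J"
  shows "h \<in> orth (range J) \<longleftrightarrow> adj whole whole J h = 0"
proof -
  have "h \<in> orth (range J) \<longleftrightarrow> (\<forall>v. cinner v (adj whole whole J h) = 0)"
    by (simp add: orth_def cinner_adj_embedding[OF J])
  then show ?thesis by (metis cinner_self_eq_0_iff cinner_zero_right)
qed

lemma adj_diff_projection:
  assumes J: "isometric_embedding J"
  shows "h - J (adj whole whole J h) \<in> orth (range J)"
  using J by (auto simp: orth_def cinner_diff_right isometric_embedding_def cinner_adj_embedding[OF J])

lemma orth_proj_range:
  assumes J: "isometric_embedding J"
  shows "orth_proj (range J) h = J (adj whole whole J h)"
  by (intro orth_proj_unique csubspace_range_isometric[OF J] adj_diff_projection[OF J]) simp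

lemma intertwining_adj:
  assumes J: "intertwining \<sigma> \<rho> J" and \<sigma>: "algebra_rep \<sigma>"
  shows "adj whole whole J (\<rho> a h) = \<sigma> a (adj whole whole J h)"
proof (rule cinner_eqI)
  fix z
  have \<rho>: "algebra_rep \<rho>" and iJ: "isometric_embedding J" and i: "\<rho> (star a) (J z) = J (\<sigma> (star a) z)"
    using J by (auto simp: intertwining_def)
  have "cinner z (adj whole whole J (\<rho> a h)) = cinner (\<rho> (star a) (J z)) h"
    by (simp add: cinner_adj_embedding[OF iJ] rep_adjoint[OF \<rho>] star_star)
  also have "\<dots> = cinner (\<sigma> (star a) z) (adj whole whole J h)"
    by (simp add: i cinner_adj_embedding[OF iJ])
  also have "\<dots> = cinner z (\<sigma> a (adj whole whole J h))"
    by (simp add: rep_adjoint[OF \<sigma>] star_star)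
  finally show "cinner z (adj whole whole J (\<rho> a h)) = cinner z (\<sigma> a (adj whole whole J h))" .
qed

lemma isometric_imp_iso_rep:
  assumes F: "correspondence F" and S: "representation F S \<rho>" and iso: "isometric F S \<rho>"
  shows "iso_rep F S \<rho>"
proof -
  interpret correspond F using F by (rule correspondI)
  have \<rho>: "algebra_rep \<rho>" using S by (simp add: representation_def)
  have b: "bounded_op whole whole (S x)" if "x \<in> mcar F" for x
    using S that by (simp add: representation_def)
  have "\<rho> a (S x h) = S (lact F a x) h" if "x \<in> mcar F" for x a h
  proof -
    have "S (lact F a (ract F x 1)) h = \<rho> a (S x (\<rho> 1 h))"
      using S that unfolding representation_def by blast
    then show ?thesis using that by (simp add: rep_one[OF \<rho>])
  qed
  moreover have "cinner (S x h) (S y g) = cinner h (\<rho> (mip F x y) g)"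
    if "x \<in> mcar F" "y \<in> mcar F" for x y h g
    using iso that cinner_adj[OF b[OF that(1)], of h "S y g"] by (simp add: isometric_def)
  ultimately show ?thesis by (simp add: iso_rep_def)
qed

lemma (in iso_representation) representation_T: "representation F T \<rho>"
  using \<rho> T_bounded_op T_madd T_mscale T_completely_contractive
  by (simp add: representation_def T_ract iso_rep_lact[OF T, symmetric])

lemma (in iso_representation) isometric_T: "isometric F T \<rho>"
  unfolding isometric_def by (intro ballI allI adj_whole) (simp add: ip)

text \<open>The last clause is the working form of a dilation: the adjoint of \<open>J\<close>
  intertwines \<open>S x\<close> with \<open>A x\<close>. Split \<open>h\<close> into its part in
  \<open>range J\<close> and its orthogonal part; \<open>S x\<close> keeps the latter orthogonal,
  and the adjoint of \<open>J\<close> annihilates it.\<close>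

lemma dilatesD:
  assumes "dilates F A \<sigma> J S \<rho>"
  shows dilates_representation: "representation F A \<sigma>" "representation F S \<rho>"
    and dilates_embedding: "isometric_embedding J"
    and dilates_intertwining: "intertwining \<sigma> \<rho> J"
    and dilates_adj: "x \<in> mcar F \<Longrightarrow> adj whole whole J (S x h) = A x (adj whole whole J h)"
proof -
  show A: "representation F A \<sigma>" and S: "representation F S \<rho>" and J: "isometric_embedding J"
    using assms by (auto simp: dilates_def)
  then show "intertwining \<sigma> \<rho> J"
    using assms by (simp add: dilates_def intertwining_def representation_def)
  assume x: "x \<in> mcar F"
  let ?Js = "adj whole whole J"
  interpret Js: bounded_linear ?Js by (rule bounded_op_whole(1)[OF bounded_op_adj_embedding[OF J]])
  have "S x (h - J (?Js h)) \<in> orth (range J)"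
    using assms x adj_diff_projection[OF J, of h] by (auto simp: dilates_def image_subset_iff)
  then have "?Js (S x (h - J (?Js h))) = 0" by (simp add: mem_orth_range_iff[OF J])
  moreover have "S x (h - J (?Js h)) = S x h - S x (J (?Js h))"
  proof -
    have "bounded_op whole whole (S x)" using S x by (simp add: representation_def)
    then show ?thesis using bounded_op_whole(1) linear_diff bounded_linear.linear by blast
  qed
  ultimately have eq: "?Js (S x h) = ?Js (S x (J (?Js h)))" by (simp add: Js.diff)
  have "orth_proj (range J) (S x (J (?Js h))) = J (A x (?Js h))"
    using assms x by (simp add: dilates_def)
  then have "?Js (J (?Js (S x (J (?Js h))))) = ?Js (J (A x (?Js h)))"
    by (simp add: orth_proj_range[OF J])
  then have "?Js (S x (J (?Js h))) = A x (?Js h)" by (simp add: J)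
  then show "?Js (S x h) = A x (?Js h)" by (simp add: eq)
qed

text \<open>Since the orthogonal complement of \<open>range J\<close> is the kernel of the adjoint
  of \<open>J\<close>, the single relation \<open>adj\<close> yields both its invariance and the
  compression formula.\<close>

lemma dilatesI:
  assumes A: "representation F A \<sigma>" and S: "representation F S \<rho>" and J: "intertwining \<sigma> \<rho> J"
    and adj: "\<And>x h. x \<in> mcar F \<Longrightarrow> adj whole whole J (S x h) = A x (adj whole whole J h)"
  shows "dilates F A \<sigma> J S \<rho>"
proof -
  have iJ: "isometric_embedding J" and i: "\<And>a v. \<rho> a (J v) = J (\<sigma> a v)"
    using J by (auto simp: intertwining_def)
  have \<sigma>: "algebra_rep \<sigma>" using A by (simp add: representation_def)
  have A0: "A x 0 = 0" if "x \<in> mcar F" for x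
  proof -
    have "bounded_op whole whole (A x)" using A that by (simp add: representation_def)
    then show ?thesis using bounded_op_whole(1) linear_0 bounded_linear.linear by blast
  qed
  have "\<rho> a ` range J \<subseteq> range J" for a by (auto simp: i)
  moreover have "\<rho> a ` orth (range J) \<subseteq> orth (range J)" for a
    using \<sigma> by (auto simp: mem_orth_range_iff[OF iJ] intertwining_adj[OF J \<sigma>])
  moreover have "S x ` orth (range J) \<subseteq> orth (range J)" if "x \<in> mcar F" for x
    using that by (auto simp: mem_orth_range_iff[OF iJ] adj A0)
  moreover have "orth_proj (range J) (S x (J v)) = J (A x v)" if "x \<in> mcar F" for x v
    using that iJ by (simp add: orth_proj_range[OF iJ] adj)
  ultimately show ?thesis using A S iJ i by (simp add: dilates_def)
qed

text \<open>\<open>\<tilde>A\<close> is the restriction of \<open>J\<^sup>*\<close> to the closed span of \<open>S(F) V\<close>, so that \<open>\<tilde>A\<tilde>A\<^sup>*\<close> is the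
  compression to \<open>V\<close> of the projection onto that closed span.\<close>

lemma fully_coisometric_range:
  fixes F :: "('a::cstar_algebra, 'e) corr" and J :: "'v::chilbert_space \<Rightarrow> 'h::chilbert_space"
  assumes F: "correspondence F" and S: "iso_rep F S \<rho>" and dil: "dilates F A \<sigma> J S \<rho>"
    and co: "fully_coisometric F A \<sigma>"
  shows "J v \<in> closed_span {S x (J u) |x u. x \<in> mcar F}"
proof -
  let ?Js = "adj whole whole J" and ?M = "wspace [F] [S] J" and ?U = "wcoord [F] [S] J"
  note J = dilates_embedding[OF dil] and iJ = dilates_intertwining[OF dil]
  have Ts: "iso_reps \<rho> [F] [S]" using F S by simp
  have M: "?M = closed_span {S x (J u) |x u. x \<in> mcar F}"
  proof -
    have "wvec [S] J ` words [F] = {S x (J u) |x u. x \<in> mcar F}"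
      by (force simp: words_def wvec_def list_all2_Cons1)
    then show ?thesis by (simp add: wspace_def)
  qed
  have tilde: "tilde F A \<sigma> (?U x) = ?Js x" if "x \<in> ?M" for x
    unfolding tilde_def
  proof (rule ext_op_tensor[OF iJ Ts realises_whole bounded_op_adj_embedding[OF J] _ _ that])
    fix w :: "'e list \<times> 'v" assume "w \<in> words [F]"
    then obtain x u where "w = ([x], u)" "x \<in> mcar F" by (auto simp: words_def list_all2_Cons1)
    then show "(\<lambda>(xs, h). A (hd xs) h) w = ?Js (wvec [S] J w)"
      by (simp add: wvec_def dilates_adj[OF dil] J)
  qed simp
  have sM: "csubspace ?M" "closed ?M" unfolding M by auto
  obtain p where p: "p \<in> ?M" "\<And>z. z \<in> ?M \<Longrightarrow> cinner z (J v - p) = 0"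
    using projection_exists[OF sM, of "J v"] by blast
  have adj: "adj (tensor [F] \<sigma>) whole (tilde F A \<sigma>) v = ?U p"
  proof (rule adj_realises[OF realises_tensor[OF iJ Ts] p(1)])
    fix z assume z: "z \<in> ?M"
    have "cinner z p = cinner z (J v)" using p(2)[OF z] by (simp add: cinner_diff_right)
    also have "\<dots> = cnj (cinner v (?Js z))"
      using cinner_adj_embedding[OF J, of v z] cinner_commute[of z "J v"] by simp
    finally show "cinner z p = cinner (tilde F A \<sigma> (?U z)) v"
      using cinner_commute[of "?Js z" v] by (simp add: tilde[OF z])
  qed
  have "tilde F A \<sigma> (adj (tensor [F] \<sigma>) whole (tilde F A \<sigma>) v) = v"
    using co by (simp add: fully_coisometric_def)
  then have Jsp: "?Js p = v" unfolding adj tilde[OF p(1)] .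
  \<comment> \<open>As \<open>p\<close> is the projection of \<open>J v\<close>, this squared
    distance reduces to \<open>cinner (J v) (J v) - cinner (J v) p\<close>; coisometry, in the form
    \<open>?Js p = v\<close>, makes both terms equal to \<open>cinner v v\<close>.\<close>
  have "cinner (J v - p) (J v - p) = cinner (J v) (J v - p) - cinner p (J v - p)"
    by (simp add: cinner_diff_left)
  also have "\<dots> = cinner (J v) (J v) - cinner (J v) p"
    using p by (simp add: cinner_diff_right)
  also have "\<dots> = 0"
    using J by (simp add: cinner_adj_embedding[OF J, symmetric] Jsp)
  finally show ?thesis using p(1) unfolding M by simp
qed

text \<open>Equal Gram matrices define the same Hausdorff completion \<open>X\<close>, and each
  total family realises \<open>X\<close> on its whole space; \<open>W\<close> goes through
  \<open>X\<close>.\<close>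

lemma unitary_of_gram:
  fixes e :: "'i \<Rightarrow> 'h::chilbert_space" and f :: "'i \<Rightarrow> 'k::chilbert_space"
  assumes gram: "\<And>i j. i \<in> I \<Longrightarrow> j \<in> I \<Longrightarrow> cinner (e i) (e j) = cinner (f i) (f j)"
    and e: "closed_span (e ` I) = UNIV" and f: "closed_span (f ` I) = UNIV"
  obtains W where "isometric_embedding W" "surj W" "\<And>i. i \<in> I \<Longrightarrow> W (e i) = f i"
proof -
  define X where "X = hausdorff_completion I (\<lambda>i j. cinner (e i) (e j))"
  let ?U = "coord I e" and ?V = "coord I f"
  have U: "realises X UNIV ?U"
    using realises_completion[of I "\<lambda>i j. cinner (e i) (e j)" e] by (simp add: X_def e)
  have V: "realises X UNIV ?V"
    using realises_completion[of I "\<lambda>i j. cinner (e i) (e j)" f] gram by (simp add: X_def f)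
  define W where "W x = inv_into UNIV ?V (?U x)" for x
  have VW: "?V (W x) = ?U x" for x
    unfolding W_def by (rule realisesD(11)[OF V]) (simp add: realisesD(3)[OF U])
  have inj: "x = y" if "?V x = ?V y" for x y
    using that realisesD(9)[OF V, of x y] by simp
  have ip: "cinner (W x) (W y) = cinner x y" for x y
    using realisesD(6)[OF V, of "W x" "W y"] realisesD(6)[OF U, of x y] by (simp add: VW)
  have "bounded_op whole whole W"
  proof (rule bounded_op_wholeI[of _ 1])
    show "W (x + y) = W x + W y" for x y
      using realisesD(5)[OF V, of "W x" "W y"] realisesD(5)[OF U, of x y] by (intro inj) (simp add: VW)
    show "W (c *\<^sub>C x) = c *\<^sub>C W x" for c x
      using realisesD(7)[OF V, of "W x" c] realisesD(7)[OF U, of x c] by (intro inj) (simp add: VW)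
    show "norm (W x) \<le> 1 * norm x" for x
      by (simp add: norm_eq_sqrt_cinner ip)
  qed
  then have "isometric_embedding W" using ip by (simp add: isometric_embedding_def)
  moreover have "surj W"
  proof (rule surjI)
    fix y
    have "?V y \<in> hcar X" by (rule realisesD(3)[OF V]) simp
    then have "?U (inv_into UNIV ?U (?V y)) = ?V y" by (rule realisesD(11)[OF U])
    then show "W (inv_into UNIV ?U (?V y)) = y" by (intro inj) (simp add: VW)
  qed
  moreover have "W (e i) = f i" if "i \<in> I" for i
    by (rule inj, unfold VW) (use that in \<open>auto simp: coord_def gram\<close>)
  ultimately show thesis using that by blast
qed

text \<open>Isometry strips one letter from each word at a time until one word is empty. What is
  left is the inner product of \<open>J v\<close> with a word vector, and the adjoint of
  \<open>J\<close> turns \<open>S\<close> there into \<open>A\<close>.\<close>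

lemma dilation_gram_unique:
  assumes F: "correspondence F"
    and S: "iso_rep F S \<rho>" "dilates F A \<sigma> J S \<rho>" and S': "iso_rep F S' \<rho>'" "dilates F A \<sigma> J' S' \<rho>'"
    and xs: "set xs \<subseteq> mcar F" and ys: "set ys \<subseteq> mcar F"
  shows "cinner (foldr S xs (J v)) (foldr S ys (J w)) = cinner (foldr S' xs (J' v)) (foldr S' ys (J' w))"
proof -
  interpret correspond F using F by (rule correspondI)
  note J = dilates_embedding[OF S(2)] and J' = dilates_embedding[OF S'(2)]
  have i: "\<rho> a (J v) = J (\<sigma> a v)" "\<rho>' a (J' v) = J' (\<sigma> a v)" for a v
    using dilates_intertwining[OF S(2)] dilates_intertwining[OF S'(2)] by (auto simp: intertwining_def)
  have compress: "adj whole whole J (foldr S ys (J w)) = foldr A ys w"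
    "adj whole whole J' (foldr S' ys (J' w)) = foldr A ys w" if "set ys \<subseteq> mcar F" for ys w
    using that by (induction ys) (auto simp: J J' dilates_adj[OF S(2)] dilates_adj[OF S'(2)])
  have base: "cinner (J v) (foldr S ys (J w)) = cinner (J' v) (foldr S' ys (J' w))"
    if "set ys \<subseteq> mcar F" for v ys w
    using that by (simp add: compress flip: cinner_adj_embedding[OF J] cinner_adj_embedding[OF J'])
  show ?thesis
    using xs ys
  proof (induction xs arbitrary: ys w)
    case Nil
    then show ?case by (simp add: base)
  next
    case (Cons x xs)
    then have x: "x \<in> mcar F" and xs: "set xs \<subseteq> mcar F" by auto
    show ?case
    proof (cases ys)
      case Nil
      then show ?thesis
        using base[OF Cons.prems(1), of w v] by (metis cinner_commute foldr_Nil id_apply)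
    next
      case (Cons y ys')
      then have y: "y \<in> mcar F" and ys': "set ys' \<subseteq> mcar F" using Cons.prems by auto
      let ?a = "mip F x y"
      \<comment> \<open>The coefficient produced by stripping acts on the end vector if no letter
        remains, and otherwise merges with the next letter; either way it is a word covered by the
        induction hypothesis.\<close>
      have "cinner (foldr S xs (J v)) (\<rho> ?a (foldr S ys' (J w)))
        = cinner (foldr S' xs (J' v)) (\<rho>' ?a (foldr S' ys' (J' w)))"
      proof (cases ys')
        case Nil
        then show ?thesis using Cons.IH[OF xs, of "[]" "\<sigma> ?a w"] by (simp add: i)
      next
        case (Cons z zs)
        then have z: "z \<in> mcar F" and zs: "set zs \<subseteq> mcar F" using ys' by auto
        then show ?thesis
          using Cons.IH[OF xs, of "lact F ?a z # zs" w] Cons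
          by (simp add: iso_rep_lact[OF S(1)] iso_rep_lact[OF S'(1)])
      qed
      then show ?thesis
        using Cons x y by (simp add: iso_rep_cinner[OF S(1)] iso_rep_cinner[OF S'(1)])
    qed
  qed
qed

lemma eq_on_total:
  fixes f g :: "'h::chilbert_space \<Rightarrow> 'k::chilbert_space"
  assumes f: "bounded_op whole whole f" and g: "bounded_op whole whole g"
    and S: "closed_span S = UNIV" and eq: "\<And>x. x \<in> S \<Longrightarrow> f x = g x"
  shows "f x = g x"
proof -
  obtain K L where KL: "\<And>x. norm (f x) \<le> K * norm x" "\<And>x. norm (g x) \<le> L * norm x"
    using f g by (auto simp: bounded_op_def)
  have "f x - g x = 0"
  proof (rule zero_on_closed_span[OF S, where K="K + L"])
    show "norm (f x - g x) \<le> (K + L) * norm x" for x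
      using norm_triangle_ineq4[of "f x" "g x"] KL[of x] by (simp add: distrib_right)
  qed (use f g eq in \<open>auto simp: bounded_op_def scaleC_diff_right\<close>)
  then show ?thesis by simp
qed

lemma bounded_op_compose:
  assumes "bounded_op whole whole f" "bounded_op whole whole g"
  shows "bounded_op whole whole (\<lambda>x. f (g x))"
proof -
  interpret f: bounded_linear f by (rule bounded_op_whole(1)[OF assms(1)])
  interpret g: bounded_linear g by (rule bounded_op_whole(1)[OF assms(2)])
  interpret fg: bounded_linear "\<lambda>x. f (g x)"
    using bounded_linear_compose[OF f.bounded_linear_axioms g.bounded_linear_axioms] .
  obtain K where "\<And>x. norm (f (g x)) \<le> norm x * K" using fg.bounded by blast
  then show ?thesis
    by (intro bounded_op_wholeI[of _ K])
      (simp_all add: fg.add bounded_op_whole(2)[OF assms(1)] bounded_op_whole(2)[OF assms(2)] mult.commute)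
qed

lemma minimal_isometric_dilationD:
  assumes F: "correspondence F" and min: "minimal_isometric_dilation F A \<sigma> J S \<rho>"
  shows minimal_dilates: "dilates F A \<sigma> J S \<rho>" and minimal_iso_rep: "iso_rep F S \<rho>"
    and minimal_total: "closed_span {foldr S xs (J v) |xs v. set xs \<subseteq> mcar F} = UNIV"
proof -
  show dil: "dilates F A \<sigma> J S \<rho>" using min by (simp add: minimal_isometric_dilation_def)
  show S: "iso_rep F S \<rho>"
    using F dilates_representation(2)[OF dil] min
    by (intro isometric_imp_iso_rep) (auto simp: minimal_isometric_dilation_def)
  have "closed_span (\<Union>m. closed_span {foldr S xs (J v) |xs v. length xs = m \<and> set xs \<subseteq> mcar F}) = UNIV"
    using min tilde_pow_amplify_image[OF dilates_intertwining[OF dil] F S]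
    by (simp add: minimal_isometric_dilation_def)
  moreover have "(\<Union>m. {foldr S xs (J v) |xs v. length xs = m \<and> set xs \<subseteq> mcar F})
    = {foldr S xs (J v) |xs v. set xs \<subseteq> mcar F}" by blast
  ultimately show "closed_span {foldr S xs (J v) |xs v. set xs \<subseteq> mcar F} = UNIV"
    by (simp add: closed_span_Union_closed_span)
qed

text \<open>The unitary comes from the equal Gram matrices. Intertwining is checked on word vectors,
  where \<open>S x\<close> adds a letter and \<open>\<rho> a\<close> changes the first letter or, on
  the empty word, the end vector.\<close>

lemma minimal_isometric_dilation_unique:
  fixes F :: "('a::cstar_algebra, 'e) corr" and J :: "'v::chilbert_space \<Rightarrow> 'h::chilbert_space"
    and J' :: "'v \<Rightarrow> 'k::chilbert_space"
  assumes F: "correspondence F"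
    and S: "minimal_isometric_dilation F A \<sigma> J S \<rho>"
    and S': "minimal_isometric_dilation F A \<sigma> J' S' \<rho>'"
  shows "equivalent_dilations F J S \<rho> J' S' \<rho>'"
proof -
  interpret correspond F using F by (rule correspondI)
  note dil = minimal_dilates[OF F S] minimal_dilates[OF F S']
  note iso = minimal_iso_rep[OF F S] minimal_iso_rep[OF F S']
  let ?I = "{(xs, v). set xs \<subseteq> mcar F}"
  let ?e = "\<lambda>(xs, v). foldr S xs (J v)" and ?f = "\<lambda>(xs, v). foldr S' xs (J' v)"
  have "?e ` ?I = {foldr S xs (J v) |xs v. set xs \<subseteq> mcar F}" by auto
  with minimal_total[OF F S] have e: "closed_span (?e ` ?I) = UNIV" by simp
  have "?f ` ?I = {foldr S' xs (J' v) |xs v. set xs \<subseteq> mcar F}" by auto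
  with minimal_total[OF F S'] have f: "closed_span (?f ` ?I) = UNIV" by simp
  obtain W where W: "isometric_embedding W" "surj W" "\<And>i. i \<in> ?I \<Longrightarrow> W (?e i) = ?f i"
  proof (rule unitary_of_gram[OF _ e f])
    fix i j :: "'e list \<times> 'v" assume "i \<in> ?I" "j \<in> ?I"
    then show "cinner (?e i) (?e j) = cinner (?f i) (?f j)"
      using dilation_gram_unique[OF F iso(1) dil(1) iso(2) dil(2)] by auto
  qed blast
  have W': "W (foldr S xs (J v)) = foldr S' xs (J' v)" if "set xs \<subseteq> mcar F" for xs v
    using W(3)[of "(xs, v)"] that by simp
  have bW: "bounded_op whole whole W" using W(1) by (simp add: isometric_embedding_def)
  have rep: "representation F S \<rho>" "representation F S' \<rho>'"
    using dilates_representation(2)[OF dil(1)] dilates_representation(2)[OF dil(2)] .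
  have \<rho>: "algebra_rep \<rho>" "algebra_rep \<rho>'" using rep by (auto simp: representation_def)
  have i: "\<rho> a (J v) = J (\<sigma> a v)" "\<rho>' a (J' v) = J' (\<sigma> a v)" for a v
    using dilates_intertwining[OF dil(1)] dilates_intertwining[OF dil(2)] by (auto simp: intertwining_def)
  have "W (J v) = J' v" for v using W'[of "[]" v] by simp
  moreover have "W (S x h) = S' x (W h)" if x: "x \<in> mcar F" for x h
  proof (rule eq_on_total[OF bounded_op_compose[OF bW] bounded_op_compose[OF _ bW] e])
    show "bounded_op whole whole (S x)" "bounded_op whole whole (S' x)"
      using rep x by (auto simp: representation_def)
    fix u assume "u \<in> ?e ` ?I"
    then obtain xs v where u: "u = foldr S xs (J v)" "set xs \<subseteq> mcar F" by auto
    then show "W (S x u) = S' x (W u)" using W'[of "x # xs" v] W'[of xs v] x by simp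
  qed
  moreover have "W (\<rho> a h) = \<rho>' a (W h)" for a h
  proof (rule eq_on_total[OF bounded_op_compose[OF bW rep_bounded_op[OF \<rho>(1)]]
        bounded_op_compose[OF rep_bounded_op[OF \<rho>(2)] bW] e])
    fix u assume "u \<in> ?e ` ?I"
    then obtain xs v where u: "u = foldr S xs (J v)" "set xs \<subseteq> mcar F" by auto
    show "W (\<rho> a u) = \<rho>' a (W u)"
    proof (cases xs)
      case Nil
      then show ?thesis using u W'[of "[]"] by (simp add: i)
    next
      case (Cons x xs')
      then show ?thesis
        using u W'[of "lact F a x # xs'" v] W'[of xs v]
        by (simp add: iso_rep_lact[OF iso(1)] iso_rep_lact[OF iso(2)])
    qed
  qed
  ultimately show ?thesis using W(1,2) unfolding equivalent_dilations_def by blast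
qed

section \<open>Isometric representations of product systems\<close>

primrec word_deg :: "nat list \<Rightarrow> nat \<Rightarrow> nat" where
  "word_deg [] = (\<lambda>_. 0)"
| "word_deg (i # ls) = nvec_add (unit_vec i) (word_deg ls)"

text \<open>The degree is the multiset of letters in disguise, so words of equal degree are exactly
  rearrangements of one another.\<close>

lemma word_deg_eq_count: "word_deg ls i = count (mset ls) i"
  by (induction ls) (auto simp: nvec_add_def unit_vec_def)

lemma word_deg_cong: "mset ls = mset ls' \<Longrightarrow> word_deg ls = word_deg ls'"
  by (rule ext) (simp add: word_deg_eq_count)

lemma mset_eq_of_word_deg: "word_deg ls = word_deg ls' \<Longrightarrow> mset ls = mset ls'"
  by (rule multiset_eqI) (simp flip: word_deg_eq_count)

lemma word_deg_append: "word_deg (ls @ ls') = nvec_add (word_deg ls) (word_deg ls')"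
  by (rule ext) (simp add: word_deg_eq_count nvec_add_def)

lemma zero_in_nvecs [simp]: "(\<lambda>_. 0) \<in> nvecs k"
  by (simp add: nvecs_def)

lemma nvec_add_in_nvecs [simp]: "n \<in> nvecs k \<Longrightarrow> m \<in> nvecs k \<Longrightarrow> nvec_add n m \<in> nvecs k"
  by (simp add: nvecs_def nvec_add_def)

lemma unit_vec_in_nvecs [simp]: "i \<in> {1..k} \<Longrightarrow> unit_vec i \<in> nvecs k"
  by (auto simp: nvecs_def unit_vec_def)

lemma word_deg_in_nvecs [simp]: "set ls \<subseteq> {1..k} \<Longrightarrow> word_deg ls \<in> nvecs k"
  by (induction ls) auto

lemma set_letters: "set (letters k n) \<subseteq> {1..k}"
  by (auto simp: letters_def)

lemma word_deg_letters [simp]: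
  assumes "n \<in> nvecs k" shows "word_deg (letters k n) = n"
proof
  fix i
  have "count (mset (concat (map (\<lambda>i. replicate (n i) i) js))) i = (if i \<in> set js then n i else 0)"
    if "distinct js" for js
    using that by (induction js) auto
  then show "word_deg (letters k n) i = n i"
    using assms by (auto simp: word_deg_eq_count letters_def nvecs_def)
qed

abbreviation in_fibres :: "('a, 'e) prodsys \<Rightarrow> nat list \<Rightarrow> 'e list \<Rightarrow> bool" where
  "in_fibres E \<equiv> list_all2 (\<lambda>i x. x \<in> mcar (gen_fibre E i))"

text \<open>One representation for each order of the letters. That different orders of the same
  letters give the same operators is a consequence of the commutation relations, not part of the
  construction.\<close>

definition word_rep ::
  "('a::cstar_algebra, 'e) prodsys \<Rightarrow> (nat \<Rightarrow> 'e \<Rightarrow> 'h::chilbert_space \<Rightarrow> 'h) \<Rightarrow> ('a \<Rightarrow> 'h \<Rightarrow> 'h) \<Rightarrow>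
    nat list \<Rightarrow> ('e \<Rightarrow> 'h \<Rightarrow> 'h) \<Rightarrow> bool" where
  "word_rep E S \<rho> ls T \<longleftrightarrow> iso_rep (fibre E (word_deg ls)) T \<rho> \<and>
     (\<forall>xs a h. in_fibres E ls xs \<longrightarrow>
        T (foldr (pmul E) xs (pcoeff E a)) h = foldr (\<lambda>(i, x). S i x) (zip ls xs) (\<rho> a h))"

locale product_sys =
  fixes k :: nat and E :: "('a::cstar_algebra, 'e) prodsys"
  assumes product_system: "product_system k E"
begin

lemma corr: "n \<in> nvecs k \<Longrightarrow> correspondence (fibre E n)"
  and mem_fibre: "n \<in> nvecs k \<Longrightarrow> mcar (fibre E n) = {x \<in> pcar E. pdeg E x = n}"
  and assoc: "x \<in> pcar E \<Longrightarrow> y \<in> pcar E \<Longrightarrow> z \<in> pcar E \<Longrightarrow>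
    pmul E (pmul E x y) z = pmul E x (pmul E y z)"
  and ten: "n \<in> nvecs k \<Longrightarrow> m \<in> nvecs k \<Longrightarrow>
    is_interior_tensor (fibre E n) (fibre E m) (fibre E (nvec_add n m)) (pmul E)"
  and pcoeff_bij: "bij_betw (pcoeff E) UNIV (mcar (fibre E (\<lambda>_. 0)))"
  and pcoeff_mult: "pcoeff E (a * b) = lact (fibre E (\<lambda>_. 0)) a (pcoeff E b)"
  and pcoeff_mip: "mip (fibre E (\<lambda>_. 0)) (pcoeff E a) (pcoeff E b) = star a * b"
  and pmul_pcoeff_left: "n \<in> nvecs k \<Longrightarrow> x \<in> mcar (fibre E n) \<Longrightarrow>
    pmul E (pcoeff E a) x = lact (fibre E n) a x"
  and pmul_pcoeff_right: "n \<in> nvecs k \<Longrightarrow> x \<in> mcar (fibre E n) \<Longrightarrow>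
    pmul E x (pcoeff E a) = ract (fibre E n) x a"
proof -
  let ?E0 = "fibre E (\<lambda>_. 0)"
  have facts: "\<forall>n\<in>nvecs k. correspondence (fibre E n) \<and> mcar (fibre E n) = {x \<in> pcar E. pdeg E x = n}"
    "\<forall>x\<in>pcar E. \<forall>y\<in>pcar E. \<forall>z\<in>pcar E. pmul E (pmul E x y) z = pmul E x (pmul E y z)"
    "\<forall>n\<in>nvecs k. \<forall>m\<in>nvecs k.
        is_interior_tensor (fibre E n) (fibre E m) (fibre E (nvec_add n m)) (pmul E)"
    "bij_betw (pcoeff E) UNIV (mcar ?E0)"
    "\<forall>a b. pcoeff E (a * b) = ract ?E0 (pcoeff E a) b \<and> pcoeff E (a * b) = lact ?E0 a (pcoeff E b)"
    "\<forall>a b. mip ?E0 (pcoeff E a) (pcoeff E b) = star a * b"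
    "\<forall>n\<in>nvecs k. \<forall>x\<in>mcar (fibre E n). \<forall>a.
        pmul E (pcoeff E a) x = lact (fibre E n) a x \<and> pmul E x (pcoeff E a) = ract (fibre E n) x a"
    using product_system unfolding product_system_def Let_def by - (elim conjE, assumption)+
  show "n \<in> nvecs k \<Longrightarrow> correspondence (fibre E n)"
    and "n \<in> nvecs k \<Longrightarrow> mcar (fibre E n) = {x \<in> pcar E. pdeg E x = n}"
    using facts(1) by simp_all
  show "x \<in> pcar E \<Longrightarrow> y \<in> pcar E \<Longrightarrow> z \<in> pcar E \<Longrightarrow>
    pmul E (pmul E x y) z = pmul E x (pmul E y z)" using facts(2) by simp
  show "n \<in> nvecs k \<Longrightarrow> m \<in> nvecs k \<Longrightarrow>
    is_interior_tensor (fibre E n) (fibre E m) (fibre E (nvec_add n m)) (pmul E)"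
    using facts(3) by simp
  show "bij_betw (pcoeff E) UNIV (mcar ?E0)" by (rule facts(4))
  show "pcoeff E (a * b) = lact ?E0 a (pcoeff E b)" using facts(5) by blast
  show "mip ?E0 (pcoeff E a) (pcoeff E b) = star a * b" using facts(6) by blast
  show "n \<in> nvecs k \<Longrightarrow> x \<in> mcar (fibre E n) \<Longrightarrow> pmul E (pcoeff E a) x = lact (fibre E n) a x"
    and "n \<in> nvecs k \<Longrightarrow> x \<in> mcar (fibre E n) \<Longrightarrow> pmul E x (pcoeff E a) = ract (fibre E n) x a"
    using facts(7) by simp_all
qed

lemma pmul_in:
  "n \<in> nvecs k \<Longrightarrow> m \<in> nvecs k \<Longrightarrow> x \<in> mcar (fibre E n) \<Longrightarrow> y \<in> mcar (fibre E m) \<Longrightarrow>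
    pmul E x y \<in> mcar (fibre E (nvec_add n m))"
  using tensor_in[OF ten] by blast

lemma pmul_assoc:
  "n \<in> nvecs k \<Longrightarrow> m \<in> nvecs k \<Longrightarrow> l \<in> nvecs k \<Longrightarrow> x \<in> mcar (fibre E n) \<Longrightarrow>
    y \<in> mcar (fibre E m) \<Longrightarrow> z \<in> mcar (fibre E l) \<Longrightarrow>
    pmul E (pmul E x y) z = pmul E x (pmul E y z)"
  by (rule assoc) (simp_all add: mem_fibre)

lemma mem_fibre_zero: "x \<in> mcar (fibre E (\<lambda>_. 0)) \<Longrightarrow> \<exists>a. x = pcoeff E a"
  using pcoeff_bij by (auto simp: bij_betw_def)

lemma pcoeff_in [simp]: "pcoeff E a \<in> mcar (fibre E (\<lambda>_. 0))"
  using pcoeff_bij by (auto simp: bij_betw_def)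

lemma word_product_in:
  assumes "set ls \<subseteq> {1..k}" "in_fibres E ls xs"
  shows "foldr (pmul E) xs (pcoeff E a) \<in> mcar (fibre E (word_deg ls))"
  using assms(2,1) by (induction rule: list_all2_induct) (auto intro: pmul_in)

text \<open>Products of letters with a final coefficient are total in the fibre: density of
  elementary tensors is used for one letter at a time, down to degree zero, where every element is a
  coefficient.\<close>

lemma modlin_word_mem:
  fixes f :: "'e \<Rightarrow> 'h::chilbert_space"
  assumes ls: "set ls \<subseteq> {1..k}" and f: "modlin (fibre E (word_deg ls)) f"
    and M: "csubspace M" "closed M"
    and mem: "\<And>xs a. in_fibres E ls xs \<Longrightarrow>
      f (foldr (pmul E) xs (pcoeff E a)) \<in> M"
    and z: "z \<in> mcar (fibre E (word_deg ls))"
  shows "f z \<in> M"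
  using ls f mem z
proof (induction ls arbitrary: f z)
  case Nil
  then obtain a where "z = pcoeff E a" using mem_fibre_zero[of z] by auto
  then show ?case using Nil(3)[of "[]" a] by simp
next
  case (Cons i ls)
  then have i: "unit_vec i \<in> nvecs k" and ls: "set ls \<subseteq> {1..k}" by auto
  note d = word_deg_in_nvecs[OF ls]
  show ?case
  proof (rule modlin_tensor_mem[OF ten[OF i d] _ M])
    show "modlin (fibre E (nvec_add (unit_vec i) (word_deg ls))) f" using Cons.prems by simp
    show "z \<in> mcar (fibre E (nvec_add (unit_vec i) (word_deg ls)))" using Cons.prems by simp
    fix x y assume x: "x \<in> mcar (gen_fibre E i)" and y: "y \<in> mcar (fibre E (word_deg ls))"
    show "f (pmul E x y) \<in> M"
    proof (rule Cons.IH[OF ls _ _ y])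
      show "modlin (fibre E (word_deg ls)) (\<lambda>y. f (pmul E x y))"
        using Cons.prems by (intro modlin_tensor_right[OF ten[OF i d] corr[OF i] corr[OF d] _ x]) simp
      show "f (pmul E x (foldr (pmul E) xs (pcoeff E a))) \<in> M"
        if "in_fibres E ls xs" for xs a
        using Cons.prems(3)[of "x # xs" a] that x by simp
    qed
  qed
qed

end

locale ps_iso_rep = product_sys k E for k and E :: "('a::cstar_algebra, 'e) prodsys" +
  fixes S :: "nat \<Rightarrow> 'e \<Rightarrow> 'h::chilbert_space \<Rightarrow> 'h" and \<rho> :: "'a \<Rightarrow> 'h \<Rightarrow> 'h"
  assumes rep: "ps_representation k E S \<rho>" and iso: "ps_isometric k E S \<rho>"
begin

lemma \<rho>: "algebra_rep \<rho>"
  using rep by (simp add: ps_representation_def)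

lemma S_iso_rep: "i \<in> {1..k} \<Longrightarrow> iso_rep (gen_fibre E i) (S i) \<rho>"
  using rep iso by (intro isometric_imp_iso_rep corr) (auto simp: ps_representation_def ps_isometric_def)

lemma iso_representationI: "n \<in> nvecs k \<Longrightarrow> iso_rep (fibre E n) T \<rho> \<Longrightarrow> iso_representation (fibre E n) T \<rho>"
  using correspondI[OF corr] \<rho> by (simp add: iso_representation_def iso_representation_axioms_def)

lemma modlin_iso_rep: "n \<in> nvecs k \<Longrightarrow> iso_rep (fibre E n) T \<rho> \<Longrightarrow> modlin (fibre E n) (\<lambda>x. T x h)"
  by (rule iso_representation.modlin_T[OF iso_representationI])

lemma bounded_op_iso_rep:
  "n \<in> nvecs k \<Longrightarrow> iso_rep (fibre E n) T \<rho> \<Longrightarrow> x \<in> mcar (fibre E n) \<Longrightarrow> bounded_op whole whole (T x)"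
  by (rule iso_representation.T_bounded_op[OF iso_representationI])

lemma word_rep_iso: "word_rep E S \<rho> ls T \<Longrightarrow> iso_rep (fibre E (word_deg ls)) T \<rho>"
  by (simp add: word_rep_def)

lemma word_rep_word:
  "word_rep E S \<rho> ls T \<Longrightarrow> in_fibres E ls xs \<Longrightarrow>
    T (foldr (pmul E) xs (pcoeff E a)) h = foldr (\<lambda>(i, x). S i x) (zip ls xs) (\<rho> a h)"
  by (simp add: word_rep_def)

lemma word_rep_unique:
  assumes ls: "set ls \<subseteq> {1..k}" and T: "word_rep E S \<rho> ls T" "word_rep E S \<rho> ls T'"
    and x: "x \<in> mcar (fibre E (word_deg ls))"
  shows "T x h = T' x h"
proof -
  have "T x h - T' x h \<in> {0}"
  proof (rule modlin_word_mem[OF ls _ _ _ _ x])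
    show "modlin (fibre E (word_deg ls)) (\<lambda>x. T x h - T' x h)"
      using ls T by (intro modlin_diff modlin_iso_rep word_rep_iso) auto
  qed (use T in \<open>auto simp: csubspace_def word_rep_word\<close>)
  then show ?thesis by simp
qed

lemma word_rep_Nil: "\<exists>T. word_rep E S \<rho> [] T"
proof -
  define T where "T x = \<rho> (inv_into UNIV (pcoeff E) x)" for x
  have Tc: "T (pcoeff E a) h = \<rho> a h" for a h
    using pcoeff_bij by (simp add: T_def bij_betw_def)
  have "iso_rep (fibre E (\<lambda>_. 0)) T \<rho>"
    unfolding iso_rep_def
  proof (intro conjI ballI allI)
    fix x y h g assume "x \<in> mcar (fibre E (\<lambda>_. 0))" "y \<in> mcar (fibre E (\<lambda>_. 0))"
    then obtain a b where "x = pcoeff E a" "y = pcoeff E b" using mem_fibre_zero by metis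
    then show "cinner (T x h) (T y g) = cinner h (\<rho> (mip (fibre E (\<lambda>_. 0)) x y) g)"
      by (simp add: Tc pcoeff_mip rep_adjoint[OF \<rho>] rep_mult[OF \<rho>])
  next
    fix x a h assume "x \<in> mcar (fibre E (\<lambda>_. 0))"
    then obtain b where "x = pcoeff E b" using mem_fibre_zero by metis
    then show "\<rho> a (T x h) = T (lact (fibre E (\<lambda>_. 0)) a x) h"
      by (simp add: Tc rep_mult[OF \<rho>] flip: pcoeff_mult)
  qed
  then have "word_rep E S \<rho> [] T" by (simp add: word_rep_def Tc)
  then show ?thesis by blast
qed

lemma word_rep_Cons:
  assumes i: "i \<in> {1..k}" and ls: "set ls \<subseteq> {1..k}" and T: "word_rep E S \<rho> ls T"
  obtains T' where "word_rep E S \<rho> (i # ls) T'"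
    "\<And>x y h. x \<in> mcar (gen_fibre E i) \<Longrightarrow> y \<in> mcar (fibre E (word_deg ls)) \<Longrightarrow>
      T' (pmul E x y) h = S i x (T y h)"
proof -
  note i' = unit_vec_in_nvecs[OF i] and d = word_deg_in_nvecs[OF ls]
  obtain T' where T': "iso_rep (fibre E (nvec_add (unit_vec i) (word_deg ls))) T' \<rho>"
    "\<And>x y h. x \<in> mcar (gen_fibre E i) \<Longrightarrow> y \<in> mcar (fibre E (word_deg ls)) \<Longrightarrow>
      T' (pmul E x y) h = S i x (T y h)"
    using tensor_iso_rep[OF \<rho> ten[OF i' d] corr[OF i'] S_iso_rep[OF i] corr[OF d] word_rep_iso[OF T]]
    by blast
  have "word_rep E S \<rho> (i # ls) T'"
    unfolding word_rep_def
  proof (intro conjI allI impI)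
    show "iso_rep (fibre E (word_deg (i # ls))) T' \<rho>" using T'(1) by simp
    fix xs a h assume "in_fibres E (i # ls) xs"
    then obtain x xs' where xs: "xs = x # xs'" "x \<in> mcar (gen_fibre E i)"
      "in_fibres E ls xs'" by (auto simp: list_all2_Cons1)
    then show "T' (foldr (pmul E) xs (pcoeff E a)) h
        = foldr (\<lambda>(i, x). S i x) (zip (i # ls) xs) (\<rho> a h)"
      by (simp add: T'(2) word_product_in[OF ls] word_rep_word[OF T])
  qed
  then show thesis using that T'(2) by blast
qed

lemma word_rep_exists: "set ls \<subseteq> {1..k} \<Longrightarrow> \<exists>T. word_rep E S \<rho> ls T"
proof (induction ls)
  case (Cons i ls)
  then obtain T where T: "word_rep E S \<rho> ls T" by auto
  have "i \<in> {1..k}" "set ls \<subseteq> {1..k}" using Cons.prems by auto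
  then show ?case by (rule word_rep_Cons[OF _ _ T]) blast
qed (rule word_rep_Nil)

lemma word_rep_Cons_mult:
  assumes i: "i \<in> {1..k}" and ls: "set ls \<subseteq> {1..k}" and T: "word_rep E S \<rho> ls T"
    and T': "word_rep E S \<rho> (i # ls) T'"
    and x: "x \<in> mcar (gen_fibre E i)" and y: "y \<in> mcar (fibre E (word_deg ls))"
  shows "T' (pmul E x y) h = S i x (T y h)"
proof -
  obtain T'' where T'': "word_rep E S \<rho> (i # ls) T''" "T'' (pmul E x y) h = S i x (T y h)"
    using word_rep_Cons[OF i ls T] x y by metis
  have "pmul E x y \<in> mcar (fibre E (word_deg (i # ls)))"
    using i ls x y by (simp add: pmul_in)
  then have "T' (pmul E x y) h = T'' (pmul E x y) h"
    using i ls by (intro word_rep_unique[OF _ T' T''(1)]) auto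
  then show ?thesis using T''(2) by simp
qed

text \<open>By density \<open>x\<close> may be taken as a letter \<open>u\<close> times a shorter
  element \<open>w\<close>, and associativity regroups the product for the induction. In the base
  case \<open>x\<close> is a coefficient and left covariance applies.\<close>

lemma word_rep_append:
  assumes ls: "set ls \<subseteq> {1..k}" "set ls' \<subseteq> {1..k}" and T: "word_rep E S \<rho> ls T"
    and T': "word_rep E S \<rho> ls' T'" and T'': "word_rep E S \<rho> (ls @ ls') T''"
    and x: "x \<in> mcar (fibre E (word_deg ls))" and y: "y \<in> mcar (fibre E (word_deg ls'))"
  shows "T'' (pmul E x y) h = T x (T' y h)"
  using ls(1) T T'' x
proof (induction ls arbitrary: T T'' x)
  case Nil
  then obtain a where x: "x = pcoeff E a" using mem_fibre_zero[of x] by auto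
  note d = word_deg_in_nvecs[OF ls(2)]
  interpret L: correspond "fibre E (word_deg ls')" by (intro correspondI corr d)
  have "T'' (pmul E x y) h = T'' (lact (fibre E (word_deg ls')) a y) h"
    by (simp add: x pmul_pcoeff_left[OF d y])
  also have "\<dots> = T' (lact (fibre E (word_deg ls')) a y) h"
    using Nil(3) y by (intro word_rep_unique[OF ls(2) _ T']) auto
  also have "\<dots> = \<rho> a (T' y h)" using iso_rep_lact[OF word_rep_iso[OF T'] y] by simp
  also have "\<dots> = T x (T' y h)" using word_rep_word[OF Nil(2), of "[]"] by (simp add: x)
  finally show ?case .
next
  case (Cons i ls)
  then have i: "i \<in> {1..k}" and ls1: "set ls \<subseteq> {1..k}" by auto
  note i' = unit_vec_in_nvecs[OF i] and d1 = word_deg_in_nvecs[OF ls1] and d = word_deg_in_nvecs[OF ls(2)]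
  have ls2: "set (ls @ ls') \<subseteq> {1..k}" using ls1 ls(2) by auto
  obtain T1 T1'' where T1: "word_rep E S \<rho> ls T1" and T1'': "word_rep E S \<rho> (ls @ ls') T1''"
    using word_rep_exists[OF ls1] word_rep_exists[OF ls2] by blast
  have dd: "nvec_add (unit_vec i) (word_deg ls) \<in> nvecs k" using i' d1 by simp
  have deg: "word_deg ((i # ls) @ ls') = nvec_add (nvec_add (unit_vec i) (word_deg ls)) (word_deg ls')"
    by (simp only: word_deg_append word_deg.simps)
  note isoT = word_rep_iso[OF Cons.prems(2), unfolded word_deg.simps]
  note isoT'' = word_rep_iso[OF Cons.prems(3), unfolded deg]
  have x: "x \<in> mcar (fibre E (nvec_add (unit_vec i) (word_deg ls)))" using Cons.prems(4) by simp
  show ?case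
  proof (rule modlin_tensor_eq[OF ten[OF i' d1] _ modlin_iso_rep[OF dd isoT] _ x])
    show "modlin (fibre E (nvec_add (unit_vec i) (word_deg ls))) (\<lambda>x. T'' (pmul E x y) h)"
      by (rule modlin_tensor_left[OF ten[OF dd d] corr[OF dd] corr[OF d] modlin_iso_rep[OF _ isoT''] y])
        (use dd d in simp)
    fix u w assume u: "u \<in> mcar (gen_fibre E i)" and w: "w \<in> mcar (fibre E (word_deg ls))"
    have wy: "pmul E w y \<in> mcar (fibre E (word_deg (ls @ ls')))"
      using pmul_in[OF d1 d w y] by (simp add: word_deg_append)
    have "T'' (pmul E (pmul E u w) y) h = T'' (pmul E u (pmul E w y)) h"
      by (simp add: pmul_assoc[OF i' d1 d u w y])
    also have "\<dots> = S i u (T1'' (pmul E w y) h)"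
      using Cons.prems(3) by (intro word_rep_Cons_mult[OF i ls2 T1'' _ u wy]) simp
    also have "\<dots> = S i u (T1 w (T' y h))" by (simp add: Cons.IH[OF ls1 T1 T1'' w])
    also have "\<dots> = T (pmul E u w) (T' y h)"
      by (rule word_rep_Cons_mult[OF i ls1 T1 Cons.prems(2) u w, symmetric])
    finally show "T'' (pmul E (pmul E u w) y) h = T (pmul E u w) (T' y h)" .
  qed
qed

lemma word_rep_single:
  assumes i: "i \<in> {1..k}" shows "word_rep E S \<rho> [i] (S i)"
proof -
  have e: "nvec_add (unit_vec i) (\<lambda>_. 0) = unit_vec i" by (simp add: nvec_add_def)
  interpret iso_representation "gen_fibre E i" "S i" \<rho>
    using i by (intro iso_representationI S_iso_rep) auto
  show ?thesis
    using i by (auto simp: word_rep_def e S_iso_rep list_all2_Cons1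
        pmul_pcoeff_right[OF unit_vec_in_nvecs[OF i]] T_ract)
qed

lemma word_rep_pair:
  assumes i: "i \<in> {1..k}" and j: "j \<in> {1..k}" and T: "word_rep E S \<rho> [i, j] T"
    and x: "x \<in> mcar (gen_fibre E i)" and y: "y \<in> mcar (gen_fibre E j)"
  shows "T (pmul E x y) h = S i x (S j y h)"
  using word_rep_Cons_mult[OF i _ word_rep_single[OF j] T x, of y h] j y by (simp add: nvec_add_def)

end

section \<open>Two-letter words and the flip isomorphisms\<close>

lemma nvec_add_commute: "nvec_add n m = nvec_add m n"
  by (simp add: nvec_add_def add.commute)

lemma wspace_single: "wspace [F] [T] J = closed_span {T x (J v) |x v. x \<in> mcar F}"
proof -
  have "wvec [T] J ` words [F] = {T x (J u) |x u. x \<in> mcar F}"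
    by (force simp: words_def wvec_def list_all2_Cons1)
  then show ?thesis by (simp add: wspace_def)
qed

lemma wspace_pair: "wspace [F, G] [T1, T2] J =
  closed_span {T1 x (T2 y (J v)) |x y v. x \<in> mcar F \<and> y \<in> mcar G}"
proof -
  have "wvec [T1, T2] J ` words [F, G] = {T1 x (T2 y (J v)) |x y v. x \<in> mcar F \<and> y \<in> mcar G}"
    by (force simp: words_def wvec_def list_all2_Cons1)
  then show ?thesis by (simp add: wspace_def)
qed

lemma words_singleE:
  assumes "w \<in> words [F]" obtains x h where "w = ([x], h)" "x \<in> mcar F"
  using assms by (auto simp: words_def list_all2_Cons1)

lemma words_pairE:
  assumes "w \<in> words [F, G]" obtains x y h where "w = ([x, y], h)" "x \<in> mcar F" "y \<in> mcar G"
  using assms by (auto simp: words_def list_all2_Cons1)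

lemma word_in_words:
  "x \<in> mcar F \<Longrightarrow> ([x], h) \<in> words [F]"
  by (simp add: words_def)

context ps_iso_rep
begin

lemmas J_id = intertwining_id[OF \<rho>]

lemma word_deg_pair: "word_deg [i, j] = nvec_add (unit_vec i) (unit_vec j)"
  by (simp add: nvec_add_def)

text \<open>In the models both operators are inclusions, so the composition gives back the
  vector.\<close>

lemma tilde_id_tensor_tilde:
  assumes i: "i \<in> {1..k}" and j: "j \<in> {1..k}"
    and x: "x \<in> wspace [gen_fibre E i, gen_fibre E j] [S i, S j] (\<lambda>h. h)"
  shows "tilde (gen_fibre E i) (S i) \<rho> (id_tensor_tilde (gen_fibre E i) (gen_fibre E j) (S j) \<rho>
    (wcoord [gen_fibre E i, gen_fibre E j] [S i, S j] (\<lambda>h. h) x)) = x"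
proof -
  let ?I = "\<lambda>h::'h. h" and ?F = "gen_fibre E i" and ?G = "gen_fibre E j"
  have Ts: "iso_reps \<rho> [?F] [S i]"
    "iso_reps \<rho> [?F, ?G] [S i, S j]"
    using i j corr S_iso_rep by auto
  have sub: "wspace [?F, ?G] [S i, S j] ?I \<subseteq> wspace [?F] [S i] ?I"
    unfolding wspace_single wspace_pair by (rule closed_span_mono) blast
  have 1: "id_tensor_tilde ?F ?G (S j) \<rho> (wcoord [?F, ?G] [S i, S j] ?I x) = wcoord [?F] [S i] ?I x"
    unfolding id_tensor_tilde_def
  proof (rule ext_op_tensor[OF J_id Ts(2) realises_tensor[OF J_id Ts(1)] bounded_op_id _ _ x])
    fix w :: "'e list \<times> 'h" assume "w \<in> words [?F, ?G]"
    then obtain y z h where w: "w = ([y, z], h)" "y \<in> mcar ?F" "z \<in> mcar ?G" by (rule words_pairE)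
    show "(\<lambda>(xs, h). elem [?F] \<rho> ([xs ! 0], S j (xs ! 1) h)) w = wcoord [?F] [S i] ?I (wvec [S i, S j] ?I w)"
      using w elem_eq[OF J_id Ts(1) word_in_words[OF w(2)], of "S j z h"] by (simp add: wvec_def)
  qed (use sub in blast)
  have x': "x \<in> wspace [?F] [S i] ?I" using x sub by blast
  have 2: "tilde ?F (S i) \<rho> (wcoord [?F] [S i] ?I x) = x"
    unfolding tilde_def
  proof (rule ext_op_tensor[OF J_id Ts(1) realises_whole bounded_op_id _ _ x'])
    fix w :: "'e list \<times> 'h" assume "w \<in> words [?F]"
    then obtain y h where w: "w = ([y], h)" "y \<in> mcar ?F" by (rule words_singleE)
    then show "(\<lambda>(xs, h). S i (hd xs) h) w = wvec [S i] ?I w" by (simp add: wvec_def)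
  qed simp
  show ?thesis unfolding 1 2 ..
qed

lemma wspace_pair_eq:
  assumes i: "i \<in> {1..k}" and j: "j \<in> {1..k}" and T: "word_rep E S \<rho> [i, j] T"
  shows "wspace [gen_fibre E i, gen_fibre E j] [S i, S j] (\<lambda>h. h)
    = wspace [fibre E (nvec_add (unit_vec i) (unit_vec j))] [T] (\<lambda>h. h)" (is "?L = ?R")
proof
  note ij = unit_vec_in_nvecs[OF i] unit_vec_in_nvecs[OF j]
  have isoT: "iso_rep (fibre E (nvec_add (unit_vec i) (unit_vec j))) T \<rho>"
    using word_rep_iso[OF T] unfolding word_deg_pair .
  show "?L \<subseteq> ?R"
    unfolding wspace_single wspace_pair
  proof (rule closed_span_mono, clarify)
    fix x y h assume xy: "x \<in> mcar (gen_fibre E i)" "y \<in> mcar (gen_fibre E j)"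
    show "\<exists>z v. S i x (S j y h) = T z v \<and> z \<in> mcar (fibre E (nvec_add (unit_vec i) (unit_vec j)))"
      using word_rep_pair[OF i j T xy] pmul_in[OF ij xy] by metis
  qed
  have "T z h \<in> ?L" if z: "z \<in> mcar (fibre E (nvec_add (unit_vec i) (unit_vec j)))" for z h
  proof (rule modlin_tensor_mem[OF ten[OF ij] modlin_iso_rep[OF _ isoT] _ _ _ z])
    fix x y assume xy: "x \<in> mcar (gen_fibre E i)" "y \<in> mcar (gen_fibre E j)"
    show "T (pmul E x y) h \<in> ?L"
      unfolding word_rep_pair[OF i j T xy] wspace_pair
      by (rule subsetD[OF closed_span_superset]) (use xy in blast)
  qed (use ij in \<open>auto simp: wspace_pair\<close>)
  then show "?R \<subseteq> ?L"
    unfolding wspace_single by (intro closed_span_minimal) (auto simp: wspace_pair)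
qed

lemma mult_iso_wcoord:
  assumes i: "i \<in> {1..k}" and j: "j \<in> {1..k}" and T: "word_rep E S \<rho> [i, j] T"
    and x: "x \<in> wspace [gen_fibre E i, gen_fibre E j] [S i, S j] (\<lambda>h. h)"
  shows "mult_iso E \<rho> i j (wcoord [gen_fibre E i, gen_fibre E j] [S i, S j] (\<lambda>h. h) x)
    = wcoord [fibre E (nvec_add (unit_vec i) (unit_vec j))] [T] (\<lambda>h. h) x"
proof -
  let ?I = "\<lambda>h::'h. h" and ?F = "gen_fibre E i" and ?G = "gen_fibre E j"
    and ?FG = "fibre E (nvec_add (unit_vec i) (unit_vec j))"
  note ij = unit_vec_in_nvecs[OF i] unit_vec_in_nvecs[OF j]
  have isoT: "iso_rep ?FG T \<rho>" using word_rep_iso[OF T] unfolding word_deg_pair .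
  have Ts: "iso_reps \<rho> [?FG] [T]"
    "iso_reps \<rho> [?F, ?G] [S i, S j]"
    using ij i j corr S_iso_rep isoT by auto
  show ?thesis
    unfolding mult_iso_def Let_def
  proof (rule ext_op_tensor[OF J_id Ts(2) realises_tensor[OF J_id Ts(1)] bounded_op_id _ _ x])
    fix w :: "'e list \<times> 'h" assume "w \<in> words [?F, ?G]"
    then obtain y z h where w: "w = ([y, z], h)" "y \<in> mcar ?F" "z \<in> mcar ?G" by (rule words_pairE)
    show "(\<lambda>(xs, h). elem [?FG] \<rho> ([pmul E (xs ! 0) (xs ! 1)], h)) w
        = wcoord [?FG] [T] ?I (wvec [S i, S j] ?I w)"
      using w elem_eq[OF J_id Ts(1) word_in_words[OF pmul_in[OF ij w(2,3)]], of h]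
      by (simp add: wvec_def word_rep_pair[OF i j T])
  qed (use wspace_pair_eq[OF i j T] in blast)
qed

text \<open>By the commutation relation the flip of \<open>x\<close> is \<open>x\<close> itself, in the models that use
  \<open>S\<^sub>i S\<^sub>j\<close> and \<open>S\<^sub>j S\<^sub>i\<close>.\<close>

lemma commutation:
  assumes i: "i \<in> {1..k}" and j: "j \<in> {1..k}"
    and T: "word_rep E S \<rho> [i, j] T" and T': "word_rep E S \<rho> [j, i] T'"
    and x: "x \<in> wspace [gen_fibre E i, gen_fibre E j] [S i, S j] (\<lambda>h. h)"
  shows "x \<in> wspace [gen_fibre E j, gen_fibre E i] [S j, S i] (\<lambda>h. h)"
    and "z \<in> mcar (fibre E (nvec_add (unit_vec i) (unit_vec j))) \<Longrightarrow>
      cinner (T z h) x = cinner (T' z h) x"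
proof -
  let ?I = "\<lambda>h::'h. h" and ?F = "gen_fibre E i" and ?G = "gen_fibre E j"
    and ?FG = "fibre E (nvec_add (unit_vec i) (unit_vec j))"
  let ?GF = "fibre E (nvec_add (unit_vec j) (unit_vec i))"
  let ?U = "wcoord [?F, ?G] [S i, S j] ?I" and ?U' = "wcoord [?G, ?F] [S j, S i] ?I"
  let ?M' = "wspace [?G, ?F] [S j, S i] ?I"
  have GF: "?GF = ?FG" by (simp add: nvec_add_commute)
  note ij = unit_vec_in_nvecs[OF i] unit_vec_in_nvecs[OF j]
  have isoT: "iso_rep ?FG T \<rho>" "iso_rep ?FG T' \<rho>"
    using word_rep_iso[OF T] word_rep_iso[OF T'] unfolding word_deg_pair GF .
  have Ts: "iso_reps \<rho> [?FG] [T]"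
    "iso_reps \<rho> [?FG] [T']"
    "iso_reps \<rho> [?F, ?G] [S i, S j]"
    "iso_reps \<rho> [?G, ?F] [S j, S i]"
    using ij i j corr S_iso_rep isoT by auto
  note r = realises_tensor[OF J_id Ts(1)] realises_tensor[OF J_id Ts(2)]
    realises_tensor[OF J_id Ts(3)] realises_tensor[OF J_id Ts(4)]
  let ?V = "wcoord [?FG] [T] ?I" and ?V' = "wcoord [?FG] [T'] ?I"
  have M': "?M' = wspace [?FG] [T'] ?I" using wspace_pair_eq[OF j i T'] by (simp add: GF)
  have m': "mult_iso E \<rho> j i (?U' y) = ?V' y" if "y \<in> ?M'" for y
    using mult_iso_wcoord[OF j i T' that] by (simp add: GF)
  have "?V x \<in> hcar (tensor [?FG] \<rho>)"
    using x wspace_pair_eq[OF i j T] by (intro realisesD(3)[OF r(1)]) simp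
  also have "\<dots> = mult_iso E \<rho> j i ` hcar (tensor [?G, ?F] \<rho>)"
    unfolding realisesD(4)[OF r(2)] realisesD(4)[OF r(4)] image_image M'[symmetric]
    by (rule image_cong[OF refl]) (rule m'[symmetric])
  \<comment> \<open>\<open>flip_iso\<close> is written with \<open>inv_into\<close>, which returns a
    preimage only for points of the image.\<close>
  finally have im: "?V x \<in> mult_iso E \<rho> j i ` hcar (tensor [?G, ?F] \<rho>)" .
  define g where "g = flip_iso E \<rho> i j (?U x)"
  have g: "g = inv_into (hcar (tensor [?G, ?F] \<rho>)) (mult_iso E \<rho> j i) (?V x)"
    unfolding g_def flip_iso_def mult_iso_wcoord[OF i j T x] ..
  have "g \<in> hcar (tensor [?G, ?F] \<rho>)" unfolding g by (rule inv_into_into[OF im])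
  then obtain y where y: "g = ?U' y" "y \<in> ?M'" unfolding realisesD(4)[OF r(4)] by blast
  have "mult_iso E \<rho> j i g = ?V x" unfolding g by (rule f_inv_into_f[OF im])
  then have VV: "?V' y = ?V x" using y m' by simp
  have "?U x \<in> hcar (tensor [?F, ?G] \<rho>)" by (rule realisesD(3)[OF r(3) x])
  then have "tilde ?F (S i) \<rho> (id_tensor_tilde ?F ?G (S j) \<rho> (?U x))
      = tilde ?G (S j) \<rho> (id_tensor_tilde ?G ?F (S i) \<rho> (flip_iso E \<rho> i j (?U x)))"
    using rep i j unfolding ps_representation_def by blast
  then have xy: "x = y"
    unfolding tilde_id_tensor_tilde[OF i j x] g_def[symmetric] y(1) tilde_id_tensor_tilde[OF j i y(2)] .
  then show "x \<in> ?M'" using y by simp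
  assume z: "z \<in> mcar ?FG"
  show "cinner (T z h) x = cinner (T' z h) x"
    using fun_cong[OF VV, of "([z], h)"] z
    by (simp add: wcoord_def coord_def words_def wvec_def xy)
qed

text \<open>Both vectors lie in the common model subspace, and there they have the same inner
  products with every vector; hence their difference is orthogonal to itself.\<close>

lemma word_rep_swap_pair:
  assumes i: "i \<in> {1..k}" and j: "j \<in> {1..k}"
    and T: "word_rep E S \<rho> [i, j] T" and T': "word_rep E S \<rho> [j, i] T'"
    and z: "z \<in> mcar (fibre E (nvec_add (unit_vec i) (unit_vec j)))"
  shows "T z h = T' z h"
proof -
  let ?M = "wspace [gen_fibre E i, gen_fibre E j] [S i, S j] (\<lambda>h::'h. h)"
  let ?M' = "wspace [gen_fibre E j, gen_fibre E i] [S j, S i] (\<lambda>h::'h. h)"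
  have M: "?M = ?M'" using commutation(1)[OF i j T T'] commutation(1)[OF j i T' T] by blast
  have "T z h \<in> ?M"
    unfolding wspace_pair_eq[OF i j T] wspace_single
    by (rule subsetD[OF closed_span_superset]) (use z in blast)
  moreover have "T' z h \<in> ?M"
    unfolding M wspace_pair_eq[OF j i T'] wspace_single nvec_add_commute[of "unit_vec j"]
    by (rule subsetD[OF closed_span_superset]) (use z in blast)
  ultimately have "T z h - T' z h \<in> ?M"
    by (intro csubspace_diff) (auto simp: wspace_def)
  from commutation(2)[OF i j T T' this z, of h]
  have "cinner (T z h - T' z h) (T z h - T' z h) = 0" by (simp add: cinner_diff_left)
  then show ?thesis by simp
qed

section \<open>Independence of the order of the letters\<close>

definition agree :: "nat list \<Rightarrow> nat list \<Rightarrow> bool" where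
  "agree ls ls' \<longleftrightarrow> (\<forall>T T' x h. word_rep E S \<rho> ls T \<longrightarrow> word_rep E S \<rho> ls' T' \<longrightarrow>
     x \<in> mcar (fibre E (word_deg ls)) \<longrightarrow> T x h = T' x h)"

lemma agree_refl: "set ls \<subseteq> {1..k} \<Longrightarrow> agree ls ls"
  unfolding agree_def using word_rep_unique by blast

lemma agree_trans:
  assumes "agree as bs" "agree bs cs" "set bs \<subseteq> {1..k}" "mset as = mset bs"
  shows "agree as cs"
proof -
  obtain U where "word_rep E S \<rho> bs U" using word_rep_exists[OF assms(3)] by blast
  then show ?thesis
    using assms(1,2) unfolding agree_def word_deg_cong[OF assms(4)] by metis
qed

lemma agree_Cons:
  assumes ag: "agree as bs" and m: "mset as = mset bs" and i: "i \<in> {1..k}" and as: "set as \<subseteq> {1..k}"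
  shows "agree (i # as) (i # bs)"
  unfolding agree_def
proof (intro allI impI)
  fix T T' x h assume T: "word_rep E S \<rho> (i # as) T" and T': "word_rep E S \<rho> (i # bs) T'"
    and x: "x \<in> mcar (fibre E (word_deg (i # as)))"
  have bs: "set bs \<subseteq> {1..k}" using as mset_eq_setD[OF m] by simp
  obtain U U' where U: "word_rep E S \<rho> as U" and U': "word_rep E S \<rho> bs U'"
    using word_rep_exists as bs by blast
  note d = word_deg_cong[OF m]
  note i' = unit_vec_in_nvecs[OF i] and da = word_deg_in_nvecs[OF as]
  have dd: "nvec_add (unit_vec i) (word_deg as) \<in> nvecs k" using i' da by simp
  note isoT = word_rep_iso[OF T, unfolded word_deg.simps]
    word_rep_iso[OF T', unfolded word_deg.simps d[symmetric]]
  show "T x h = T' x h"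
  proof (rule modlin_tensor_eq[OF ten[OF i' da] modlin_iso_rep[OF dd isoT(1)] modlin_iso_rep[OF dd isoT(2)]])
    fix u w assume u: "u \<in> mcar (gen_fibre E i)" and w: "w \<in> mcar (fibre E (word_deg as))"
    have w': "w \<in> mcar (fibre E (word_deg bs))" using w d by simp
    have "U w h = U' w h" using ag U U' w unfolding agree_def by blast
    then show "T (pmul E u w) h = T' (pmul E u w) h"
      by (simp add: word_rep_Cons_mult[OF i as U T u w] word_rep_Cons_mult[OF i bs U' T' u w'])
  qed (use x in simp)
qed

text \<open>Grouping the first two letters into one fibre element \<open>z\<close>, both
  representations factor as a two-letter representation at \<open>z\<close> followed by that of
  \<open>ls\<close>, and the two-letter ones coincide.\<close>

lemma agree_swap:
  assumes i: "i \<in> {1..k}" and j: "j \<in> {1..k}" and ls: "set ls \<subseteq> {1..k}"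
  shows "agree (i # j # ls) (j # i # ls)"
  unfolding agree_def
proof (intro allI impI)
  fix T T' x h assume T: "word_rep E S \<rho> (i # j # ls) T" and T': "word_rep E S \<rho> (j # i # ls) T'"
    and x: "x \<in> mcar (fibre E (word_deg (i # j # ls)))"
  have sets: "set [i, j] \<subseteq> {1..k}" "set [j, i] \<subseteq> {1..k}" using i j by auto
  obtain U V V' where U: "word_rep E S \<rho> ls U" and V: "word_rep E S \<rho> [i, j] V"
    and V': "word_rep E S \<rho> [j, i] V'"
    using word_rep_exists ls sets by metis
  let ?n = "nvec_add (unit_vec i) (unit_vec j)"
  have n: "?n \<in> nvecs k" and d: "word_deg ls \<in> nvecs k" using i j ls by auto
  have nd: "nvec_add ?n (word_deg ls) \<in> nvecs k" using n d by simp
  have deg: "word_deg (i # j # ls) = nvec_add ?n (word_deg ls)"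
    "word_deg (j # i # ls) = nvec_add ?n (word_deg ls)"
    by (auto simp: nvec_add_def add_ac)
  show "T x h = T' x h"
  proof (rule modlin_tensor_eq[OF ten[OF n d] modlin_iso_rep[OF nd word_rep_iso[OF T, unfolded deg]]
        modlin_iso_rep[OF nd word_rep_iso[OF T', unfolded deg]]])
    fix z w assume z: "z \<in> mcar (fibre E ?n)" and w: "w \<in> mcar (fibre E (word_deg ls))"
    have "T (pmul E z w) h = V z (U w h)"
      using T z by (intro word_rep_append[OF sets(1) ls V U _ _ w]) (simp_all only: append.simps word_deg_pair)
    also have "\<dots> = V' z (U w h)" by (rule word_rep_swap_pair[OF i j V V' z])
    also have "\<dots> = T' (pmul E z w) h"
      using T' z by (intro word_rep_append[OF sets(2) ls V' U _ _ w, symmetric])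
        (simp_all only: append.simps word_deg_pair nvec_add_commute[of "unit_vec j"])
    finally show "T (pmul E z w) h = T' (pmul E z w) h" .
  qed (use x deg in simp)
qed

lemma agree_insert:
  assumes "i \<in> {1..k}" "set as \<subseteq> {1..k}" "set bs \<subseteq> {1..k}"
  shows "agree (i # as @ bs) (as @ i # bs)"
  using assms
proof (induction as)
  case Nil
  then show ?case by (simp add: agree_refl)
next
  case (Cons j as)
  have 1: "agree (i # j # as @ bs) (j # i # as @ bs)"
    by (rule agree_swap) (use Cons.prems in simp_all)
  have 2: "agree (j # i # as @ bs) (j # as @ i # bs)"
    by (rule agree_Cons) (use Cons in simp_all)
  show ?case
    unfolding append_Cons by (rule agree_trans[OF 1 2]) (use Cons.prems in simp_all)
qed

text \<open>Adjacent swaps carry the head of \<open>as\<close> to its place in \<open>bs\<close>;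
  induction rearranges the rest.\<close>

lemma agree_perm: "mset as = mset bs \<Longrightarrow> set as \<subseteq> {1..k} \<Longrightarrow> agree as bs"
proof (induction as arbitrary: bs)
  case Nil
  then show ?case by (simp add: agree_refl)
next
  case (Cons i as)
  have "i \<in> set bs" using mset_eq_setD[OF Cons.prems(1)] by auto
  then obtain us vs where bs: "bs = us @ i # vs" by (auto dest: split_list)
  have m: "mset as = mset (us @ vs)" using Cons.prems(1) by (simp add: bs)
  have s: "set (us @ vs) \<subseteq> {1..k}" using mset_eq_setD[OF m] Cons.prems(2) by simp
  have "agree (i # as) (i # us @ vs)"
    using Cons m by (intro agree_Cons) auto
  moreover have "agree (i # us @ vs) (us @ i # vs)"
    using Cons.prems(2) s by (intro agree_insert) auto
  ultimately show ?case
    unfolding bs by (rule agree_trans) (use Cons.prems(2) s m in simp_all)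
qed

text \<open>A model of S_n independent of the tensor spaces. The choice is harmless, as
  \<open>word_rep\<close> determines the values on the fibre.\<close>

definition S_at :: "(nat \<Rightarrow> nat) \<Rightarrow> 'e \<Rightarrow> 'h \<Rightarrow> 'h" where
  "S_at n = (SOME T. word_rep E S \<rho> (letters k n) T)"

lemma S_at_word_rep: "word_rep E S \<rho> (letters k n) (S_at n)"
  unfolding S_at_def by (rule someI_ex[OF word_rep_exists[OF set_letters]])

lemma S_at_iso_rep: "n \<in> nvecs k \<Longrightarrow> iso_rep (fibre E n) (S_at n) \<rho>"
  using word_rep_iso[OF S_at_word_rep[of n]] by simp

lemma S_at_eq_word_rep:
  assumes ls: "set ls \<subseteq> {1..k}" and T: "word_rep E S \<rho> ls T" and x: "x \<in> mcar (fibre E (word_deg ls))"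
  shows "S_at (word_deg ls) x h = T x h"
proof -
  have d: "word_deg ls \<in> nvecs k" using ls by simp
  then have "mset (letters k (word_deg ls)) = mset ls" by (intro mset_eq_of_word_deg) simp
  then have "agree (letters k (word_deg ls)) ls" by (rule agree_perm) (rule set_letters)
  then show ?thesis using S_at_word_rep T x d unfolding agree_def by simp
qed

text \<open>The two letter lists, concatenated, are in general not in the order of
  \<open>letters\<close>; order independence identifies the representation of this word with
  \<open>S_at\<close>.\<close>

lemma S_at_mult:
  assumes n: "n \<in> nvecs k" and m: "m \<in> nvecs k" and x: "x \<in> mcar (fibre E n)" and y: "y \<in> mcar (fibre E m)"
  shows "S_at (nvec_add n m) (pmul E x y) h = S_at n x (S_at m y h)"
proof -
  let ?ls = "letters k n @ letters k m"
  have s: "set ?ls \<subseteq> {1..k}" using set_letters by auto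
  obtain T where T: "word_rep E S \<rho> ?ls T" using word_rep_exists[OF s] by blast
  have d: "word_deg ?ls = nvec_add n m" using n m by (simp add: word_deg_append)
  have "S_at (nvec_add n m) (pmul E x y) h = T (pmul E x y) h"
    using S_at_eq_word_rep[OF s T, of "pmul E x y"] pmul_in[OF n m x y] by (simp add: d)
  also have "\<dots> = S_at n x (S_at m y h)"
    using x y n m by (intro word_rep_append[OF set_letters set_letters S_at_word_rep S_at_word_rep T]) simp_all
  finally show ?thesis .
qed

lemma S_at_unit_vec:
  assumes i: "i \<in> {1..k}" and x: "x \<in> mcar (gen_fibre E i)"
  shows "S_at (unit_vec i) x h = S i x h"
  using S_at_eq_word_rep[OF _ word_rep_single[OF i], of x h] i x by (simp add: nvec_add_def)

lemma S_at_zero: "S_at (\<lambda>_. 0) (pcoeff E a) h = \<rho> a h"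
  using word_rep_word[OF S_at_word_rep[of "\<lambda>_. 0"], of "[]" a h] by (simp add: letters_def)

end

section \<open>Dilations of product system representations\<close>

lemma closed_span_image_mem:
  assumes T: "bounded_op whole whole T" and N: "csubspace N" "closed N"
    and S: "\<And>x. x \<in> S \<Longrightarrow> T x \<in> N" and x: "x \<in> closed_span S"
  shows "T x \<in> N"
proof -
  interpret bounded_linear T by (rule bounded_op_whole(1)[OF T])
  have "closed_span S \<subseteq> T -` N"
  proof (rule closed_span_minimal)
    show "csubspace (T -` N)"
      using N(1) by (auto simp: csubspace_def add zero bounded_op_whole(2)[OF T])
    show "closed (T -` N)"
      by (rule closed_vimage[OF N(2)]) (rule continuous_on[OF continuous_on_id])
  qed (use S in auto)
  then show ?thesis using x by auto
qed

lemma representation_cong: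
  assumes F: "correspondence F" and A: "representation F A \<sigma>"
    and eq: "\<And>x h. x \<in> mcar F \<Longrightarrow> A' x h = A x h"
  shows "representation F A' \<sigma>"
proof -
  interpret correspond F using F by (rule correspondI)
  have e: "A' x = A x" if "x \<in> mcar F" for x using eq[OF that] by auto
  have "completely_contractive F A'"
    unfolding completely_contractive_def
  proof (intro allI impI)
    fix N and x :: "nat \<Rightarrow> nat \<Rightarrow> 'b" and v :: "nat \<Rightarrow> 'c"
    assume x: "\<forall>i<N. \<forall>j<N. x i j \<in> mcar F"
    then have "(\<Sum>i<N. (norm (\<Sum>j<N. A' (x i j) (v j)))\<^sup>2) = (\<Sum>i<N. (norm (\<Sum>j<N. A (x i j) (v j)))\<^sup>2)"
      by (simp add: e)
    then show "sqrt (\<Sum>i<N. (norm (\<Sum>j<N. A' (x i j) (v j)))\<^sup>2)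
        \<le> corr_mat_norm F N x * sqrt (\<Sum>j<N. (norm (v j))\<^sup>2)"
      using A x by (simp add: representation_def completely_contractive_def)
  qed
  then show ?thesis using A by (simp add: representation_def e)
qed

text \<open>Complete contractivity survives compression because the adjoint of \<open>J\<close> is
  contractive and \<open>J\<close> preserves norms; covariance survives because both intertwine
  \<sigma> and \<rho>.\<close>

lemma (in iso_representation) representation_compression:
  fixes J :: "'v::chilbert_space \<Rightarrow> 'h"
  assumes J: "intertwining \<sigma> \<rho> J" and \<sigma>: "algebra_rep \<sigma>"
  shows "representation F (\<lambda>x v. adj whole whole J (T x (J v))) \<sigma>"
proof -
  let ?Js = "adj whole whole J"
  have iJ: "isometric_embedding J" and i: "\<And>a v. \<rho> a (J v) = J (\<sigma> a v)"
    using J by (auto simp: intertwining_def)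
  have bJ: "bounded_op whole whole J" using iJ by (simp add: isometric_embedding_def)
  note bJs = bounded_op_adj_embedding[OF iJ]
  interpret Js: bounded_linear ?Js by (rule bounded_op_whole(1)[OF bJs])
  have "completely_contractive F (\<lambda>x v. ?Js (T x (J v)))"
    unfolding completely_contractive_def
  proof (intro allI impI)
    fix N and x :: "nat \<Rightarrow> nat \<Rightarrow> 'e" and v :: "nat \<Rightarrow> 'v"
    assume x: "\<forall>i<N. \<forall>j<N. x i j \<in> mcar F"
    have "sqrt (\<Sum>i<N. (norm (\<Sum>j<N. ?Js (T (x i j) (J (v j)))))\<^sup>2)
      \<le> sqrt (\<Sum>i<N. (norm (\<Sum>j<N. T (x i j) (J (v j))))\<^sup>2)"
      by (intro real_sqrt_le_mono sum_mono power_mono) (simp_all add: norm_adj_embedding_le[OF iJ] flip: Js.sum)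
    also have "\<dots> \<le> corr_mat_norm F N x * sqrt (\<Sum>j<N. (norm (J (v j)))\<^sup>2)"
      using T_completely_contractive x by (simp add: completely_contractive_def)
    finally show "sqrt (\<Sum>i<N. (norm (\<Sum>j<N. ?Js (T (x i j) (J (v j)))))\<^sup>2)
      \<le> corr_mat_norm F N x * sqrt (\<Sum>j<N. (norm (v j))\<^sup>2)"
      by (simp add: norm_isometric[OF iJ])
  qed
  moreover have "bounded_op whole whole (\<lambda>v. ?Js (T x (J v)))" if "x \<in> mcar F" for x
    using that by (intro bounded_op_compose[OF bJs] bounded_op_compose[OF _ bJ] T_bounded_op)
  ultimately show ?thesis
    unfolding representation_def
    using \<sigma> by (simp add: T_madd T_mscale Js.add bounded_op_whole(2)[OF bJs] T_ract i
        intertwining_adj[OF J \<sigma>] flip: iso_rep_lact[OF T])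
qed

context ps_iso_rep
begin

text \<open>The products on which \<open>ps_tilde\<close> is prescribed are total in the model of
  \<open>E(n) \<otimes> V\<close>, so its description determines an operator.\<close>

lemma wspace_S_at_eq:
  fixes J :: "'v \<Rightarrow> 'h"
  assumes n: "n \<in> nvecs k"
  shows "closed_span ((\<lambda>(xs, a, v). S_at n (foldr (pmul E) xs (pcoeff E a)) (J v)) `
      {(xs, a, v). in_fibres E (letters k n) xs})
    = wspace [fibre E n] [S_at n] J" (is "closed_span (?d ` ?G) = _")
proof
  have prod: "foldr (pmul E) xs (pcoeff E a) \<in> mcar (fibre E n)"
    if "in_fibres E (letters k n) xs" for xs a
    using word_product_in[OF set_letters that] n by simp
  show "closed_span (?d ` ?G) \<subseteq> wspace [fibre E n] [S_at n] J"
    unfolding wspace_single by (rule closed_span_mono) (use prod in fastforce)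
  have "S_at n x (J v) \<in> closed_span (?d ` ?G)" if x: "x \<in> mcar (fibre E n)" for x v
  proof (rule modlin_word_mem[OF set_letters])
    show "modlin (fibre E (word_deg (letters k n))) (\<lambda>x. S_at n x (J v))"
      using n by (simp add: modlin_iso_rep S_at_iso_rep)
    show "x \<in> mcar (fibre E (word_deg (letters k n)))" using x n by simp
    fix xs a assume "in_fibres E (letters k n) xs"
    then have "(xs, a, v) \<in> ?G" by simp
    from imageI[OF this, of ?d] show "S_at n (foldr (pmul E) xs (pcoeff E a)) (J v) \<in> closed_span (?d ` ?G)"
      by (intro subsetD[OF closed_span_superset]) simp
  qed auto
  then show "wspace [fibre E n] [S_at n] J \<subseteq> closed_span (?d ` ?G)"
    unfolding wspace_single by (intro closed_span_minimal) auto
qed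

lemma S_at_single: "n \<in> nvecs k \<Longrightarrow>
    iso_reps \<rho> [fibre E n] [S_at n]"
  by (simp add: corr S_at_iso_rep)

text \<open>Stated with a general \<open>B\<close> to treat both systems at once: the identity for
  \<open>S\<close>, the adjoint of \<open>J\<close> for \<open>A\<close>.\<close>

lemma ps_tilde_wcoord:
  fixes J :: "'v::chilbert_space \<Rightarrow> 'h" and B :: "'h \<Rightarrow> 'v"
  assumes n: "n \<in> nvecs k" and J: "intertwining \<sigma> \<rho> J" and B: "bounded_op whole whole B"
    and t: "\<And>xs a v. in_fibres E (letters k n) xs \<Longrightarrow>
      foldr (\<lambda>(i, x). A i x) (zip (letters k n) xs) (\<sigma> a v)
        = B (foldr (\<lambda>(i, x). S i x) (zip (letters k n) xs) (\<rho> a (J v)))"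
    and x: "x \<in> wspace [fibre E n] [S_at n] J"
  shows "ps_tilde k E A \<sigma> n (wcoord [fibre E n] [S_at n] J x) = B x"
proof -
  obtain K where K: "\<And>x. norm (B x) \<le> K * norm x" using B by (auto simp: bounded_op_def)
  show ?thesis
    unfolding ps_tilde_def
  proof (rule ext_op_realises[OF realises_tensor[OF J S_at_single[OF n]] realises_whole _ wspace_S_at_eq[OF n], where K=K])
    fix w :: "'e list \<times> 'a \<times> 'v"
    assume "w \<in> {(xs, a, v). in_fibres E (letters k n) xs}"
    then obtain xs a v where w: "w = (xs, a, v)"
      and xs: "in_fibres E (letters k n) xs" by auto
    have prod: "foldr (pmul E) xs (pcoeff E a) \<in> mcar (fibre E n)"
      using word_product_in[OF set_letters xs] n by simp
    show "(\<lambda>(xs, a, h). elem [fibre E n] \<sigma> ([foldr (pmul E) xs (pcoeff E a)], h)) w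
      = wcoord [fibre E n] [S_at n] J ((\<lambda>(xs, a, v). S_at n (foldr (pmul E) xs (pcoeff E a)) (J v)) w)"
      using elem_eq[OF J S_at_single[OF n] word_in_words[OF prod], of v] by (simp add: w wvec_def)
    show "(\<lambda>(xs, a, h). foldr (\<lambda>(i, x). A i x) (zip (letters k n) xs) (\<sigma> a h)) w
      = B ((\<lambda>(xs, a, v). S_at n (foldr (pmul E) xs (pcoeff E a)) (J v)) w)"
      using t[OF xs] by (simp add: w word_rep_word[OF S_at_word_rep xs])
  qed (use B K x in \<open>auto simp: bounded_op_def\<close>)
qed

lemma ps_tilde_S:
  assumes n: "n \<in> nvecs k" and x: "x \<in> wspace [fibre E n] [S_at n] (\<lambda>h. h)"
  shows "ps_tilde k E S \<rho> n (wcoord [fibre E n] [S_at n] (\<lambda>h. h) x) = x"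
  by (rule ps_tilde_wcoord[OF n J_id bounded_op_id _ x]) simp

lemma ps_at_S:
  assumes n: "n \<in> nvecs k" and x: "x \<in> mcar (fibre E n)"
  shows "ps_at k E S \<rho> n x h = S_at n x h"
proof -
  have w: "([x], h) \<in> words [fibre E n]" by (rule word_in_words[OF x])
  have "wvec [S_at n] (\<lambda>h. h) ([x], h) = S_at n x h" by (simp add: wvec_def)
  then show ?thesis
    using ps_tilde_S[OF n wvec_in_wspace[OF w]] elem_eq[OF J_id S_at_single[OF n] w]
    by (simp add: ps_at_def)
qed

lemma ps_tilde_amplify_image:
  assumes n: "n \<in> nvecs k" and J: "intertwining \<sigma> \<rho> J"
  shows "ps_tilde k E S \<rho> n ` amplify [fibre E n] \<sigma> \<rho> J ` hcar (tensor [fibre E n] \<sigma>)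
    = closed_span {S_at n x (J v) |x v. x \<in> mcar (fibre E n)}"
proof -
  let ?F = "[fibre E n]" and ?T = "[S_at n]"
  note Ts = S_at_single[OF n]
  have "ps_tilde k E S \<rho> n ` amplify ?F \<sigma> \<rho> J ` hcar (tensor ?F \<sigma>)
    = (\<lambda>x. ps_tilde k E S \<rho> n (amplify ?F \<sigma> \<rho> J (wcoord ?F ?T J x))) ` wspace ?F ?T J"
    unfolding realisesD(4)[OF realises_tensor[OF J Ts]] image_image ..
  also have "\<dots> = (\<lambda>x. x) ` wspace ?F ?T J"
  proof (rule image_cong[OF refl])
    fix x assume x: "x \<in> wspace ?F ?T J"
    then have x': "x \<in> wspace ?F ?T (\<lambda>h. h)" using wspace_mono by blast
    show "ps_tilde k E S \<rho> n (amplify ?F \<sigma> \<rho> J (wcoord ?F ?T J x)) = x"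
      unfolding amplify_wcoord[OF J Ts x] by (rule ps_tilde_S[OF n x'])
  qed
  finally show ?thesis by (simp add: wspace_single)
qed

end

locale ps_coisometric_dilation = ps_iso_rep k E S \<rho>
  for k and E :: "('a::cstar_algebra, 'e) prodsys"
    and S :: "nat \<Rightarrow> 'e \<Rightarrow> 'h::chilbert_space \<Rightarrow> 'h" and \<rho> +
  fixes A :: "nat \<Rightarrow> 'e \<Rightarrow> 'v::chilbert_space \<Rightarrow> 'v" and \<sigma> and J :: "'v \<Rightarrow> 'h"
  assumes k: "1 \<le> k"
    and dil: "ps_dilates k E A \<sigma> J S \<rho>"
    and co: "ps_fully_coisometric k E A \<sigma>"
begin

lemma dilates_gen: "i \<in> {1..k} \<Longrightarrow> dilates (gen_fibre E i) (A i) \<sigma> J (S i) \<rho>"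
  using dil by (simp add: ps_dilates_def)

text \<open>Read off from the dilation of the first generator; here \<open>1 \<le> k\<close> enters,
  since \<open>ps_dilates\<close> relates \<sigma>, \<rho> and \<open>J\<close> only through the
  generators.\<close>

lemma J: "intertwining \<sigma> \<rho> J"
  using dilates_intertwining[OF dilates_gen[of 1]] k by simp

lemma J_embedding: "isometric_embedding J"
  using J by (simp add: intertwining_def)

lemma \<sigma>: "algebra_rep \<sigma>"
  using dil by (simp add: ps_dilates_def ps_representation_def)

abbreviation Js :: "'h \<Rightarrow> 'v" where "Js \<equiv> adj whole whole J"

lemmas Js_bounded_op = bounded_op_adj_embedding[OF J_embedding]

lemma Js_word:
  assumes "in_fibres E ls xs" "set ls \<subseteq> {1..k}"
  shows "Js (foldr (\<lambda>(i, x). S i x) (zip ls xs) h) = foldr (\<lambda>(i, x). A i x) (zip ls xs) (Js h)"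
  using assms by (induction rule: list_all2_induct) (auto simp: dilates_adj[OF dilates_gen])

text \<open>On a product of letters the adjoint of \<open>J\<close> passes through one letter at a
  time, so only \<open>Js h\<close> matters; totality of these products gives the rest of the
  fibre.\<close>

lemma Js_S_at:
  assumes n: "n \<in> nvecs k" and x: "x \<in> mcar (fibre E n)"
  shows "Js (S_at n x h) = Js (S_at n x (J (Js h)))"
proof -
  have m: "modlin (fibre E n) (\<lambda>x. Js (S_at n x h))" for h
    by (rule modlin_compose[OF modlin_iso_rep[OF n S_at_iso_rep[OF n]]
          bounded_op_whole(1)[OF Js_bounded_op] bounded_op_whole(2)[OF Js_bounded_op]])
  have "Js (S_at n x h) - Js (S_at n x (J (Js h))) \<in> {0}"
  proof (rule modlin_word_mem[OF set_letters])
    show "modlin (fibre E (word_deg (letters k n))) (\<lambda>x. Js (S_at n x h) - Js (S_at n x (J (Js h))))"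
      using n by (simp add: modlin_diff m)
    show "x \<in> mcar (fibre E (word_deg (letters k n)))" using x n by simp
    fix xs a assume xs: "in_fibres E (letters k n) xs"
    show "Js (S_at n (foldr (pmul E) xs (pcoeff E a)) h)
        - Js (S_at n (foldr (pmul E) xs (pcoeff E a)) (J (Js h))) \<in> {0}"
      using J_embedding
      by (simp add: word_rep_word[OF S_at_word_rep xs] Js_word[OF xs set_letters] intertwining_adj[OF J \<sigma>])
  qed (auto simp: csubspace_def)
  then show ?thesis by simp
qed

text \<open>The adjoint of \<open>J\<close> models the tilde operator of \<open>A\<close>, which
  exhibits A_n as the compression of S_n; this is how A_n is seen to be a representation.\<close>

lemma ps_at_A:
  assumes n: "n \<in> nvecs k" and x: "x \<in> mcar (fibre E n)"
  shows "ps_at k E A \<sigma> n x v = Js (S_at n x (J v))"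
proof -
  have w: "([x], v) \<in> words [fibre E n]" by (rule word_in_words[OF x])
  have "ps_tilde k E A \<sigma> n (wcoord [fibre E n] [S_at n] J (wvec [S_at n] J ([x], v))) = Js (wvec [S_at n] J ([x], v))"
  proof (rule ps_tilde_wcoord[OF n J Js_bounded_op _ wvec_in_wspace[OF w]])
    fix xs a v assume xs: "in_fibres E (letters k n) xs"
    show "foldr (\<lambda>(i, x). A i x) (zip (letters k n) xs) (\<sigma> a v)
        = Js (foldr (\<lambda>(i, x). S i x) (zip (letters k n) xs) (\<rho> a (J v)))"
      using J_embedding by (simp add: Js_word[OF xs set_letters] intertwining_adj[OF J \<sigma>])
  qed
  then show ?thesis
    by (simp add: ps_at_def elem_eq[OF J S_at_single[OF n] w]) (simp add: wvec_def)
qed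

lemma ps_at_iso_rep:
  assumes n: "n \<in> nvecs k" shows "iso_rep (fibre E n) (ps_at k E S \<rho> n) \<rho>"
proof -
  interpret correspond "fibre E n" by (intro correspondI corr n)
  show ?thesis
    using S_at_iso_rep[OF n] by (simp add: iso_rep_def ps_at_S[OF n])
qed

lemma ps_at_dilates:
  assumes n: "n \<in> nvecs k"
  shows "dilates (fibre E n) (ps_at k E A \<sigma> n) \<sigma> J (ps_at k E S \<rho> n) \<rho>"
proof (rule dilatesI[OF _ _ J])
  interpret T: iso_representation "fibre E n" "S_at n" \<rho>
    by (rule iso_representationI[OF n S_at_iso_rep[OF n]])
  interpret S: iso_representation "fibre E n" "ps_at k E S \<rho> n" \<rho>
    by (rule iso_representationI[OF n ps_at_iso_rep[OF n]])
  show "representation (fibre E n) (ps_at k E A \<sigma> n) \<sigma>"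
    by (rule representation_cong[OF corr[OF n] T.representation_compression[OF J \<sigma>] ps_at_A[OF n]])
  show "representation (fibre E n) (ps_at k E S \<rho> n) \<rho>" by (rule S.representation_T)
  show "Js (ps_at k E S \<rho> n x h) = ps_at k E A \<sigma> n x (Js h)" if "x \<in> mcar (fibre E n)" for x h
    using Js_S_at[OF n that] by (simp add: ps_at_S[OF n that] ps_at_A[OF n that])
qed

section \<open>The increasing family of subspaces generated by the fibres\<close>

definition span_at :: "(nat \<Rightarrow> nat) \<Rightarrow> 'h set" where
  "span_at n = closed_span {S_at n x (J v) |x v. x \<in> mcar (fibre E n)}"

lemma span_at_closed: "csubspace (span_at n)" "closed (span_at n)"
  by (auto simp: span_at_def)

lemma span_at_gen: "x \<in> mcar (fibre E n) \<Longrightarrow> S_at n x (J v) \<in> span_at n"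
  unfolding span_at_def by (rule subsetD[OF closed_span_superset]) blast

text \<open>Coisometry of \<open>A i\<close> places \<open>J v\<close> in the closed span of the
  vectors \<open>S i y (J u)\<close>; applying \<open>S_at m x\<close> raises the degree by
  \<open>unit_vec i\<close> through \<open>pmul E x y\<close>.\<close>

lemma span_at_step:
  assumes m: "m \<in> nvecs k" and i: "i \<in> {1..k}"
  shows "span_at m \<subseteq> span_at (nvec_add m (unit_vec i))"
proof -
  note i' = unit_vec_in_nvecs[OF i]
  have "S_at m x (J v) \<in> span_at (nvec_add m (unit_vec i))" if x: "x \<in> mcar (fibre E m)" for x v
  proof (rule closed_span_image_mem[OF bounded_op_iso_rep[OF m S_at_iso_rep[OF m] x] span_at_closed])
    show "J v \<in> closed_span {S i y (J u) |y u. y \<in> mcar (gen_fibre E i)}"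
      using co i by (intro fully_coisometric_range[OF corr[OF i'] S_iso_rep[OF i] dilates_gen[OF i]])
        (simp add: ps_fully_coisometric_def)
    fix w assume "w \<in> {S i y (J u) |y u. y \<in> mcar (gen_fibre E i)}"
    then obtain y u where w: "w = S i y (J u)" and y: "y \<in> mcar (gen_fibre E i)" by blast
    have "S_at m x w = S_at (nvec_add m (unit_vec i)) (pmul E x y) (J u)"
      by (simp add: w S_at_mult[OF m i' x y] S_at_unit_vec[OF i y])
    then show "S_at m x w \<in> span_at (nvec_add m (unit_vec i))"
      using span_at_gen[OF pmul_in[OF m i' x y]] by simp
  qed
  then show ?thesis unfolding span_at_def[of m] by (intro closed_span_minimal span_at_closed) blast
qed

lemma span_at_mono:
  assumes m: "m \<in> nvecs k" and ls: "set ls \<subseteq> {1..k}"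
  shows "span_at m \<subseteq> span_at (nvec_add m (word_deg ls))"
  using ls m
proof (induction ls arbitrary: m)
  case Nil
  then show ?case by (simp add: nvec_add_def)
next
  case (Cons i ls)
  then have i: "i \<in> {1..k}" by simp
  have "span_at m \<subseteq> span_at (nvec_add m (unit_vec i))" by (rule span_at_step[OF Cons.prems(2) i])
  also have "\<dots> \<subseteq> span_at (nvec_add (nvec_add m (unit_vec i)) (word_deg ls))"
    using Cons.prems i by (intro Cons.IH) auto
  also have "nvec_add (nvec_add m (unit_vec i)) (word_deg ls) = nvec_add m (word_deg (i # ls))"
    by (simp add: nvec_add_def add.assoc)
  finally show ?case .
qed

text \<open>Peel off one factor from \<open>E(n)\<close> at each step, by density of products in the
  fibre of degree \<open>Suc r\<close> times \<open>n\<close>. In degree zero the coefficient acts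
  inside \<open>V\<close>, giving the empty word.\<close>

lemma span_at_multiple:
  assumes n: "n \<in> nvecs k"
  shows "span_at (\<lambda>i. r * n i) \<subseteq> closed_span {foldr (S_at n) xs (J v) |xs v. length xs = r \<and> set xs \<subseteq> mcar (fibre E n)}"
    (is "_ \<subseteq> closed_span (?P r)")
proof (induction r)
  case 0
  have "S_at (\<lambda>_. 0) x (J v) \<in> closed_span (?P 0)" if x: "x \<in> mcar (fibre E (\<lambda>_. 0))" for x v
  proof -
    obtain a where "x = pcoeff E a" using mem_fibre_zero[OF x] by blast
    then have "S_at (\<lambda>_. 0) x (J v) = J (\<sigma> a v)" using J by (simp add: S_at_zero intertwining_def)
    also have "\<dots> \<in> closed_span (?P 0)" by (rule subsetD[OF closed_span_superset]) auto
    finally show ?thesis .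
  qed
  then show ?case unfolding span_at_def by (intro closed_span_minimal) auto
next
  case (Suc r)
  let ?rn = "\<lambda>i. r * n i"
  have rn: "?rn \<in> nvecs k" using n by (simp add: nvecs_def)
  have eq: "(\<lambda>i. Suc r * n i) = nvec_add n ?rn" by (simp add: nvec_add_def)
  have nrn: "nvec_add n ?rn \<in> nvecs k" using n rn by simp
  have "S_at (nvec_add n ?rn) z (J v) \<in> closed_span (?P (Suc r))"
    if z: "z \<in> mcar (fibre E (nvec_add n ?rn))" for z v
  proof (rule modlin_tensor_mem[OF ten[OF n rn] modlin_iso_rep[OF nrn S_at_iso_rep[OF nrn]] _ _ _ z])
    fix x y assume x: "x \<in> mcar (fibre E n)" and y: "y \<in> mcar (fibre E ?rn)"
    have "S_at n x (S_at ?rn y (J v)) \<in> closed_span (?P (Suc r))"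
    proof (rule closed_span_image_mem[OF bounded_op_iso_rep[OF n S_at_iso_rep[OF n] x]])
      show "S_at ?rn y (J v) \<in> closed_span (?P r)" using Suc.IH span_at_gen[OF y] by blast
      fix w assume "w \<in> ?P r"
      then obtain xs u where w: "w = foldr (S_at n) xs (J u)" "length xs = r" "set xs \<subseteq> mcar (fibre E n)"
        by blast
      then have "S_at n x w = foldr (S_at n) (x # xs) (J u)" "length (x # xs) = Suc r"
        "set (x # xs) \<subseteq> mcar (fibre E n)" using x by auto
      then have "S_at n x w \<in> ?P (Suc r)" by blast
      then show "S_at n x w \<in> closed_span (?P (Suc r))" by (rule subsetD[OF closed_span_superset])
    qed auto
    then show "S_at (nvec_add n ?rn) (pmul E x y) (J v) \<in> closed_span (?P (Suc r))"
      by (simp add: S_at_mult[OF n rn x y])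
  qed auto
  then show ?case unfolding span_at_def eq by (intro closed_span_minimal) auto
qed

text \<open>For a dominating multiple \<open>r n\<close> of \<open>m\<close>, coisometry gives
  \<open>S\<^sub>m(E(m)) V \<subseteq> \<Or>S\<^sub>r\<^sub>n(E(r n)) V\<close>, and \<open>E(r n)\<close> is the \<open>r\<close>-th tensor power of \<open>E(n)\<close>.\<close>

lemma span_at_subset_powers:
  assumes n: "n \<in> nvecs k" "\<forall>i\<in>{1..k}. n i \<noteq> 0" and m: "m \<in> nvecs k"
  shows "span_at m \<subseteq> closed_span {foldr (S_at n) xs (J v) |xs v. set xs \<subseteq> mcar (fibre E n)}"
proof -
  \<comment> \<open>Each \<open>m i\<close> is at most the sum \<open>r\<close>, and
    \<open>r \<le> r * n i\<close> because \<open>n i\<close> is at least 1.\<close>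
  define r where "r = (\<Sum>i\<in>{1..k}. m i)"
  have le: "m i \<le> r * n i" for i
  proof (cases "i \<in> {1..k}")
    case True
    then have "m i \<le> r" unfolding r_def by (intro member_le_sum) auto
    also have "r \<le> r * n i" using n(2) True by (simp add: Suc_leI)
    finally show ?thesis .
  next
    case False
    then show ?thesis using m by (simp add: nvecs_def)
  qed
  \<comment> \<open>The truncated subtraction is exact by \<open>le\<close>.\<close>
  define l where "l = (\<lambda>i. r * n i - m i)"
  have l: "l \<in> nvecs k" using n(1) by (simp add: l_def nvecs_def)
  have "nvec_add m l = (\<lambda>i. r * n i)" using le by (simp add: nvec_add_def l_def)
  then have "span_at m \<subseteq> span_at (\<lambda>i. r * n i)"
    using span_at_mono[OF m set_letters[of k l]] l by simp
  also have "\<dots> \<subseteq> closed_span {foldr (S_at n) xs (J v) |xs v. length xs = r \<and> set xs \<subseteq> mcar (fibre E n)}"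
    by (rule span_at_multiple[OF n(1)])
  also have "\<dots> \<subseteq> closed_span {foldr (S_at n) xs (J v) |xs v. set xs \<subseteq> mcar (fibre E n)}"
    by (rule closed_span_mono) blast
  finally show ?thesis .
qed

lemma ps_at_minimal:
  assumes n: "n \<in> nvecs k" "\<forall>i\<in>{1..k}. n i \<noteq> 0"
    and min: "ps_minimal_isometric_dilation k E A \<sigma> J S \<rho>"
  shows "minimal_isometric_dilation (fibre E n) (ps_at k E A \<sigma> n) \<sigma> J (ps_at k E S \<rho> n) \<rho>"
proof -
  let ?F = "fibre E n" and ?S = "ps_at k E S \<rho> n"
  let ?P = "{foldr (S_at n) xs (J v) |xs v. set xs \<subseteq> mcar ?F}"
  let ?Q = "\<lambda>m. {foldr ?S xs (J v) |xs v. length xs = m \<and> set xs \<subseteq> mcar ?F}"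
  interpret iso_representation ?F ?S \<rho>
    by (rule iso_representationI[OF n(1) ps_at_iso_rep[OF n(1)]])
  have "closed_span (\<Union>m\<in>nvecs k. span_at m) = UNIV"
    using min ps_tilde_amplify_image[OF _ J]
    by (simp add: ps_minimal_isometric_dilation_def span_at_def)
  moreover have "closed_span (\<Union>m\<in>nvecs k. span_at m) \<subseteq> closed_span ?P"
    by (intro closed_span_minimal UN_least span_at_subset_powers[OF n]) auto
  ultimately have P: "closed_span ?P = UNIV" by blast
  have foldr_eq: "foldr ?S xs (J v) = foldr (S_at n) xs (J v)" if "set xs \<subseteq> mcar ?F" for xs v
    using that by (induction xs) (auto simp: ps_at_S[OF n(1)])
  have "?P \<subseteq> (\<Union>m. ?Q m)"
  proof clarify
    fix xs v assume xs: "set xs \<subseteq> mcar ?F"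
    have "foldr ?S xs (J v) \<in> ?Q (length xs)" using xs by blast
    then show "foldr (S_at n) xs (J v) \<in> (\<Union>m. ?Q m)" unfolding foldr_eq[OF xs] by blast
  qed
  then have "closed_span ?P \<subseteq> closed_span (\<Union>m. ?Q m)" by (rule closed_span_mono)
  then have "closed_span (\<Union>m. ?Q m) = UNIV" using P by blast
  then have "closed_span (\<Union>m. tilde_pow ?F ?S \<rho> m ` amplify (replicate m ?F) \<sigma> \<rho> J `
       hcar (tensor (replicate m ?F) \<sigma>)) = UNIV"
    by (simp add: tilde_pow_amplify_image[OF J corr T] closed_span_Union_closed_span)
  then show ?thesis
    using ps_at_dilates[OF n(1)] isometric_T by (simp add: minimal_isometric_dilation_def)
qed

end

theorem theorem3p12:
  fixes k :: nat
    and E :: "('a::cstar_algebra, 'e) prodsys"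
    and A :: "nat \<Rightarrow> 'e \<Rightarrow> 'v::chilbert_space \<Rightarrow> 'v"
    and \<sigma> :: "'a \<Rightarrow> 'v \<Rightarrow> 'v"
    and J :: "'v \<Rightarrow> 'h::chilbert_space"
    and S :: "nat \<Rightarrow> 'e \<Rightarrow> 'h \<Rightarrow> 'h"
    and \<rho> :: "'a \<Rightarrow> 'h \<Rightarrow> 'h"
    and n :: "nat \<Rightarrow> nat"
  assumes "1 \<le> k"
    and "product_system k E"
    and "ps_representation k E A \<sigma>"
    and "ps_fully_coisometric k E A \<sigma>"
    and "ps_minimal_isometric_dilation k E A \<sigma> J S \<rho>"
    and "n \<in> nvecs k"
    and "\<forall>i\<in>{1..k}. n i \<noteq> 0"
  shows "minimal_isometric_dilation (fibre E n) (ps_at k E A \<sigma> n) \<sigma> J (ps_at k E S \<rho> n) \<rho> \<and>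
    (\<forall>(J' :: 'v \<Rightarrow> 'k::chilbert_space) S' \<rho>'.
       minimal_isometric_dilation (fibre E n) (ps_at k E A \<sigma> n) \<sigma> J' S' \<rho>' \<longrightarrow>
       equivalent_dilations (fibre E n) J (ps_at k E S \<rho> n) \<rho> J' S' \<rho>')"
proof -
  interpret ps_coisometric_dilation k E S \<rho> A \<sigma> J
    using assms by unfold_locales (auto simp: ps_minimal_isometric_dilation_def ps_dilates_def)
  have min: "minimal_isometric_dilation (fibre E n) (ps_at k E A \<sigma> n) \<sigma> J (ps_at k E S \<rho> n) \<rho>"
    using assms by (intro ps_at_minimal)
  moreover have "equivalent_dilations (fibre E n) J (ps_at k E S \<rho> n) \<rho> J' S' \<rho>'"
    if "minimal_isometric_dilation (fibre E n) (ps_at k E A \<sigma> n) \<sigma> J' S' \<rho>'"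
    for J' :: "'v \<Rightarrow> 'k" and S' \<rho>'
    by (rule minimal_isometric_dilation_unique[OF corr[OF assms(6)] min that])
  ultimately show ?thesis by blast
qed

end
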